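(* Consider the advanced model (without $\mathbf{RandEdge}$ queries), where $n$ is unknown to the algorithm, and let $\varepsilon\in(0,1)$. (a) There is a randomized algorithm that outputs a $(1\pm\varepsilon)$-approximation to $n$ using $\widetilde{O}\left(\varepsilon^{-2}\sqrt{n/d}\right)$ queries. (b) Any algorithm that outputs a constant factor approximation to $n$ requires $\Omega(\sqrt{n/d})$ samples. This holds even in the stronger full adjacency model.
   Context: $G=(V,E)$ is an unknown simple undirected graph with $n=|V|$ vertices and $m=|E|$ edges, no isolated vertices, and average degree $d=2m/n$. Access to $G$ is only through oracles: - $\mathbf{RandVert}()$ returns a uniformly random vertex. - $\mathbf{RandNbr}(x)$ returns a uniformly random neighbor of $x$. - $\mathbf{Degree}(x)$ returns $\deg(x)$. - $\mathbf{Additive}(S)$, for $S\subseteq V$, returns the number of edges with both endpoints in $S$ and costs $|S|$. - $\mathbf{FullNbrHood}(x)$ returns the full adjacency list of $x$. All queries other than $\mathbf{Additive}$ cost $1$. The advanced model gives $\mathbf{RandVert}$, $\mathbf{RandNbr}$, $\mathbf{Degree}$ and $\mathbf{Additive}$. The full adjacency model gives $\mathbf{RandVert}$, $\mathbf{RandNbr}$, $\mathbf{Degree}$ and $\mathbf{FullNbrHood}$. "$n$ unknown" means the algorithm is not given $n$; vertex identifiers reveal no information about $n$. A $(1\pm\varepsilon)$-approximation to $n$ is a value in $[(1-\varepsilon)n,(1+\varepsilon)n]$. Randomized guarantees hold with probability at least $0.99$. $\widetilde{O}$ hides factors polylogarithmic in $n$. *)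

theory Defs
  imports "HOL-Probability.Probability" "HOL-Probability.SPMF"
begin

section \<open>Graphs\<close>

text \<open>
  Vertex identifiers are natural numbers, but the vertex set is an arbitrary finite set of
  naturals, so an identifier carries no information about the number of vertices: a guarantee
  required for all graphs is in particular required for every way of naming the vertices.
\<close>

record graph =
  verts :: "nat set"
  edges :: "nat set set"

definition simple_graph :: "graph \<Rightarrow> bool" where
  "simple_graph G \<longleftrightarrow>
     finite (verts G) \<and> verts G \<noteq> {} \<and> (\<forall>e \<in> edges G. e \<subseteq> verts G \<and> card e = 2)"

definition nbrs :: "graph \<Rightarrow> nat \<Rightarrow> nat set" where
  "nbrs G x = {y. {x, y} \<in> edges G}"

definition deg :: "graph \<Rightarrow> nat \<Rightarrow> nat" where
  "deg G x = card (nbrs G x)"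

definition no_isolated :: "graph \<Rightarrow> bool" where
  "no_isolated G \<longleftrightarrow> (\<forall>x \<in> verts G. nbrs G x \<noteq> {})"

definition input_graph :: "graph \<Rightarrow> bool" where
  "input_graph G \<longleftrightarrow> simple_graph G \<and> no_isolated G"

definition num_verts :: "graph \<Rightarrow> nat" where
  "num_verts G = card (verts G)"

definition num_edges :: "graph \<Rightarrow> nat" where
  "num_edges G = card (edges G)"

definition avg_deg :: "graph \<Rightarrow> real" where
  "avg_deg G = 2 * real (num_edges G) / real (num_verts G)"


section \<open>Oracles\<close>

datatype query = RandVert | RandNbr nat | Degree nat | Additive "nat set" | FullNbrHood nat

datatype answer = Vertex nat | Count nat | Vertices "nat set"

fun cost :: "query \<Rightarrow> nat" where
  "cost (Additive S) = card S"
| "cost _ = 1"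

text \<open>
  Answers are only meaningful for queries about vertices of the graph; the definition of an
  algorithm below excludes all others. The adjacency list of a vertex is returned without any
  particular order, as a set.
\<close>

fun response :: "graph \<Rightarrow> query \<Rightarrow> answer pmf" where
  "response G RandVert = map_pmf Vertex (pmf_of_set (verts G))"
| "response G (RandNbr x) = map_pmf Vertex (pmf_of_set (nbrs G x))"
| "response G (Degree x) = return_pmf (Count (deg G x))"
| "response G (Additive S) = return_pmf (Count (card {e \<in> edges G. e \<subseteq> S}))"
| "response G (FullNbrHood x) = return_pmf (Vertices (nbrs G x))"

definition advanced_model :: "query set" where
  "advanced_model = {RandVert} \<union> range RandNbr \<union> range Degree \<union> range Additive"

definition full_adjacency_model :: "query set" where
  "full_adjacency_model = {RandVert} \<union> range RandNbr \<union> range Degree \<union> range FullNbrHood"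


section \<open>Randomized query algorithms\<close>

type_synonym history = "(query \<times> answer) list"

datatype action = Ask query | Output real

text \<open>
  A strategy maps the interaction so far (oldest entry first) to a random next action. Its only
  access to the graph is through this history.
\<close>

type_synonym strategy = "history \<Rightarrow> action pmf"

fun query_verts :: "query \<Rightarrow> nat set" where
  "query_verts RandVert = {}"
| "query_verts (RandNbr x) = {x}"
| "query_verts (Degree x) = {x}"
| "query_verts (Additive S) = S"
| "query_verts (FullNbrHood x) = {x}"

fun answer_verts :: "answer \<Rightarrow> nat set" where
  "answer_verts (Vertex x) = {x}"
| "answer_verts (Count k) = {}"
| "answer_verts (Vertices S) = S"

definition seen :: "history \<Rightarrow> nat set" where
  "seen h = (\<Union>(q, a) \<in> set h. answer_verts a)"

text \<open>
  As the vertex set is unknown, an algorithm may only ask about vertices that some query has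
  already returned to it.
\<close>

definition algorithm :: "query set \<Rightarrow> strategy \<Rightarrow> bool" where
  "algorithm M A \<longleftrightarrow>
     (\<forall>h q. Ask q \<in> set_pmf (A h) \<longrightarrow> q \<in> M \<and> query_verts q \<subseteq> seen h)"

text \<open>
  The joint distribution of the complete interaction and the output, continuing from history
  \<open>h\<close>. The missing mass is the probability that the algorithm does not terminate.
\<close>

partial_function (spmf) run :: "graph \<Rightarrow> strategy \<Rightarrow> history \<Rightarrow> (history \<times> real) spmf" where
  "run G A h =
     bind_spmf (spmf_of_pmf (A h)) (\<lambda>act. case act of
         Output r \<Rightarrow> return_spmf (h, r)
       | Ask q \<Rightarrow> bind_spmf (spmf_of_pmf (response G q)) (\<lambda>a. run G A (h @ [(q, a)])))"

definition total_cost :: "history \<Rightarrow> nat" where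
  "total_cost h = (\<Sum>(q, a) \<leftarrow> h. cost q)"

text \<open>
  The probability that \<open>A\<close> terminates on \<open>G\<close> with an output \<open>r\<close> and a total query cost
  \<open>t\<close> such that \<open>P r t\<close>.
\<close>

definition run_prob :: "graph \<Rightarrow> strategy \<Rightarrow> (real \<Rightarrow> nat \<Rightarrow> bool) \<Rightarrow> real" where
  "run_prob G A P = measure (measure_spmf (run G A [])) {(h, r). P r (total_cost h)}"

definition eps_approx :: "real \<Rightarrow> real \<Rightarrow> nat \<Rightarrow> bool" where
  "eps_approx \<epsilon> r n \<longleftrightarrow> (1 - \<epsilon>) * real n \<le> r \<and> r \<le> (1 + \<epsilon>) * real n"

definition factor_approx :: "real \<Rightarrow> real \<Rightarrow> nat \<Rightarrow> bool" where
  "factor_approx c r n \<longleftrightarrow> real n / c \<le> r \<and> r \<le> c * real n"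

end

theory Submission
  imports Defs
begin

text \<open>
  Part (a). Let \<open>y\<close> be the vertex of largest degree \<open>D\<close> among about \<open>sqrt (n / d)\<close> random neighbours of
  random vertices. At least half of the edges are likely to be light, that is, to have no endpoint
  of degree above \<open>D\<close>. If \<open>D\<close> is at least about \<open>sqrt (n * d)\<close>, then \<open>n\<close> is estimated from the fraction
  \<open>D / n\<close> of random vertices that are adjacent to \<open>y\<close>. Otherwise both the number \<open>m'\<close> of light edges
  relative to \<open>n choose 2\<close>, which is the density seen by \<open>Additive\<close> among random vertices, and the
  average light degree \<open>2 * m' / n\<close> have estimators of small variance, and their quotient is \<open>n - 1\<close>.
  As \<open>sqrt (n / d)\<close> is unknown, the sample size is doubled until one of the counts is large enough to
  be trusted.

  Part (b). Take a graph \<open>G\<close> made of dense blocks, so that the squares of the block sizes add up to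
  \<open>O(m)\<close>, and \<open>N > c\<^sup>2\<close> disjoint copies of it. Choosing one of the copies of each block at random yields
  a graph isomorphic to \<open>G\<close>. As long as \<open>RandVert\<close> does not hit a block twice, the interaction with
  this random graph has the same distribution as the interaction with the \<open>N\<close> copies, where the
  correct outputs are different ones; and a block is hit twice only after about \<open>n / sqrt m\<close> samples.
\<close>

section \<open>Probabilities of runs\<close>

text \<open>The obstacle in part (a) is variance: the second moment of the number of edges among
  \<open>k\<close> random vertices has a term proportional to the maximum degree times
  \<open>k / n\<close>. This is why a heavy vertex is sought first. Either its hits are frequent and
  give \<open>n\<close> at once, or its degree is below about \<open>4 * n / k\<close>, and ignoring
  all heavier vertices tames both variances. A phase of the wrong scale has to abstain rather than
  err. So \<open>K\<close> and \<open>A\<close> are compared with twice the additive slack of their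
  estimates: passing the test makes the error relative, failing it bounds the true mean. Part (b) is
  a change of measure. The probability of a complete interaction is a product of factors of the
  strategy and factors of the graph, so two graphs can be compared history by history, for every
  adaptive strategy. Only upper bounds on events of terminating runs are carried from one graph to
  another, so the mass of non-terminating runs needs no separate treatment.\<close>

lemma emeasure_spmf_bind_pmf:
  "emeasure (measure_spmf (bind_pmf p f)) X = (\<integral>\<^sup>+a. emeasure (measure_spmf (f a)) X \<partial>measure_pmf p)"
  by (simp add: emeasure_measure_spmf_conv_measure_pmf)

lemma emeasure_return_spmf_eq: "emeasure (measure_spmf (return_spmf x)) X = indicator X x"
  by (simp add: emeasure_measure_spmf_conv_measure_pmf indicator_def image_iff)

lemma emeasure_run:
  "emeasure (measure_spmf (run G A h)) X =
    (\<integral>\<^sup>+act. (case act of Output r \<Rightarrow> indicator X (h, r)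
      | Ask q \<Rightarrow> \<integral>\<^sup>+a. emeasure (measure_spmf (run G A (h @ [(q, a)]))) X \<partial>measure_pmf (response G q)) \<partial>measure_pmf (A h))"
  by (subst run.simps) (auto simp: emeasure_spmf_bind_pmf emeasure_return_spmf_eq intro!: nn_integral_cong split: action.split)

text \<open>The hypotheses make \<open>\<Phi>\<close> a supermartingale along every interaction.\<close>

lemma emeasure_run_le:
  fixes \<Phi> :: "history \<Rightarrow> ennreal"
  assumes final: "\<And>h r. (h, r) \<in> X \<Longrightarrow> 1 \<le> \<Phi> h"
    and step: "\<And>h q. (\<integral>\<^sup>+a. \<Phi> (h @ [(q, a)]) \<partial>measure_pmf (response G q)) \<le> \<Phi> h"
  shows "emeasure (measure_spmf (run G A h)) X \<le> \<Phi> h"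
proof -
  have "\<forall>h. emeasure (measure_spmf (run G A h)) X \<le> \<Phi> h"
  \<comment> \<open>\<open>run\<close> is a least fixed point: the bound has to hold at bottom,
    survive suprema of chains and be preserved by one unfolding. Mass lost to non-termination only
    helps.\<close>
  proof (induction rule: run.fixp_induct)
    case 1
    show ?case
    proof (rule ccpo.admissibleI, intro allI)
      fix Y :: "((graph \<times> strategy) \<times> history \<Rightarrow> (history \<times> real) spmf) set" and h
      assume chain: "Complete_Partial_Order.chain (fun_ord (ord_spmf (=))) Y"
        and ne: "Y \<noteq> {}" and le: "\<forall>x\<in>Y. \<forall>h. emeasure (measure_spmf (curry (curry x) G A h)) X \<le> \<Phi> h"
      let ?Z = "(\<lambda>f. f ((G, A), h)) ` Y"
      have "Complete_Partial_Order.chain (ord_spmf (=)) ?Z"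
        using chain by (force simp: Complete_Partial_Order.chain_def fun_ord_def)
      then have "emeasure (measure_spmf (lub_spmf ?Z)) X = (SUP y\<in>?Z. emeasure (measure_spmf y) X)"
        using ne by (intro emeasure_lub_spmf) auto
      also have "\<dots> \<le> \<Phi> h" using le by (auto intro!: SUP_least)
      also have "lub_spmf ?Z = curry (curry (fun_lub lub_spmf Y)) G A h"
        by (auto simp: fun_lub_def intro!: arg_cong[where f=lub_spmf])
      finally show "emeasure (measure_spmf (curry (curry (fun_lub lub_spmf Y)) G A h)) X \<le> \<Phi> h" .
    qed
  next
    case 2
    show ?case by (simp add: emeasure_measure_spmf_conv_measure_pmf)
  next
    case (3 rec)
    show ?case
    proof
      fix h
      let ?g = "\<lambda>act. emeasure (measure_spmf (case act of Output r \<Rightarrow> return_spmf (h, r)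
         | Ask q \<Rightarrow> bind_pmf (response G q) (\<lambda>a. rec G A (h @ [(q, a)])))) X"
      have le: "?g act \<le> \<Phi> h" for act
      proof (cases act)
        case (Ask q)
        have "(\<integral>\<^sup>+a. emeasure (measure_spmf (rec G A (h @ [(q, a)]))) X \<partial>measure_pmf (response G q))
           \<le> (\<integral>\<^sup>+a. \<Phi> (h @ [(q, a)]) \<partial>measure_pmf (response G q))"
          using 3 by (intro nn_integral_mono) auto
        then show ?thesis using Ask step[where h=h and q=q] by (simp add: emeasure_spmf_bind_pmf)
      next
        case (Output r)
        then show ?thesis using final[of h r] by (auto simp: emeasure_return_spmf_eq indicator_def)
      qed
      have "(\<integral>\<^sup>+act. ?g act \<partial>measure_pmf (A h)) \<le> (\<integral>\<^sup>+act. \<Phi> h \<partial>measure_pmf (A h))"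
        using le by (intro nn_integral_mono) auto
      also have "\<dots> = \<Phi> h" by simp
      finally show "emeasure (measure_spmf (spmf_of_pmf (A h) \<bind> (\<lambda>act. case act of Output r \<Rightarrow> return_spmf (h, r)
         | Ask q \<Rightarrow> spmf_of_pmf (response G q) \<bind> (\<lambda>a. rec G A (h @ [(q, a)]))))) X \<le> \<Phi> h"
        by (simp add: emeasure_spmf_bind_pmf cong: action.case_cong)
    qed
  qed
  then show ?thesis by blast
qed

text \<open>Histories only grow, so the indicator of not extending \<open>h\<close> is itself a
  potential, and it is 0 at \<open>h\<close>.\<close>

lemma emeasure_run_extends:
  "emeasure (measure_spmf (run G A h)) {(h', r). \<not> (\<exists>l. h' = h @ l)} = 0"
proof -
  let ?\<Phi> = "\<lambda>h'. if \<exists>l. h' = h @ l then 0 else 1 :: ennreal"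
  have "emeasure (measure_spmf (run G A h)) {(h', r). \<not> (\<exists>l. h' = h @ l)} \<le> ?\<Phi> h"
  proof (rule emeasure_run_le[where \<Phi> = ?\<Phi>])
    fix h' q
    show "(\<integral>\<^sup>+a. ?\<Phi> (h' @ [(q, a)]) \<partial>measure_pmf (response G q)) \<le> ?\<Phi> h'"
    proof (cases "\<exists>l. h' = h @ l")
      case True
      then have "\<exists>l. h' @ [(q, a)] = h @ l" for a by auto
      then show ?thesis by simp
    next
      case False
      have "(\<integral>\<^sup>+a. ?\<Phi> (h' @ [(q, a)]) \<partial>measure_pmf (response G q)) \<le> (\<integral>\<^sup>+a. 1 \<partial>measure_pmf (response G q))"
        by (intro nn_integral_mono) auto
      then show ?thesis using False by simp
    qed
  qed auto
  then show ?thesis by (auto split: if_splits)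
qed

lemma emeasure_run_extends_0:
  assumes "\<And>h' r. (h', r) \<in> X \<Longrightarrow> \<not> (\<exists>l. h' = h @ l)"
  shows "emeasure (measure_spmf (run G A h)) X = 0"
proof -
  have "emeasure (measure_spmf (run G A h)) X \<le> emeasure (measure_spmf (run G A h)) {(h', r). \<not> (\<exists>l. h' = h @ l)}"
    using assms by (intro emeasure_mono) auto
  then show ?thesis by (metis emeasure_run_extends le_zero_eq)
qed

lemma nn_integral_pmf_single:
  assumes "\<And>y. y \<noteq> x \<Longrightarrow> f y = 0"
  shows "(\<integral>\<^sup>+y. f y \<partial>measure_pmf p) = ennreal (pmf p x) * f x"
proof -
  have "(\<integral>\<^sup>+y. f y \<partial>measure_pmf p) = (\<integral>\<^sup>+y. f x * indicator {x} y \<partial>measure_pmf p)"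
    using assms by (intro nn_integral_cong) (auto simp: indicator_def)
  also have "\<dots> = f x * ennreal (pmf p x)"
    by (subst nn_integral_cmult_indicator) (auto simp: emeasure_pmf_single)
  finally show ?thesis by (simp add: mult.commute)
qed

section \<open>Factorisation of the probability of an interaction\<close>

primrec strategy_factor :: "strategy \<Rightarrow> history \<Rightarrow> history \<Rightarrow> ennreal" where
  "strategy_factor A h [] = 1"
| "strategy_factor A h (qa # l) = ennreal (pmf (A h) (Ask (fst qa))) * strategy_factor A (h @ [qa]) l"

primrec graph_factor :: "graph \<Rightarrow> history \<Rightarrow> ennreal" where
  "graph_factor G [] = 1"
| "graph_factor G (qa # l) = ennreal (pmf (response G (fst qa)) (snd qa)) * graph_factor G l"

text \<open>A history records every query and answer, so at each step a single action and a single
  answer lead to it, and the integrals in \<open>emeasure_run\<close> collapse to one term. The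
  factor of the graph does not mention \<open>A\<close>.\<close>

lemma spmf_run:
  "ennreal (spmf (run G A h) (h @ l, r)) =
     strategy_factor A h l * graph_factor G l * ennreal (pmf (A (h @ l)) (Output r))"
proof (induction l arbitrary: h)
  case Nil
  have "ennreal (spmf (run G A h) (h, r)) = emeasure (measure_spmf (run G A h)) {(h, r)}"
    by (simp add: emeasure_spmf_single)
  also have "\<dots> = ennreal (pmf (A h) (Output r))"
  proof (subst emeasure_run, subst nn_integral_pmf_single[where x = "Output r"])
    have "emeasure (measure_spmf (run G A (h @ [qa]))) {(h, r)} = 0" for qa
      by (rule emeasure_run_extends_0) auto
    then show "(case act of Output r' \<Rightarrow> indicator {(h, r)} (h, r')
      | Ask q \<Rightarrow> \<integral>\<^sup>+a. emeasure (measure_spmf (run G A (h @ [(q, a)]))) {(h, r)} \<partial>measure_pmf (response G q)) = 0"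
      if "act \<noteq> Output r" for act
      using that by (auto simp: indicator_def split: action.split if_splits)
  qed simp
  finally show ?case by simp
next
  case (Cons qa l)
  obtain q a where qa: "qa = (q, a)" by force
  have "ennreal (spmf (run G A h) (h @ qa # l, r)) = emeasure (measure_spmf (run G A h)) {(h @ qa # l, r)}"
    by (simp add: emeasure_spmf_single)
  also have "\<dots> = ennreal (pmf (A h) (Ask q)) * (\<integral>\<^sup>+a. emeasure (measure_spmf (run G A (h @ [(q, a)]))) {(h @ qa # l, r)} \<partial>measure_pmf (response G q))"
  proof (subst emeasure_run, subst nn_integral_pmf_single[where x = "Ask q"])
    have [simp]: "emeasure (measure_spmf (run G A (h @ [(q', a')]))) {(h @ qa # l, r)} = 0" if "q' \<noteq> q" for q' a'
      using that by (intro emeasure_run_extends_0) (auto simp: qa)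
    then show "(case act of Output r' \<Rightarrow> indicator {(h @ qa # l, r)} (h, r')
      | Ask q' \<Rightarrow> \<integral>\<^sup>+a'. emeasure (measure_spmf (run G A (h @ [(q', a')]))) {(h @ qa # l, r)} \<partial>measure_pmf (response G q')) = 0"
      if "act \<noteq> Ask q" for act
    proof (cases act)
      case (Ask q')
      then show ?thesis using that by simp
    qed (simp add: indicator_def)
  qed simp
  also have "(\<integral>\<^sup>+a. emeasure (measure_spmf (run G A (h @ [(q, a)]))) {(h @ qa # l, r)} \<partial>measure_pmf (response G q))
    = ennreal (pmf (response G q) a) * emeasure (measure_spmf (run G A (h @ [(q, a)]))) {(h @ qa # l, r)}"
    by (intro nn_integral_pmf_single emeasure_run_extends_0) (auto simp: qa)
  also have "emeasure (measure_spmf (run G A (h @ [(q, a)]))) {(h @ qa # l, r)} = ennreal (spmf (run G A (h @ [qa])) ((h @ [qa]) @ l, r))"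
    by (simp add: emeasure_spmf_single qa)
  finally show ?case by (subst (asm) Cons) (simp add: qa ac_simps)
qed

lemma emeasure_run_Nil:
  "emeasure (measure_spmf (run G A [])) X =
    (\<integral>\<^sup>+(h, r). strategy_factor A [] h * graph_factor G h * ennreal (pmf (A h) (Output r)) * indicator X (h, r) \<partial>count_space UNIV)"
proof -
  have "emeasure (measure_spmf (run G A [])) X = (\<integral>\<^sup>+x. indicator X x \<partial>measure_spmf (run G A []))"
    by simp
  also have "\<dots> = (\<integral>\<^sup>+x. ennreal (spmf (run G A []) x) * indicator X x \<partial>count_space UNIV)"
    by (rule nn_integral_measure_spmf)
  also have "\<dots> = (\<integral>\<^sup>+(h, r). strategy_factor A [] h * graph_factor G h * ennreal (pmf (A h) (Output r)) * indicator X (h, r) \<partial>count_space UNIV)"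
    using spmf_run[of G A "[]"] by (intro nn_integral_cong) (auto split: prod.split)
  finally show ?thesis .
qed

section \<open>The lower bound\<close>

primrec legal :: "nat set \<Rightarrow> history \<Rightarrow> bool" where
  "legal V [] \<longleftrightarrow> True"
| "legal V (qa # l) \<longleftrightarrow> query_verts (fst qa) \<subseteq> V \<and> legal (V \<union> answer_verts (snd qa)) l"

lemma seen_Nil [simp]: "seen [] = {}"
  and seen_snoc [simp]: "seen (h @ [(q, a)]) = seen h \<union> answer_verts a"
  by (auto simp: seen_def)

text \<open>Restricts the comparison of graphs to histories whose queries concern vertices returned
  earlier; for these the graphs agree on all answers but those of \<open>RandVert\<close>.\<close>

lemma strategy_factor_legal:
  assumes "algorithm M A" "strategy_factor A h l \<noteq> 0"
  shows "legal (seen h) l"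
  using assms(2)
proof (induction l arbitrary: h)
  case (Cons qa l)
  obtain q a where qa: "qa = (q, a)" by force
  have "pmf (A h) (Ask q) \<noteq> 0" and "legal (seen h \<union> answer_verts a) l"
    using Cons.prems Cons.IH[of "h @ [qa]"] by (auto simp: qa)
  then show ?case using assms(1) by (auto simp: algorithm_def set_pmf_iff qa)
qed simp

fun sampled :: "history \<Rightarrow> nat list" where
  "sampled [] = []"
| "sampled ((RandVert, Vertex x) # l) = x # sampled l"
| "sampled (qa # l) = sampled l"

lemma sampled_append: "sampled (h @ h') = sampled h @ sampled h'"
  by (induction h rule: sampled.induct) auto

lemma sampled_other: "q \<noteq> RandVert \<Longrightarrow> sampled ((q, a) # l) = sampled l"
  by (cases q; cases a) auto

lemma nn_integral_randvert:
  assumes "finite V" "V \<noteq> {}"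
  shows "(\<integral>\<^sup>+a. f a \<partial>measure_pmf (map_pmf Vertex (pmf_of_set V))) = (\<Sum>x\<in>V. f (Vertex x)) / card V"
  using assms by (simp add: nn_integral_pmf_of_set)

lemma pmf_randvert:
  assumes "finite V" "V \<noteq> {}"
  shows "pmf (map_pmf Vertex (pmf_of_set V)) (Vertex x) = (if x \<in> V then 1 / card V else 0)"
  using assms by (simp add: pmf_map_inj' inj_def indicator_def)

text \<open>
  A union \<open>G\<close> of components of \<open>H\<close> can only be told apart from \<open>H\<close> through the vertices returned
  by \<open>RandVert\<close>.
\<close>

locale component_union =
  fixes G H :: graph and N :: nat
  assumes finite_H: "finite (verts H)" and verts_sub: "verts G \<subseteq> verts H"
    and input_G: "input_graph G"
    and card_H: "card (verts H) = N * card (verts G)"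
    and edges_G: "edges G = {e \<in> edges H. e \<subseteq> verts G}"
    and closed: "\<And>e. e \<in> edges H \<Longrightarrow> e \<inter> verts G \<noteq> {} \<Longrightarrow> e \<subseteq> verts G"
begin

lemma finite_G: "finite (verts G)" and G_nonempty: "verts G \<noteq> {}"
  using input_G by (auto simp: input_graph_def simple_graph_def)

lemma nbrs_eq: "x \<in> verts G \<Longrightarrow> nbrs G x = nbrs H x"
  using edges_G closed by (auto simp: nbrs_def)

lemma nbrs_sub: "nbrs G x \<subseteq> verts G"
  using edges_G by (auto simp: nbrs_def)

lemma response_eq:
  assumes "q \<noteq> RandVert" "query_verts q \<subseteq> verts G"
  shows "response G q = response H q"
proof (cases q)
  case (Additive S)
  have "{e \<in> edges G. e \<subseteq> S} = {e \<in> edges H. e \<subseteq> S}"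
    using assms Additive edges_G by auto
  then show ?thesis using Additive by simp
qed (use assms nbrs_eq in \<open>auto simp: deg_def\<close>)

lemma answer_sub:
  assumes "query_verts q \<subseteq> verts G" "a \<in> set_pmf (response G q)"
  shows "answer_verts a \<subseteq> verts G"
proof (cases q)
  case RandVert
  then show ?thesis using assms finite_G G_nonempty by auto
next
  case (RandNbr x)
  have "finite (nbrs G x)" "nbrs G x \<noteq> {}"
    using RandNbr assms finite_subset[OF nbrs_sub finite_G] input_G
    by (auto simp: input_graph_def no_isolated_def)
  then show ?thesis using RandNbr assms by (auto dest: subsetD[OF nbrs_sub])
qed (use assms nbrs_sub in auto)

text \<open>Legality keeps every query inside \<open>verts G\<close>, because no answer of
  \<open>G\<close> leads out of it, and there both graphs answer alike except to
  \<open>RandVert\<close>. A vertex of \<open>G\<close> is returned by \<open>RandVert\<close> with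
  \<open>N\<close> times its probability in \<open>H\<close>, by \<open>card_H\<close>; any other
  vertex has probability 0 in \<open>G\<close>.\<close>

lemma graph_factor_le:
  assumes "legal V l" "V \<subseteq> verts G"
  shows "graph_factor G l \<le>
    (if set (sampled l) \<subseteq> verts G then ennreal (real N ^ length (sampled l)) * graph_factor H l else 0)"
  using assms
proof (induction l arbitrary: V)
  case (Cons qa l)
  obtain q a where qa: "qa = (q, a)" by force
  show ?case
  proof (cases "a \<in> set_pmf (response G q)")
    case False
    then show ?thesis by (simp add: qa set_pmf_iff)
  next
    case True
    have q: "query_verts q \<subseteq> verts G" using Cons.prems by (auto simp: qa)
    have IH: "graph_factor G l \<le>
      (if set (sampled l) \<subseteq> verts G then ennreal (real N ^ length (sampled l)) * graph_factor H l else 0)"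
      using Cons.prems answer_sub[OF q True] by (intro Cons.IH[of "V \<union> answer_verts a"]) (auto simp: qa)
    show ?thesis
    proof (cases "q = RandVert")
      case False
      have "graph_factor G (qa # l) = ennreal (pmf (response H q) a) * graph_factor G l"
        using response_eq[OF False q] by (simp add: qa)
      also have "\<dots> \<le> ennreal (pmf (response H q) a) *
          (if set (sampled l) \<subseteq> verts G then ennreal (real N ^ length (sampled l)) * graph_factor H l else 0)"
        by (intro mult_left_mono IH) auto
      finally show ?thesis using False by (auto simp: qa sampled_other mult_ac split: if_splits)
    next
      case rv: True
      then obtain x where x: "a = Vertex x" "x \<in> verts G"
        using True finite_G G_nonempty by auto
      have cG: "card (verts G) > 0" using finite_G G_nonempty by (simp add: card_gt_0_iff)
      have "verts H \<noteq> {}" using verts_sub G_nonempty by auto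
      then have N: "N > 0" using card_H finite_H by (metis card_eq_0_iff mult_is_0 neq0_conv)
      have "ennreal (pmf (response G q) a) = ennreal (real N) * ennreal (pmf (response H q) a)"
        using x verts_sub finite_H finite_G G_nonempty \<open>verts H \<noteq> {}\<close> N
        by (auto simp: rv pmf_randvert card_H simp flip: ennreal_mult)
      then have "graph_factor G (qa # l) = ennreal (real N) * ennreal (pmf (response H q) a) * graph_factor G l"
        by (simp add: qa)
      also have "\<dots> \<le> ennreal (real N) * ennreal (pmf (response H q) a) *
          (if set (sampled l) \<subseteq> verts G then ennreal (real N ^ length (sampled l)) * graph_factor H l else 0)"
        by (intro mult_left_mono IH) auto
      finally show ?thesis by (auto simp: qa rv x ennreal_mult mult_ac split: if_splits)
    qed
  qed
qed simp

end

text \<open>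
  The potential is the expected number of future pairs of sampled vertices in the same block.
\<close>

lemma emeasure_run_collision:
  fixes \<kappa> :: "nat \<Rightarrow> 'b" and J :: nat
  assumes fin: "finite (verts G)" "verts G \<noteq> {}"
  defines "w \<equiv> \<lambda>x. real (card {y \<in> verts G. \<kappa> y = \<kappa> x}) / card (verts G)"
  defines "W \<equiv> (\<Sum>x\<in>verts G. w x) / card (verts G)"
  shows "emeasure (measure_spmf (run G A []))
     {(h, r). \<not> distinct (map \<kappa> (sampled h)) \<and> length (sampled h) \<le> J} \<le> ennreal (real J * (real J - 1) / 2 * W)"
proof -
  let ?n = "card (verts G)"
  have n: "?n > 0" using fin by (simp add: card_gt_0_iff)
  have w0: "w x \<ge> 0" for x by (simp add: w_def)
  have W0: "W \<ge> 0" by (auto simp: W_def intro!: divide_nonneg_nonneg sum_nonneg w0)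
  define R :: "history \<Rightarrow> real" where "R = (\<lambda>h. real J - real (length (sampled h)))"
  \<comment> \<open>\<open>R h\<close> draws are left. Each meets the block of an earlier draw
    \<open>v\<close> with probability \<open>w v\<close>, and two of them meet each other with
    probability \<open>W\<close>. The value 0 beyond \<open>J\<close> draws is allowed because the
    event asks for at most \<open>J\<close>.\<close>
  define \<Psi> :: "history \<Rightarrow> real" where "\<Psi> = (\<lambda>h. if length (sampled h) > J then 0
     else if \<not> distinct (map \<kappa> (sampled h)) then 1
     else R h * sum_list (map w (sampled h)) + R h * (R h - 1) / 2 * W)"
  have pos: "\<Psi> h \<ge> 0" for h
  proof -
    consider "length (sampled h) > J" | "length (sampled h) = J" | "real (length (sampled h)) + 1 \<le> J" by linarith
    then show ?thesis
    proof cases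
      case 3
      then have "R h \<ge> 1" by (simp add: R_def)
      then show ?thesis using W0 w0 by (auto simp: \<Psi>_def intro!: add_nonneg_nonneg mult_nonneg_nonneg sum_list_nonneg)
    qed (auto simp: \<Psi>_def R_def)
  qed
  have step: "(\<integral>\<^sup>+a. ennreal (\<Psi> (h @ [(q, a)])) \<partial>measure_pmf (response G q)) \<le> ennreal (\<Psi> h)" for h q
  proof (cases "q = RandVert")
    case False
    then have "\<Psi> (h @ [(q, a)]) = \<Psi> h" for a by (simp add: \<Psi>_def R_def sampled_append sampled_other)
    then show ?thesis by simp
  next
    case True
    have "(\<integral>\<^sup>+a. ennreal (\<Psi> (h @ [(q, a)])) \<partial>measure_pmf (response G q)) =
        (\<Sum>x\<in>verts G. ennreal (\<Psi> (h @ [(q, Vertex x)]))) / ?n"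
      using fin by (simp add: True nn_integral_randvert del: nn_integral_map_pmf)
    also have "\<dots> = ennreal ((\<Sum>x\<in>verts G. \<Psi> (h @ [(q, Vertex x)])) / ?n)"
      using n pos by (simp add: divide_ennreal sum_nonneg ennreal_of_nat_eq_real_of_nat)
    also have "(\<Sum>x\<in>verts G. \<Psi> (h @ [(q, Vertex x)])) / ?n \<le> \<Psi> h"
    proof -
      consider "length (sampled h) \<ge> J" | "length (sampled h) < J" "\<not> distinct (map \<kappa> (sampled h))"
         | "length (sampled h) < J" "distinct (map \<kappa> (sampled h))" by linarith
      then show ?thesis
      proof cases
        case 1
        then have "\<Psi> (h @ [(q, Vertex x)]) = 0" for x by (simp add: \<Psi>_def True sampled_append)
        then show ?thesis using pos[of h] by simp
      next
        case 2
        then have "\<Psi> (h @ [(q, Vertex x)]) = 1" for x by (simp add: \<Psi>_def True sampled_append)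
        moreover have "\<Psi> h = 1" using 2 by (simp add: \<Psi>_def)
        ultimately show ?thesis using n by simp
      next
        case 3
        let ?S = "sum_list (map w (sampled h))"
        let ?r = "R h"
        have r: "?r \<ge> 1" using 3 by (simp add: R_def)
        define B where "B = (\<lambda>x. if \<kappa> x \<in> \<kappa> ` set (sampled h) then 1 else 0 :: real)"
        have le: "\<Psi> (h @ [(q, Vertex x)]) \<le> B x + (?r - 1) * (?S + w x) + (?r - 1) * (?r - 2) / 2 * W" for x
        proof -
          have R': "R (h @ [(q, Vertex x)]) = ?r - 1" by (simp add: R_def True sampled_append)
          have S': "sum_list (map w (sampled (h @ [(q, Vertex x)]))) = ?S + w x" by (simp add: True sampled_append)
          have nn: "0 \<le> (?r - 1) * (?S + w x) + (?r - 1) * (?r - 2) / 2 * W"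
          proof -
            \<comment> \<open>\<open>?r\<close> is a positive integer, hence 1 or at least
              2.\<close>
            have "(?r - 1) * (?r - 2) \<ge> 0"
            proof (cases "Suc (length (sampled h)) = J")
              case False
              then have "?r \<ge> 2" using 3 by (simp add: R_def)
              then show ?thesis by simp
            qed (auto simp: R_def)
            then show ?thesis using r w0 W0 by (auto intro!: add_nonneg_nonneg mult_nonneg_nonneg sum_list_nonneg)
          qed
          show ?thesis
          proof (cases "\<kappa> x \<in> \<kappa> ` set (sampled h)")
            case T: True
            then have "\<Psi> (h @ [(q, Vertex x)]) = 1" using 3 by (auto simp: \<Psi>_def True sampled_append)
            then show ?thesis using nn T by (simp add: B_def)
          next
            case F: False
            then have "\<Psi> (h @ [(q, Vertex x)]) = R (h @ [(q, Vertex x)]) * sum_list (map w (sampled (h @ [(q, Vertex x)])))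
                + R (h @ [(q, Vertex x)]) * (R (h @ [(q, Vertex x)]) - 1) / 2 * W"
              using 3 by (auto simp: \<Psi>_def True sampled_append)
            then show ?thesis unfolding R' S' using F by (simp add: B_def)
          qed
        qed
        have B: "(\<Sum>x\<in>verts G. B x) \<le> ?n * ?S"
        proof -
          have "(\<Sum>x\<in>verts G. B x) \<le> (\<Sum>x\<in>verts G. \<Sum>v\<leftarrow>sampled h. if \<kappa> x = \<kappa> v then 1 else 0)"
          proof (rule sum_mono)
            fix x
            show "B x \<le> (\<Sum>v\<leftarrow>sampled h. if \<kappa> x = \<kappa> v then 1 else 0)"
            proof -
              have "(if \<kappa> x \<in> \<kappa> ` set xs then 1 else 0 :: real) \<le> (\<Sum>v\<leftarrow>xs. if \<kappa> x = \<kappa> v then 1 else 0)" for xs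
                by (induction xs) (auto intro!: sum_list_nonneg)
              then show ?thesis by (simp add: B_def)
            qed
          qed
          also have "\<dots> = (\<Sum>v\<leftarrow>sampled h. \<Sum>x\<in>verts G. if \<kappa> x = \<kappa> v then 1 else 0)"
          proof -
            have "(\<Sum>x\<in>verts G. \<Sum>v\<leftarrow>xs. if \<kappa> x = \<kappa> v then 1 else 0 :: real) =
              (\<Sum>v\<leftarrow>xs. \<Sum>x\<in>verts G. if \<kappa> x = \<kappa> v then 1 else 0)" for xs
              by (induction xs) (auto simp: sum.distrib)
            then show ?thesis .
          qed
          also have "\<dots> = (\<Sum>v\<leftarrow>sampled h. ?n * w v)"
            using n fin by (simp add: w_def sum.If_cases Int_def)
          also have "\<dots> = ?n * ?S" by (simp add: sum_list_const_mult)
          finally show ?thesis .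
        qed
        have "(\<Sum>x\<in>verts G. \<Psi> (h @ [(q, Vertex x)])) \<le>
            (\<Sum>x\<in>verts G. B x + (?r - 1) * (?S + w x) + (?r - 1) * (?r - 2) / 2 * W)"
          by (intro sum_mono le)
        also have "\<dots> = (\<Sum>x\<in>verts G. B x) + (?r - 1) * (?n * ?S + ?n * W) + ?n * ((?r - 1) * (?r - 2) / 2 * W)"
          using n by (simp add: sum.distrib W_def flip: sum_distrib_left)
        also have "\<dots> \<le> ?n * ?S + (?r - 1) * (?n * ?S + ?n * W) + ?n * ((?r - 1) * (?r - 2) / 2 * W)"
          using B by simp
        also have "\<dots> = ?n * (?r * ?S + ?r * (?r - 1) / 2 * W)" by (simp add: field_simps)
        also have "\<dots> = ?n * \<Psi> h" using 3 by (simp add: \<Psi>_def)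
        finally show ?thesis using n by (simp add: field_simps)
      qed
    qed
    finally show ?thesis by (simp add: ennreal_leI)
  qed
  have "emeasure (measure_spmf (run G A []))
     {(h, r). \<not> distinct (map \<kappa> (sampled h)) \<and> length (sampled h) \<le> J} \<le> ennreal (\<Psi> [])"
    by (rule emeasure_run_le[where \<Phi> = "\<lambda>h. ennreal (\<Psi> h)", OF _ step]) (auto simp: \<Psi>_def)
  also have "\<Psi> [] = real J * (real J - 1) / 2 * W" by (simp add: \<Psi>_def R_def)
  finally show ?thesis .
qed

text \<open>Elements of different blocks constrain \<open>f\<close> at different arguments, and each
  constraint leaves at most one of \<open>N\<close> values. Equality may fail because
  \<open>c x\<close> can lie outside \<open>{..<N}\<close>.\<close>

lemma card_consistent_choices:
  assumes "finite B" "distinct (map \<kappa> xs)" "\<kappa> ` set xs \<subseteq> B"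
  shows "card {f \<in> B \<rightarrow>\<^sub>E {..<N}. \<forall>x\<in>set xs. f (\<kappa> x) = c x} * N ^ length xs \<le> N ^ card B"
proof -
  let ?K = "\<kappa> ` set xs"
  let ?c = "\<lambda>b. c (inv_into (set xs) \<kappa> b)"
  have inj: "inj_on \<kappa> (set xs)" using assms(2) by (simp add: distinct_map)
  have K: "card ?K = length xs" using assms(2) by (metis distinct_card length_map set_map)
  have "{f \<in> B \<rightarrow>\<^sub>E {..<N}. \<forall>x\<in>set xs. f (\<kappa> x) = c x} \<subseteq> (\<Pi>\<^sub>E b\<in>B. if b \<in> ?K then {?c b} else {..<N})"
  proof (intro subsetI PiE_I)
    fix f b assume f: "f \<in> {f \<in> B \<rightarrow>\<^sub>E {..<N}. \<forall>x\<in>set xs. f (\<kappa> x) = c x}"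
    show "f b \<in> (if b \<in> ?K then {?c b} else {..<N})" if "b \<in> B"
    proof (cases "b \<in> ?K")
      case True
      then obtain x where "x \<in> set xs" "b = \<kappa> x" by blast
      then show ?thesis using f inj by (simp add: inv_into_f_f)
    qed (use f that in auto)
    show "f b = undefined" if "b \<notin> B" using f that by auto
  qed
  then have "card {f \<in> B \<rightarrow>\<^sub>E {..<N}. \<forall>x\<in>set xs. f (\<kappa> x) = c x} \<le> card (\<Pi>\<^sub>E b\<in>B. if b \<in> ?K then {?c b} else {..<N})"
    using assms(1) by (intro card_mono finite_PiE) auto
  also have "\<dots> = (\<Prod>b\<in>B. if b \<in> ?K then 1 else N)"
    using assms(1) by (subst card_PiE) (auto intro!: prod.cong)
  also have "\<dots> = N ^ card (B - ?K)" using assms(1) by (simp add: prod.If_cases Diff_eq)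
  also have "card (B - ?K) = card B - length xs" using assms K by (simp add: card_Diff_subset)
  finally have "card {f \<in> B \<rightarrow>\<^sub>E {..<N}. \<forall>x\<in>set xs. f (\<kappa> x) = c x} * N ^ length xs \<le> N ^ (card B - length xs) * N ^ length xs"
    by (rule mult_right_mono) simp
  also have "\<dots> = N ^ card B"
    using assms K card_mono[of B ?K] by (simp flip: power_add)
  finally show ?thesis .
qed

section \<open>Placing the blocks of a graph into copies of it\<close>

locale blocked_graph =
  fixes n :: nat and E :: "nat set set" and \<kappa> :: "nat \<Rightarrow> nat"
  assumes input: "input_graph \<lparr>verts = {..<n}, edges = E\<rparr>"
    and block: "\<And>e u v. e \<in> E \<Longrightarrow> u \<in> e \<Longrightarrow> v \<in> e \<Longrightarrow> \<kappa> u = \<kappa> v"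
begin

lemma n_pos: "n > 0" using input by (cases n) (auto simp: input_graph_def simple_graph_def)

lemma edgeD: "e \<in> E \<Longrightarrow> e \<subseteq> {..<n}" "e \<in> E \<Longrightarrow> card e = 2"
  and nbr_ex: "v < n \<Longrightarrow> \<exists>u. {v, u} \<in> E"
  using input by (auto simp: input_graph_def simple_graph_def no_isolated_def nbrs_def)

text \<open>Base-\<open>n\<close> coding: the remainder is the original vertex, the quotient the
  number of its copy. Since \<open>f\<close> is applied to the block, a block moves as a
  whole.\<close>

definition place :: "(nat \<Rightarrow> nat) \<Rightarrow> nat \<Rightarrow> nat" where
  "place f v = v + n * f (\<kappa> v)"

definition scattered :: "(nat \<Rightarrow> nat) \<Rightarrow> graph" where
  "scattered f = \<lparr>verts = place f ` {..<n}, edges = image (place f) ` E\<rparr>"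

definition copies :: "nat \<Rightarrow> graph" where
  "copies N = \<lparr>verts = {..<n * N}, edges = (\<Union>c<N. image (\<lambda>v. v + n * c) ` E)\<rparr>"

lemma place_mod [simp]: "v < n \<Longrightarrow> place f v mod n = v"
  and place_div [simp]: "v < n \<Longrightarrow> place f v div n = f (\<kappa> v)"
  by (auto simp: place_def)

lemma inj_place: "inj_on (place f) {..<n}"
  by (rule inj_on_inverseI[of _ "\<lambda>x. x mod n"]) auto

text \<open>Membership of \<open>x\<close> is one condition on \<open>f\<close> at one block; this
  is how samples become constraints on the placement.\<close>

lemma verts_scattered: "x \<in> verts (scattered f) \<longleftrightarrow> x div n = f (\<kappa> (x mod n))"
proof
  assume "x div n = f (\<kappa> (x mod n))"
  then have "x = place f (x mod n)" by (metis place_def add.commute mult.commute div_mult_mod_eq)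
  then show "x \<in> verts (scattered f)" using n_pos by (auto simp: scattered_def)
qed (auto simp: scattered_def)

lemma num_verts_scattered: "num_verts (scattered f) = n"
  by (simp add: num_verts_def scattered_def card_image inj_place)

lemma num_edges_scattered: "num_edges (scattered f) = card E"
proof -
  have "inj_on (image (place f)) E"
    using edgeD(1) by (intro inj_on_subset[OF inj_on_image_Pow[OF inj_place]]) auto
  then show ?thesis by (simp add: num_edges_def scattered_def card_image)
qed

lemma input_scattered: "input_graph (scattered f)"
proof -
  have "card (place f ` e) = 2" if "e \<in> E" for e
    using edgeD[OF that] by (metis card_image inj_on_subset inj_place)
  moreover have "\<exists>y. {place f v, y} \<in> image (place f) ` E" if "v < n" for v
  proof -
    obtain u where "{v, u} \<in> E" using nbr_ex \<open>v < n\<close> by blast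
    then have "{place f v, place f u} \<in> image (place f) ` E" by (auto intro!: image_eqI[of _ _ "{v, u}"])
    then show ?thesis by blast
  qed
  moreover have "place f ` e \<subseteq> place f ` {..<n}" if "e \<in> E" for e
    using edgeD(1)[OF that] by blast
  ultimately show ?thesis using n_pos
    by (simp add: input_graph_def simple_graph_def no_isolated_def nbrs_def scattered_def lessThan_empty_iff)
qed

lemma shift_less: "v < n \<Longrightarrow> c < N \<Longrightarrow> v + n * c < n * (N::nat)"
  by (metis add.commute add_less_cancel_right mult_Suc_right mult_le_mono2 Suc_leI order_less_le_trans)

lemma input_copies:
  assumes "N > 0"
  shows "input_graph (copies N)"
proof -
  have "card ((\<lambda>v. v + n * c) ` e) = 2" if "e \<in> E" for e c
    using edgeD[OF that] by (subst card_image) auto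
  moreover have "\<exists>y. \<exists>c<N. {x, y} \<in> image (\<lambda>v. v + n * c) ` E" if "x < n * N" for x
  proof -
    have c: "x div n < N" using that n_pos by (simp add: less_mult_imp_div_less mult.commute)
    obtain u where "{x mod n, u} \<in> E" using nbr_ex n_pos by (meson mod_less_divisor)
    then have "{x mod n + n * (x div n), u + n * (x div n)} \<in> image (\<lambda>v. v + n * (x div n)) ` E"
      by (auto intro!: image_eqI[of _ _ "{x mod n, u}"])
    then show ?thesis using c by auto
  qed
  moreover have "(\<lambda>v. v + n * c) ` e \<subseteq> {..<n * N}" if "e \<in> E" "c < N" for e c
    using edgeD(1)[OF that(1)] shift_less that(2) by blast
  ultimately show ?thesis using n_pos assms
    by (simp add: input_graph_def simple_graph_def no_isolated_def nbrs_def copies_def lessThan_empty_iff) blast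
qed

lemma num_verts_copies: "num_verts (copies N) = n * N"
  by (simp add: num_verts_def copies_def)

lemma shift_eq_place:
  assumes "e \<in> E" "v \<in> e" "c = f (\<kappa> v)"
  shows "(\<lambda>v. v + n * c) ` e = place f ` e"
  using block[OF assms(1) assms(2)] assms(3) by (auto simp: place_def image_def)

text \<open>An edge lies within one block, so a placement moves it to a single copy; conversely an
  edge of that copy that meets a placed vertex is a placed edge.\<close>

lemma component_union_scattered:
  assumes f: "f \<in> \<kappa> ` {..<n} \<rightarrow>\<^sub>E {..<N}"
  shows "component_union (scattered f) (copies N) N"
proof
  have fN: "f (\<kappa> v) < N" if "v < n" for v using f that by auto
  have shift: "c = f (\<kappa> v)" if "v < n" "v + n * c \<in> verts (scattered f)" for v c
    using that by (simp add: verts_scattered)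
  show "finite (verts (copies N))" by (simp add: copies_def)
  show "verts (scattered f) \<subseteq> verts (copies N)"
    using fN by (auto simp: scattered_def copies_def place_def intro!: shift_less)
  show "input_graph (scattered f)" by (rule input_scattered)
  show "card (verts (copies N)) = N * card (verts (scattered f))"
    using num_verts_scattered num_verts_copies by (simp add: num_verts_def)
  show closed: "e \<subseteq> verts (scattered f)"
    if e: "e \<in> edges (copies N)" "e \<inter> verts (scattered f) \<noteq> {}" for e
  proof -
    obtain c e' where e': "e' \<in> E" "e = (\<lambda>v. v + n * c) ` e'" using e by (auto simp: copies_def)
    then obtain v where "v \<in> e'" "v + n * c \<in> verts (scattered f)" using e by auto
    moreover have "v < n" using edgeD(1)[OF e'(1)] \<open>v \<in> e'\<close> by auto
    ultimately have "e = place f ` e'" using shift_eq_place[OF e'(1), of v c f] e' shift by simp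
    then show ?thesis using edgeD(1)[OF e'(1)] by (auto simp: scattered_def)
  qed
  show "edges (scattered f) = {e \<in> edges (copies N). e \<subseteq> verts (scattered f)}"
  proof (intro equalityI subsetI)
    fix e assume "e \<in> edges (scattered f)"
    then obtain e' where e': "e' \<in> E" "e = place f ` e'" by (auto simp: scattered_def)
    obtain v where v: "v \<in> e'" using edgeD(2)[OF e'(1)] by fastforce
    then have "v < n" using edgeD(1)[OF e'(1)] by auto
    then have "e \<in> edges (copies N)"
      using e' shift_eq_place[OF e'(1) v refl, of f] fN[of v]
      by (auto simp: copies_def intro!: bexI[of _ "f (\<kappa> v)"] image_eqI[of _ _ e'])
    then show "e \<in> {e \<in> edges (copies N). e \<subseteq> verts (scattered f)}"
      using e' edgeD(1)[OF e'(1)] by (auto simp: scattered_def)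
  next
    fix e assume e: "e \<in> {e \<in> edges (copies N). e \<subseteq> verts (scattered f)}"
    then obtain c e' where e': "e' \<in> E" "e = (\<lambda>v. v + n * c) ` e'" by (auto simp: copies_def)
    obtain v where v: "v \<in> e'" using edgeD(2)[OF e'(1)] by fastforce
    then have "v < n" "v + n * c \<in> verts (scattered f)" using edgeD(1)[OF e'(1)] e e' by auto
    then have "e = place f ` e'" using shift_eq_place[OF e'(1) v, of c f] e' shift by simp
    then show "e \<in> edges (scattered f)" using e' by (auto simp: scattered_def)
  qed
qed

text \<open>The gain \<open>N ^ length ?xs\<close> from \<open>graph_factor_le\<close> is offset by
  the proportion of placements that contain all samples, which is at most its reciprocal because no
  two samples share a block.\<close>

lemma sum_graph_factor_le:
  assumes "legal {} h" "distinct (map (\<lambda>x. \<kappa> (x mod n)) (sampled h))"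
  shows "(\<Sum>f\<in>\<kappa> ` {..<n} \<rightarrow>\<^sub>E {..<N}. graph_factor (scattered f) h) \<le>
    ennreal (real (card (\<kappa> ` {..<n} \<rightarrow>\<^sub>E {..<N}))) * graph_factor (copies N) h"
proof -
  let ?F = "\<kappa> ` {..<n} \<rightarrow>\<^sub>E {..<N}" and ?xs = "sampled h"
  let ?P = "\<lambda>f. \<forall>x\<in>set ?xs. f (\<kappa> (x mod n)) = x div n"
  have fin: "finite ?F" by (intro finite_PiE) auto
  have iff: "set ?xs \<subseteq> verts (scattered f) \<longleftrightarrow> ?P f" for f
    unfolding subset_iff verts_scattered by (metis (no_types))
  have "(\<Sum>f\<in>?F. graph_factor (scattered f) h) \<le>
    (\<Sum>f\<in>?F. if ?P f then ennreal (real N ^ length ?xs) * graph_factor (copies N) h else 0)"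
  proof (rule sum_mono)
    fix f assume "f \<in> ?F"
    then interpret component_union "scattered f" "copies N" N by (rule component_union_scattered)
    show "graph_factor (scattered f) h \<le> (if ?P f then ennreal (real N ^ length ?xs) * graph_factor (copies N) h else 0)"
      using graph_factor_le[OF assms(1)] by (simp only: iff empty_subsetI)
  qed
  also have "\<dots> = (\<Sum>f\<in>{f\<in>?F. ?P f}. ennreal (real N ^ length ?xs) * graph_factor (copies N) h)"
    by (simp only: sum.inter_filter[OF fin])
  also have "\<dots> = ennreal (real (card {f\<in>?F. ?P f} * N ^ length ?xs)) * graph_factor (copies N) h"
    by (simp add: ennreal_of_nat_eq_real_of_nat ennreal_mult mult.assoc)
  also have "\<dots> \<le> ennreal (real (card ?F)) * graph_factor (copies N) h"
  proof (intro mult_right_mono ennreal_leI of_nat_mono)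
    have "card {f \<in> ?F. ?P f} * N ^ length ?xs \<le> N ^ card (\<kappa> ` {..<n})"
      using n_pos by (intro card_consistent_choices assms(2)) auto
    then show "card {f \<in> ?F. ?P f} * N ^ length ?xs \<le> card ?F"
      by (simp add: card_PiE)
  qed simp
  finally show ?thesis .
qed

end

lemma length_sampled_le_cost: "length (sampled h) \<le> total_cost h"
  unfolding total_cost_def by (induction h rule: sampled.induct) auto

text \<open>An output right for \<open>n\<close> at cost below \<open>T\<close> has probability at
  most 1/100 on \<open>copies N\<close>, where the output should be right for \<open>n * N\<close>.
  By averaging, this carries over to some placement, up to collisions; there, correct runs are
  mostly expensive.\<close>

lemma (in blocked_graph) exists_hard_placement:
  fixes T :: real
  assumes alg: "algorithm M A" and c: "c \<ge> 1"
    and correct: "\<And>G. input_graph G \<Longrightarrow> run_prob G A (\<lambda>r t. factor_approx c r (num_verts G)) \<ge> 99 / 100"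
    and small: "T\<^sup>2 * (\<Sum>x<n. card {y. y < n \<and> \<kappa> y = \<kappa> x}) \<le> (3/40) * n\<^sup>2" and T: "T \<ge> 0"
  shows "\<exists>f. run_prob (scattered f) A (\<lambda>r t. real t \<ge> T) \<ge> 9 / 10"
proof -
  \<comment> \<open>This separates the outputs: \<open>r \<le> c * n\<close> and
    \<open>n * N / c \<le> r\<close> would imply \<open>N \<le> c\<^sup>2\<close>.\<close>
  define N where "N = Suc (nat \<lceil>c\<^sup>2\<rceil>)"
  have N: "real N > c\<^sup>2" "N > 0" by (auto simp: N_def) linarith
  let ?F = "\<kappa> ` {..<n} \<rightarrow>\<^sub>E {..<N}"
  let ?\<kappa> = "\<lambda>x. \<kappa> (x mod n)"
  let ?Ev = "{(h, r). factor_approx c r n \<and> real (total_cost h) < T}"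
  let ?NC = "{(h, r :: real). distinct (map ?\<kappa> (sampled h))}"
  have finF: "finite ?F" by (intro finite_PiE) auto
  have cardF: "card ?F > 0" using N by (simp add: card_PiE)
  have big: "emeasure (measure_spmf (run (copies N) A [])) ?Ev \<le> ennreal (1 / 100)"
  proof -
    let ?p = "measure_spmf (run (copies N) A [])"
    have disj: "?Ev \<inter> {(h, r). factor_approx c r (n * N)} = {}"
    proof -
      have "False" if "real (n * N) / c \<le> r" "r \<le> c * n" for r
      proof -
        have "real n * N \<le> real n * c\<^sup>2" using that c by (simp add: field_simps power2_eq_square)
          (smt (verit) mult.assoc mult.commute mult_left_mono)
        then show False using N n_pos by simp
      qed
      then show ?thesis by (force simp: factor_approx_def)
    qed
    have "measure ?p ?Ev + measure ?p {(h, r). factor_approx c r (n * N)} = measure ?p (?Ev \<union> {(h, r). factor_approx c r (n * N)})"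
      using disj by (intro measure_spmf.finite_measure_Union[symmetric]) auto
    also have "\<dots> \<le> 1" by (rule measure_spmf.subprob_measure_le_1)
    also have "measure ?p {(h, r). factor_approx c r (n * N)} \<ge> 99 / 100"
      using correct[OF input_copies[OF N(2)]] by (simp add: run_prob_def num_verts_copies)
    ultimately have "measure ?p ?Ev \<le> 1 / 100" by simp
    then show ?thesis by (simp add: measure_spmf.emeasure_eq_measure ennreal_leI)
  qed
  have "(\<Sum>f\<in>?F. emeasure (measure_spmf (run (scattered f) A [])) (?Ev \<inter> ?NC)) \<le>
     ennreal (real (card ?F)) * emeasure (measure_spmf (run (copies N) A [])) ?Ev"
  proof -
    have "(\<Sum>f\<in>?F. strategy_factor A [] h * graph_factor (scattered f) h * ennreal (pmf (A h) (Output r)) * indicator (?Ev \<inter> ?NC) (h, r))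
       \<le> ennreal (real (card ?F)) * (strategy_factor A [] h * graph_factor (copies N) h * ennreal (pmf (A h) (Output r)) * indicator ?Ev (h, r))"
      (is "(\<Sum>f\<in>_. ?l f) \<le> ?r") for h r
    proof (cases "strategy_factor A [] h \<noteq> 0 \<and> (h, r) \<in> ?Ev \<inter> ?NC")
      case False
      then have "?l f = 0" for f by (cases "(h, r) \<in> ?Ev \<inter> ?NC") simp_all
      then have "(\<Sum>f\<in>?F. ?l f) = 0" by (intro sum.neutral) blast
      then show ?thesis by (metis zero_le)
    next
      case True
      have "legal {} h" using strategy_factor_legal[OF alg, of "[]" h] True by simp
      then have "(\<Sum>f\<in>?F. graph_factor (scattered f) h) \<le> ennreal (real (card ?F)) * graph_factor (copies N) h"
        using True by (intro sum_graph_factor_le) auto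
      then have "strategy_factor A [] h * ennreal (pmf (A h) (Output r)) * (\<Sum>f\<in>?F. graph_factor (scattered f) h)
        \<le> strategy_factor A [] h * ennreal (pmf (A h) (Output r)) * (ennreal (real (card ?F)) * graph_factor (copies N) h)"
        by (rule mult_left_mono) simp
      then show ?thesis using True by (simp add: sum_distrib_left mult_ac)
    qed
    then have "(\<integral>\<^sup>+(h, r). (\<Sum>f\<in>?F. strategy_factor A [] h * graph_factor (scattered f) h * ennreal (pmf (A h) (Output r)) * indicator (?Ev \<inter> ?NC) (h, r)) \<partial>count_space UNIV)
       \<le> (\<integral>\<^sup>+(h, r). ennreal (real (card ?F)) * (strategy_factor A [] h * graph_factor (copies N) h * ennreal (pmf (A h) (Output r)) * indicator ?Ev (h, r)) \<partial>count_space UNIV)"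
      by (intro nn_integral_mono) (simp only: split_paired_all prod.case)
    also have "\<dots> = ennreal (real (card ?F)) * emeasure (measure_spmf (run (copies N) A [])) ?Ev"
      unfolding emeasure_run_Nil by (subst nn_integral_cmult[symmetric]) (auto intro!: nn_integral_cong)
    also have "(\<integral>\<^sup>+(h, r). (\<Sum>f\<in>?F. strategy_factor A [] h * graph_factor (scattered f) h * ennreal (pmf (A h) (Output r)) * indicator (?Ev \<inter> ?NC) (h, r)) \<partial>count_space UNIV)
       = (\<Sum>f\<in>?F. emeasure (measure_spmf (run (scattered f) A [])) (?Ev \<inter> ?NC))"
      unfolding emeasure_run_Nil by (subst nn_integral_sum[symmetric]) (auto intro!: nn_integral_cong)
    finally show ?thesis .
  qed
  also have "\<dots> \<le> ennreal (real (card ?F)) * ennreal (1 / 100)" by (intro mult_left_mono big) simp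
  finally have avg: "(\<Sum>f\<in>?F. emeasure (measure_spmf (run (scattered f) A [])) (?Ev \<inter> ?NC)) \<le> ennreal (real (card ?F) / 100)"
    by (simp flip: ennreal_mult)
  have "\<exists>f\<in>?F. measure (measure_spmf (run (scattered f) A [])) (?Ev \<inter> ?NC) \<le> 1 / 100"
  proof (rule ccontr)
    assume "\<not> ?thesis"
    then have "(\<Sum>f\<in>?F. 1 / 100) < (\<Sum>f\<in>?F. measure (measure_spmf (run (scattered f) A [])) (?Ev \<inter> ?NC))"
      using finF cardF by (intro sum_strict_mono) (auto simp: not_le)
    moreover have "(\<Sum>f\<in>?F. measure (measure_spmf (run (scattered f) A [])) (?Ev \<inter> ?NC)) \<le> real (card ?F) / 100"
      using avg by (simp add: measure_spmf.emeasure_eq_measure sum_ennreal)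
    ultimately show False by simp
  qed
  then obtain f where f: "measure (measure_spmf (run (scattered f) A [])) (?Ev \<inter> ?NC) \<le> 1 / 100" by blast
  let ?p = "measure_spmf (run (scattered f) A [])"
  let ?V = "verts (scattered f)"
  have V: "finite ?V" "?V \<noteq> {}" using input_scattered[of f] by (auto simp: input_graph_def simple_graph_def)
  have cardV: "card ?V = n" using num_verts_scattered by (simp add: num_verts_def)
  \<comment> \<open>Every sample costs 1, so a run of cost below \<open>T\<close> has at most
    \<open>J\<close> samples.\<close>
  define J where "J = nat \<lfloor>T\<rfloor>"
  have J: "real J \<le> T" "\<And>k. real k < T \<Longrightarrow> k \<le> J" using T by (auto simp: J_def) linarith+
  have cardeq: "card {y \<in> ?V. ?\<kappa> y = b} = card {y. y < n \<and> \<kappa> y = b}" for b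
  proof -
    have "{y \<in> ?V. ?\<kappa> y = b} = place f ` {y. y < n \<and> \<kappa> y = b}" by (auto simp: scattered_def)
    then show ?thesis using inj_on_subset[OF inj_place] by (simp add: card_image subset_iff)
  qed
  have W: "(\<Sum>x\<in>?V. real (card {y \<in> ?V. ?\<kappa> y = ?\<kappa> x}) / card ?V) / card ?V =
     real (\<Sum>x<n. card {y. y < n \<and> \<kappa> y = \<kappa> x}) / n\<^sup>2"
    unfolding cardeq cardV by (simp add: scattered_def sum.reindex[OF inj_place] power2_eq_square flip: sum_divide_distrib)
  have "measure ?p {(h, r). \<not> distinct (map ?\<kappa> (sampled h)) \<and> length (sampled h) \<le> J} \<le> 3 / 80"
  proof -
    let ?W = "real (\<Sum>x<n. card {y. y < n \<and> \<kappa> y = \<kappa> x}) / n\<^sup>2"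
    have "emeasure ?p {(h, r). \<not> distinct (map ?\<kappa> (sampled h)) \<and> length (sampled h) \<le> J}
       \<le> ennreal (real J * (real J - 1) / 2 * ?W)"
      using emeasure_run_collision[OF V, of A ?\<kappa> J] unfolding W by simp
    also have "\<dots> \<le> ennreal (3 / 80)"
    proof (rule ennreal_leI)
      have "real J * (real J - 1) \<le> T\<^sup>2"
      proof (cases "J = 0")
        case False
        then show ?thesis using J(1) T unfolding power2_eq_square by (intro mult_mono) auto
      qed simp
      then have "real J * (real J - 1) / 2 * ?W \<le> T\<^sup>2 / 2 * ?W" by (intro mult_right_mono) (simp_all add: sum_nonneg)
      also have "\<dots> \<le> 3 / 80" using small n_pos by (simp add: field_simps)
      finally show "real J * (real J - 1) / 2 * ?W \<le> 3 / 80" .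
    qed
    finally show ?thesis by (simp add: measure_spmf.emeasure_eq_measure)
  qed
  moreover have "measure ?p ?Ev \<le> measure ?p ((?Ev \<inter> ?NC) \<union> {(h, r). \<not> distinct (map ?\<kappa> (sampled h)) \<and> length (sampled h) \<le> J})"
    using J(2) length_sampled_le_cost
    by (intro measure_spmf.finite_measure_mono) (auto simp del: distinct_map, meson le_trans)
  moreover have "\<dots> \<le> measure ?p (?Ev \<inter> ?NC) + measure ?p {(h, r). \<not> distinct (map ?\<kappa> (sampled h)) \<and> length (sampled h) \<le> J}"
    by (rule measure_Un_le) auto
  ultimately have "measure ?p ?Ev \<le> 1 / 100 + 3 / 80" using f by linarith
  moreover have "measure ?p {(h, r). factor_approx c r n} \<ge> 99 / 100"
    using correct[OF input_scattered[of f]] by (simp add: run_prob_def num_verts_scattered)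
  moreover have "measure ?p {(h, r). factor_approx c r n} \<le> measure ?p (?Ev \<union> {(h, r). real (total_cost h) \<ge> T})"
    by (intro measure_spmf.finite_measure_mono) auto
  moreover have "\<dots> \<le> measure ?p ?Ev + measure ?p {(h, r). real (total_cost h) \<ge> T}"
    by (rule measure_Un_le) auto
  \<comment> \<open>The 99/100 of a correct output, less 1/100 carried over from the copies and 3/80
    for collisions.\<close>
  ultimately have "measure ?p {(h, r). real (total_cost h) \<ge> T} \<ge> 9 / 10" by linarith
  then show ?thesis by (auto simp: run_prob_def)
qed

text \<open>
  Start with a matching, with one more edge if \<open>n\<close> is odd, and add edges on the vertices below the
  least possible \<open>s\<close>. Everything that meets these vertices is one block of size at most \<open>s + 3\<close>.
\<close>

lemma exists_blocked_graph:
  assumes n: "n \<ge> 2" and m: "n \<le> 2 * m" "m \<le> n choose 2"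
  shows "\<exists>E \<kappa>. blocked_graph n E \<kappa> \<and> card E = m \<and> (\<Sum>x<n. card {y. y < n \<and> \<kappa> y = \<kappa> x}) \<le> 60 * m"
proof -
  \<comment> \<open>\<open>p v\<close> numbers the matching edge at \<open>v\<close>. For odd
    \<open>n\<close> the cap puts the last vertex into the last pair, to which the edge
    \<open>{n - 2, n - 1}\<close> joins it; for even \<open>n\<close> this edge is already in the
    matching.\<close>
  define p where "p = (\<lambda>v. min (v div 2) (n div 2 - 1))"
  define F where "F = insert {n - 2, n - 1} ((\<lambda>i. {2 * i, 2 * i + 1}) ` {..<n div 2})"
  define K where "K = (\<lambda>s::nat. {e. e \<subseteq> {..<s} \<and> card e = 2})"
  have cardK: "card (K s) = s choose 2" for s unfolding K_def by (subst n_subsets) auto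
  have finK: "finite (K s)" for s by (simp add: K_def)
  have finF: "finite F" by (simp add: F_def)
  have F_sub: "F \<subseteq> K n" using n by (auto simp: F_def K_def)
  have cardF: "card F \<le> m"
  proof (cases "even n")
    case True
    then have "{n - 2, n - 1} = {2 * (n div 2 - 1), 2 * (n div 2 - 1) + 1}" using n by auto
    then have "F = (\<lambda>i. {2 * i, 2 * i + 1}) ` {..<n div 2}" unfolding F_def using n by (auto intro!: insert_absorb)
    then have "card F \<le> n div 2" by (metis card_image_le[OF finite_lessThan] card_lessThan)
    then show ?thesis using m(1) by linarith
  next
    case False
    have "card F \<le> Suc (card ((\<lambda>i. {2 * i, 2 * i + 1}) ` {..<n div 2}))" unfolding F_def by (simp add: card_insert_if)
    also have "\<dots> \<le> Suc (n div 2)" by (metis Suc_le_mono card_image_le[OF finite_lessThan] card_lessThan)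
    finally show ?thesis using m(1) False by presburger
  qed
  define s where "s = (LEAST s. m \<le> card (F \<union> K s))"
  have "m \<le> card (F \<union> K n)" using m F_sub by (simp add: Un_absorb1 cardK)
  then have s1: "m \<le> card (F \<union> K s)" and s_le: "s \<le> n" unfolding s_def by (auto intro: LeastI Least_le)
  obtain E where E: "F \<subseteq> E" "E \<subseteq> F \<union> K s" "card E = m"
    using exists_subset_between[of F m "F \<union> K s"] cardF s1 finF finK by auto
  have "K s \<subseteq> K n" using s_le by (fastforce simp: K_def)
  then have Kn: "E \<subseteq> K n" using E(2) F_sub by blast
  \<comment> \<open>All pairs up to that of \<open>s\<close> merge into one block, which contains
    the ends of all added edges; the later pairs remain blocks of their own.\<close>
  define \<kappa> where "\<kappa> = (\<lambda>v. max (p v) (p s))"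
  have blk: "\<kappa> u = \<kappa> v" if "e \<in> E" "u \<in> e" "v \<in> e" for e u v
  proof (cases "e \<in> F")
    case True
    then have "p u = p v" using that n by (auto simp: F_def p_def)
    then show ?thesis by (simp add: \<kappa>_def)
  next
    case False
    then have "u < s" "v < s" using E(2) that by (auto simp: K_def)
    moreover have "mono p" by (auto simp: p_def mono_def intro: div_le_mono)
    ultimately have "p u \<le> p s" "p v \<le> p s" by (auto intro: monoD)
    then show ?thesis by (simp add: \<kappa>_def max_absorb2)
  qed
  have iso: "\<exists>u. {v, u} \<in> E" if "v < n" for v
  proof (cases "v div 2 < n div 2")
    case True
    then have "{2 * (v div 2), 2 * (v div 2) + 1} \<in> E" using E(1) by (auto simp: F_def)
    then show ?thesis by (cases "even v") (auto simp: insert_commute)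
  next
    case False
    then have "v = n - 1" using that by linarith
    then have "{v, n - 2} \<in> E" using E(1) by (auto simp: F_def insert_commute)
    then show ?thesis ..
  qed
  have "blocked_graph n E \<kappa>"
  proof
    have "\<forall>e\<in>E. e \<subseteq> {..<n} \<and> card e = 2" using Kn unfolding K_def by blast
    moreover have "{..<n} \<noteq> {}" using n by (simp add: lessThan_empty_iff)
    ultimately show "input_graph \<lparr>verts = {..<n}, edges = E\<rparr>"
      using iso by (simp add: input_graph_def simple_graph_def no_isolated_def nbrs_def)
  qed (rule blk)
  moreover have "(\<Sum>x<n. card {y. y < n \<and> \<kappa> y = \<kappa> x}) \<le> 60 * m"
  proof -
    let ?B = "{y. y < n \<and> p y \<le> p s}"
    have cardB: "card ?B \<le> s + 3"
    proof -
      have "?B \<subseteq> insert (n - 1) {..<s + 2}" by (auto simp: p_def min_def split: if_splits)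
      then have "card ?B \<le> card (insert (n - 1) {..<s + 2})" by (intro card_mono) auto
      also have "\<dots> \<le> Suc (card {..<s + 2})" by (simp add: card_insert_if)
      finally show ?thesis by simp
    qed
    have le: "card {y. y < n \<and> \<kappa> y = \<kappa> x} \<le> (if x \<in> ?B then s + 3 else 0) + 3" if "x < n" for x
    proof (cases "x \<in> ?B")
      case True
      then have "{y. y < n \<and> \<kappa> y = \<kappa> x} = ?B" by (auto simp: \<kappa>_def)
      then show ?thesis using cardB True by simp
    next
      case False
      then have "{y. y < n \<and> \<kappa> y = \<kappa> x} \<subseteq> {y. y < n \<and> p y = p x}" using that by (auto simp: \<kappa>_def max_def split: if_splits)
      also have "\<dots> \<subseteq> {2 * p x, 2 * p x + 1, n - 1}"
      proof
        fix y assume y: "y \<in> {y. y < n \<and> p y = p x}"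
        show "y \<in> {2 * p x, 2 * p x + 1, n - 1}"
        proof (cases "y div 2 \<le> n div 2 - 1")
          case True
          then have "y div 2 = p x" using y by (simp add: p_def)
          then show ?thesis by (auto simp: div_eq_dividend_iff)
        next
          case False
          then have "y = n - 1" using y n by simp linarith
          then show ?thesis by simp
        qed
      qed
      finally have "card {y. y < n \<and> \<kappa> y = \<kappa> x} \<le> card {2 * p x, 2 * p x + 1, n - 1}" by (intro card_mono) auto
      also have "\<dots> \<le> 3" by (auto simp: card_insert_if)
      finally show ?thesis by simp
    qed
    have "(\<Sum>x<n. card {y. y < n \<and> \<kappa> y = \<kappa> x}) \<le> (\<Sum>x<n. (if x \<in> ?B then s + 3 else 0) + 3)"
      by (intro sum_mono le) simp
    also have "\<dots> = card ?B * (s + 3) + 3 * n"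
      by (simp add: sum.distrib sum.If_cases Int_def conj_ac)
    also have "\<dots> \<le> (s + 3) * (s + 3) + 3 * n" using cardB by simp
    \<comment> \<open>\<open>3 * n \<le> 6 * m\<close> leaves \<open>54 * m\<close> for the merged
      block. By minimality of \<open>s\<close> there are fewer than \<open>m\<close> pairs below
      \<open>s - 1\<close>, so the square of \<open>s\<close> is \<open>O(m)\<close>.\<close>
    also have "\<dots> \<le> 60 * m"
    proof (cases "s \<le> 2")
      case True
      then have "(s + 3) * (s + 3) \<le> 5 * 5" by (intro mult_mono) auto
      then show ?thesis using m(1) n by linarith
    next
      case False
      then have "\<not> m \<le> card (F \<union> K (s - 1))" unfolding s_def by (intro not_less_Least) auto
      moreover have "card (K (s - 1)) \<le> card (F \<union> K (s - 1))" using finF finK by (intro card_mono) auto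
      ultimately have "(s - 1) choose 2 < m" using cardK by simp
      obtain t where t: "s = t + 3" using False by (metis add.commute le_Suc_ex not_less_eq_eq numeral_2_eq_2 numeral_3_eq_3)
      have "(t + 2) * (t + 1) = 2 * ((s - 1) choose 2)" by (simp add: t choose_two)
      then have "(t + 2) * (t + 1) + 2 \<le> 2 * m" using \<open>(s - 1) choose 2 < m\<close> by linarith
      moreover have "(s + 3) * (s + 3) \<le> 27 * ((t + 2) * (t + 1) + 2)" by (simp add: t algebra_simps)
      ultimately have "(s + 3) * (s + 3) \<le> 27 * (2 * m)" by (meson le_trans mult_le_mono2)
      then show ?thesis using m(1) by linarith
    qed
    finally show ?thesis .
  qed
  ultimately show ?thesis using E(3) by blast
qed

section \<open>Sizes of input graphs, and the lower bound\<close>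

lemma input_graph_finite:
  assumes "input_graph G"
  shows "finite (verts G)" "finite (edges G)"
proof -
  show "finite (verts G)" using assms by (simp add: input_graph_def simple_graph_def)
  moreover have "edges G \<subseteq> Pow (verts G)" using assms by (auto simp: input_graph_def simple_graph_def)
  ultimately show "finite (edges G)" by (meson finite_Pow_iff finite_subset)
qed

text \<open>These are the hypotheses of \<open>exists_blocked_graph\<close>, so a hard graph exists
  for every pair of sizes that occurs at all.\<close>

lemma input_graph_bounds:
  assumes "input_graph G"
  shows "num_verts G \<ge> 2" "num_verts G \<le> 2 * num_edges G" "num_edges G \<le> num_verts G choose 2"
proof -
  note fin = input_graph_finite[OF assms]
  have e: "e \<subseteq> verts G" "card e = 2" if "e \<in> edges G" for e
    using assms that by (auto simp: input_graph_def simple_graph_def)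
  have cover: "verts G \<subseteq> \<Union> (edges G)" and ne: "verts G \<noteq> {}"
    using assms by (auto simp: input_graph_def simple_graph_def no_isolated_def nbrs_def)
  then obtain e' where "e' \<in> edges G" by blast
  then show "num_verts G \<ge> 2" using e[of e'] card_mono[of "verts G" e'] fin by (simp add: num_verts_def)
  have "card (verts G) \<le> card (\<Union> (edges G))" using fin e cover by (intro card_mono) (auto intro: finite_subset)
  also have "\<dots> \<le> (\<Sum>e\<in>edges G. card e)" by (rule card_Union_le_sum_card)
  also have "\<dots> = 2 * num_edges G" using e by (simp add: num_edges_def)
  finally show "num_verts G \<le> 2 * num_edges G" by (simp add: num_verts_def)
  have "edges G \<subseteq> {e. e \<subseteq> verts G \<and> card e = 2}" using e by auto
  then have "num_edges G \<le> card {e. e \<subseteq> verts G \<and> card e = 2}"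
    unfolding num_edges_def using fin by (intro card_mono) auto
  then show "num_edges G \<le> num_verts G choose 2" using fin by (simp add: n_subsets num_verts_def)
qed

theorem lower_bound:
  assumes "c \<ge> 1" "algorithm M A"
    and correct: "\<And>G. input_graph G \<Longrightarrow> run_prob G A (\<lambda>r t. factor_approx c r (num_verts G)) \<ge> 99 / 100"
    and G0: "input_graph G0"
  shows "\<exists>G. input_graph G \<and> num_verts G = num_verts G0 \<and> num_edges G = num_edges G0 \<and>
    run_prob G A (\<lambda>r t. real t \<ge> 1 / 20 * sqrt (real (num_verts G0) / avg_deg G)) \<ge> 9 / 10"
proof -
  let ?n = "num_verts G0" and ?m = "num_edges G0"
  note b = input_graph_bounds[OF G0]
  obtain E \<kappa> where E: "blocked_graph ?n E \<kappa>" "card E = ?m"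
    and sum: "(\<Sum>x<?n. card {y. y < ?n \<and> \<kappa> y = \<kappa> x}) \<le> 60 * ?m"
    using exists_blocked_graph[OF b] by blast
  interpret blocked_graph ?n E \<kappa> by (rule E)
  \<comment> \<open>The square of \<open>T\<close> is \<open>n^2 / (800 * m)\<close>; multiplied by
    the bound \<open>60 * m\<close> it is the \<open>3/40 * n^2\<close> of
    \<open>exists_hard_placement\<close>.\<close>
  define T where "T = 1 / 20 * sqrt (?n / (2 * real ?m / ?n))"
  have m: "?m > 0" using b by linarith
  have "T\<^sup>2 * (\<Sum>x<?n. card {y. y < ?n \<and> \<kappa> y = \<kappa> x}) \<le> T\<^sup>2 * (60 * ?m)"
    using sum by (intro mult_left_mono) (simp_all flip: of_nat_sum)
  also have "\<dots> = (3/40) * (?n)\<^sup>2"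
    using m by (simp add: T_def power_mult_distrib power2_eq_square)
  finally have le: "T\<^sup>2 * (\<Sum>x<?n. card {y. y < ?n \<and> \<kappa> y = \<kappa> x}) \<le> (3/40) * (?n)\<^sup>2" .
  have "\<exists>f. run_prob (scattered f) A (\<lambda>r t. real t \<ge> T) \<ge> 9 / 10"
    by (rule exists_hard_placement[OF assms(2,1) correct le]) (auto simp: T_def)
  then obtain f where "run_prob (scattered f) A (\<lambda>r t. real t \<ge> T) \<ge> 9 / 10" ..
  then show ?thesis
    using input_scattered[of f] num_verts_scattered[of f] num_edges_scattered[of f] E(2)
    by (intro exI[of _ "scattered f"]) (simp add: T_def avg_deg_def)
qed

section \<open>Programs\<close>

text \<open>A strategy is a function of the whole history and does not compose. Subroutines are
  therefore written as trees of queries, and the tree is turned into a strategy at the end.\<close>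

datatype 'a prog = Ret 'a | Query query "answer \<Rightarrow> 'a prog"

primrec bind_prog :: "'a prog \<Rightarrow> ('a \<Rightarrow> 'b prog) \<Rightarrow> 'b prog" where
  "bind_prog (Ret x) g = g x"
| "bind_prog (Query q f) g = Query q (\<lambda>a. bind_prog (f a) g)"

primrec sem :: "graph \<Rightarrow> 'a prog \<Rightarrow> 'a pmf" where
  "sem G (Ret x) = return_pmf x"
| "sem G (Query q f) = bind_pmf (response G q) (\<lambda>a. sem G (f a))"

lemma sem_bind [simp]: "sem G (bind_prog p g) = bind_pmf (sem G p) (\<lambda>x. sem G (g x))"
  by (induction p) (auto simp: bind_return_pmf bind_assoc_pmf)

text \<open>
  \<open>safe G p V w \<Phi>\<close>: started with known vertices \<open>V\<close>, the program asks only legal queries of total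
  cost at most \<open>w\<close>, and ends with a set of known vertices and a value satisfying \<open>\<Phi>\<close>.
\<close>

primrec safe :: "graph \<Rightarrow> 'a prog \<Rightarrow> nat set \<Rightarrow> nat \<Rightarrow> (nat set \<Rightarrow> 'a \<Rightarrow> bool) \<Rightarrow> bool" where
  "safe G (Ret x) = (\<lambda>V w \<Phi>. \<Phi> V x)"
| "safe G (Query q f) = (\<lambda>V w \<Phi>. q \<in> advanced_model \<and> query_verts q \<subseteq> V \<and> cost q \<le> w \<and>
    (\<forall>a\<in>set_pmf (response G q). safe G (f a) (V \<union> answer_verts a) (w - cost q) \<Phi>))"

lemma safe_bind:
  assumes "safe G p V w1 \<Psi>" "\<And>V' x. \<Psi> V' x \<Longrightarrow> safe G (g x) V' w2 \<Phi>"
  shows "safe G (bind_prog p g) V (w1 + w2) \<Phi>"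
  using assms
proof (induction p arbitrary: V w1)
  case (Ret x)
  have mono: "safe G p V w \<Phi> \<Longrightarrow> w \<le> w' \<Longrightarrow> safe G p V w' \<Phi>" for p :: "'b prog" and V w w'
    by (induction p arbitrary: V w w') (auto intro: diff_le_mono)
  show ?case using Ret mono[of "g x" V w2 "w1 + w2"] by simp
next
  case (Query q f)
  then have "cost q \<le> w1" by simp
  show ?case
    unfolding bind_prog.simps safe.simps
  proof (intro conjI ballI)
    fix a assume "a \<in> set_pmf (response G q)"
    then have "safe G (bind_prog (f a) g) (V \<union> answer_verts a) (w1 - cost q + w2) \<Phi>"
      using Query.prems by (intro Query.IH) auto
    then show "safe G (bind_prog (f a) g) (V \<union> answer_verts a) (w1 + w2 - cost q) \<Phi>"
      using \<open>cost q \<le> w1\<close> by simp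
  qed (use Query.prems in auto)
qed

lemma safe_mono:
  assumes "safe G p V w \<Psi>" "w \<le> w'" "\<And>V' x. \<Psi> V' x \<Longrightarrow> \<Phi> V' x"
  shows "safe G p V w' \<Phi>"
proof -
  have "bind_prog p Ret = p" by (induction p) auto
  moreover have "safe G (bind_prog p Ret) V (w + (w' - w)) \<Phi>"
    using assms by (intro safe_bind[of G p V w \<Psi>]) auto
  ultimately show ?thesis using assms(2) by simp
qed

text \<open>
  The strategy runs the programs \<open>ph 0\<close>, \<open>ph 1\<close>, ... until one of them returns a value. The
  query \<open>RandVert\<close> between two programs makes the recursion on the history structural.
\<close>

primrec play :: "(nat \<Rightarrow> real option prog) \<Rightarrow> nat \<Rightarrow> real option prog \<Rightarrow> history \<Rightarrow> action" where
  "play ph i p [] = (case p of Ret None \<Rightarrow> Ask RandVert | Ret (Some r) \<Rightarrow> Output r | Query q f \<Rightarrow> Ask q)"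
| "play ph i p (qa # h) = (case p of Ret None \<Rightarrow> play ph (Suc i) (ph (Suc i)) h
     | Ret (Some r) \<Rightarrow> Output r | Query q f \<Rightarrow> play ph i (f (snd qa)) h)"

text \<open>\<open>algorithm\<close> constrains all histories, also impossible ones, on which a
  program may be led to ask about unseen vertices. On the runs that occur, \<open>safe\<close> shows
  that the default output 0 is never taken.\<close>

definition guard :: "nat set \<Rightarrow> action \<Rightarrow> action" where
  "guard V act = (case act of Output r \<Rightarrow> Output r
     | Ask q \<Rightarrow> if q \<in> advanced_model \<and> query_verts q \<subseteq> V then Ask q else Output 0)"

definition strat :: "(nat \<Rightarrow> real option prog) \<Rightarrow> strategy" where
  "strat ph h = return_pmf (guard (seen h) (play ph 0 (ph 0) h))"

lemma algorithm_strat: "algorithm advanced_model (strat ph)"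
  by (auto simp: algorithm_def strat_def guard_def split: action.splits if_splits)

text \<open>A finite truncation of the endless strategy: at most \<open>l\<close> phases follow
  phase \<open>i\<close>, and a final \<open>None\<close> is counted as failure in the
  analysis.\<close>

primrec continue :: "(nat \<Rightarrow> real option prog) \<Rightarrow> nat \<Rightarrow> nat \<Rightarrow> real option \<Rightarrow> real option prog" where
  "continue ph 0 i r = Ret r"
| "continue ph (Suc l) i r = (case r of Some v \<Rightarrow> Ret (Some v)
     | None \<Rightarrow> Query RandVert (\<lambda>_. bind_prog (ph (Suc i)) (continue ph l (Suc i))))"

lemma total_cost_snoc: "total_cost (h @ [(q, a)]) = total_cost h + cost q"
  by (simp add: total_cost_def)

lemma emeasure_run_Ask:
  "A h = return_pmf (Ask q) \<Longrightarrow> emeasure (measure_spmf (run G A h)) X =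
     (\<integral>\<^sup>+a. emeasure (measure_spmf (run G A (h @ [(q, a)]))) X \<partial>measure_pmf (response G q))"
  by (subst emeasure_run) simp

lemma emeasure_run_ge_query:
  assumes "A h = return_pmf (Ask q)" "cost q \<le> w"
    and "\<And>a. a \<in> set_pmf (response G q) \<Longrightarrow> emeasure (measure_pmf (f a)) Y \<le>
      emeasure (measure_spmf (run G A (h @ [(q, a)]))) {(h', r). good r \<and> total_cost h' \<le> total_cost (h @ [(q, a)]) + (w - cost q)}"
  shows "emeasure (measure_pmf (bind_pmf (response G q) f)) Y \<le>
    emeasure (measure_spmf (run G A h)) {(h', r). good r \<and> total_cost h' \<le> total_cost h + w}"
proof -
  have "emeasure (measure_pmf (bind_pmf (response G q) f)) Y = (\<integral>\<^sup>+a. emeasure (measure_pmf (f a)) Y \<partial>measure_pmf (response G q))"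
    by simp
  also have "\<dots> \<le> (\<integral>\<^sup>+a. emeasure (measure_spmf (run G A (h @ [(q, a)])))
      {(h', r). good r \<and> total_cost h' \<le> total_cost h + w} \<partial>measure_pmf (response G q))"
    using assms(2,3) by (intro nn_integral_mono_AE AE_pmfI) (simp add: total_cost_snoc)
  finally show ?thesis by (simp add: emeasure_run_Ask[where A = A and h = h, OF assms(1)])
qed

text \<open>Lower bounds on a least fixed point come from unfolding it finitely often, here along
  the finite tree of the truncated strategy. The first hypothesis says that after \<open>h\<close>
  the strategy is in state \<open>(i, p)\<close> and replays the rest of the history from there.
  Equality may fail since the strategy goes on after the truncation.\<close>

lemma emeasure_run_play:
  assumes "\<And>h'. A (h @ h') = return_pmf (guard (seen (h @ h')) (play ph i p h'))"
    and "safe G (bind_prog p (continue ph l i)) (seen h) w (\<lambda>_ _. True)"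
  shows "emeasure (measure_pmf (sem G (bind_prog p (continue ph l i)))) {r. \<exists>v. r = Some v \<and> good v} \<le>
    emeasure (measure_spmf (run G A h)) {(h', r). good r \<and> total_cost h' \<le> total_cost h + w}"
  using assms
proof (induction l arbitrary: i p h w)
  case 0
  have snoc: "A ((h @ [(q, a)]) @ h') = return_pmf (guard (seen ((h @ [(q, a)]) @ h')) (play ph i (f a) h'))"
    if "\<And>h'. A (h @ h') = return_pmf (guard (seen (h @ h')) (play ph i (Query q f) h'))" for h q a h' f
    using that[of "(q, a) # h'"] by simp
  show ?case using 0
  proof (induction p arbitrary: h w)
    case (Ret r)
    have "emeasure (measure_spmf (run G A h)) {(h', r). good r \<and> total_cost h' \<le> total_cost h + w} \<ge> 1" if "r = Some v" "good v" for v
      using Ret.prems(1)[of "[]"] that by (subst emeasure_run) (simp add: guard_def)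
    then show ?case by (auto simp: indicator_def)
  next
    case (Query q f)
    have "A h = return_pmf (Ask q)" using Query.prems(1)[of "[]"] Query.prems(2) by (simp add: guard_def)
    then show ?case unfolding bind_prog.simps sem.simps
      using Query.prems(2) by (intro emeasure_run_ge_query Query.IH snoc Query.prems(1)) auto
  qed
next
  case (Suc l)
  have snoc: "A ((h @ [(q, a)]) @ h') = return_pmf (guard (seen ((h @ [(q, a)]) @ h')) (play ph i (f a) h'))"
    if "\<And>h'. A (h @ h') = return_pmf (guard (seen (h @ h')) (play ph i (Query q f) h'))" for h q a h' f
    using that[of "(q, a) # h'"] by simp
  show ?case using Suc.prems
  proof (induction p arbitrary: h w)
    case (Ret r)
    show ?case
    proof (cases r)
      case (Some v)
      have "emeasure (measure_spmf (run G A h)) {(h', r). good r \<and> total_cost h' \<le> total_cost h + w} \<ge> 1" if "good v"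
        using Ret.prems(1)[of "[]"] that Some by (subst emeasure_run) (simp add: guard_def)
      then show ?thesis using Some by (auto simp: indicator_def)
    next
      case None
      have "A h = return_pmf (Ask RandVert)"
        using Ret.prems(1)[of "[]"] None by (simp add: guard_def advanced_model_def)
      moreover have "A ((h @ [(RandVert, a)]) @ h') = return_pmf (guard (seen ((h @ [(RandVert, a)]) @ h')) (play ph (Suc i) (ph (Suc i)) h'))" for a h'
        using Ret.prems(1)[of "(RandVert, a) # h'"] None by simp
      ultimately show ?thesis
        using Ret.prems(2) unfolding None bind_prog.simps continue.simps option.case sem.simps
        by (intro emeasure_run_ge_query Suc.IH) auto
    qed
  next
    case (Query q f)
    have "A h = return_pmf (Ask q)" using Query.prems(1)[of "[]"] Query.prems(2) by (simp add: guard_def)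
    then show ?case unfolding bind_prog.simps sem.simps
      using Query.prems(2) by (intro emeasure_run_ge_query Query.IH snoc Query.prems(1)) auto
  qed
qed

lemma run_prob_strat:
  assumes "safe G (bind_prog (ph 0) (continue ph l 0)) {} w (\<lambda>_ _. True)"
  shows "measure_pmf.prob (sem G (bind_prog (ph 0) (continue ph l 0))) {r. \<exists>v. r = Some v \<and> good v} \<le>
    run_prob G (strat ph) (\<lambda>r t. good r \<and> t \<le> w)"
proof -
  have "emeasure (measure_pmf (sem G (bind_prog (ph 0) (continue ph l 0)))) {r. \<exists>v. r = Some v \<and> good v} \<le>
    emeasure (measure_spmf (run G (strat ph) [])) {(h', r). good r \<and> total_cost h' \<le> total_cost [] + w}"
    using assms by (intro emeasure_run_play) (auto simp: strat_def)
  then show ?thesis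
    by (simp add: run_prob_def measure_pmf.emeasure_eq_measure measure_spmf.emeasure_eq_measure total_cost_def)
qed

text \<open>The union bound for consecutive stages, by which the failures of the single estimators
  are added up.\<close>

lemma prob_bind_le:
  assumes "measure_pmf.prob p {x. \<not> P x} \<le> a" "b \<ge> 0"
    and "\<And>x. x \<in> set_pmf p \<Longrightarrow> P x \<Longrightarrow> measure_pmf.prob (f x) B \<le> b"
  shows "measure_pmf.prob (bind_pmf p f) B \<le> a + b"
proof -
  have "a \<ge> 0" using assms(1) by (rule order_trans[OF measure_nonneg])
  have "emeasure (measure_pmf (bind_pmf p f)) B = (\<integral>\<^sup>+x. emeasure (measure_pmf (f x)) B \<partial>measure_pmf p)" by simp
  also have "\<dots> \<le> (\<integral>\<^sup>+x. indicator {x. \<not> P x} x + ennreal b \<partial>measure_pmf p)"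
  proof (intro nn_integral_mono_AE AE_pmfI)
    fix x assume "x \<in> set_pmf p"
    then show "emeasure (measure_pmf (f x)) B \<le> indicator {x. \<not> P x} x + ennreal b"
      using assms(3)[of x] measure_pmf.prob_le_1[of "f x" B]
      by (cases "P x") (auto simp: measure_pmf.emeasure_eq_measure simp flip: ennreal_1 ennreal_plus intro!: ennreal_leI add_increasing2 assms(2))
  qed
  also have "\<dots> = ennreal (measure_pmf.prob p {x. \<not> P x}) + ennreal b"
    by (subst nn_integral_add) (auto simp: measure_pmf.emeasure_eq_measure)
  also have "\<dots> \<le> ennreal (a + b)" using assms \<open>a \<ge> 0\<close> by (simp flip: ennreal_plus add: ennreal_leI)
  finally show ?thesis using assms(2) \<open>a \<ge> 0\<close> by (simp add: measure_pmf.emeasure_eq_measure del: ennreal_plus flip: ennreal_plus)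
qed

section \<open>Sums of independent samples\<close>

lemma expectation_bind_finite:
  fixes h :: "'b \<Rightarrow> real"
  assumes "finite (set_pmf p)" "\<And>x. x \<in> set_pmf p \<Longrightarrow> finite (set_pmf (f x))"
  shows "measure_pmf.expectation (bind_pmf p f) h = measure_pmf.expectation p (\<lambda>x. measure_pmf.expectation (f x) h)"
  using assms by (subst pmf_expectation_bind[of "set_pmf p"]) (auto simp: integral_measure_pmf[of "set_pmf p"])

lemma expectation_finite_eq:
  fixes h :: "'b \<Rightarrow> real"
  shows "finite (set_pmf p) \<Longrightarrow> measure_pmf.expectation p h = (\<Sum>x\<in>set_pmf p. pmf p x * h x)"
  by (subst integral_measure_pmf[of "set_pmf p"]) auto

lemma expectation_mono_finite:
  fixes f g :: "'b \<Rightarrow> real"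
  assumes "finite (set_pmf p)" "\<And>x. x \<in> set_pmf p \<Longrightarrow> f x \<le> g x"
  shows "measure_pmf.expectation p f \<le> measure_pmf.expectation p g"
  using assms by (auto simp: expectation_finite_eq intro!: sum_mono mult_left_mono)

primrec sum_iid :: "nat \<Rightarrow> real pmf \<Rightarrow> real pmf" where
  "sum_iid 0 p = return_pmf 0"
| "sum_iid (Suc k) p = bind_pmf p (\<lambda>a. bind_pmf (sum_iid k p) (\<lambda>s. return_pmf (a + s)))"

lemma finite_sum_iid: "finite (set_pmf p) \<Longrightarrow> finite (set_pmf (sum_iid k p))"
  by (induction k) auto

text \<open>The cross term vanishes because the centred sum has mean 0, so variances add; each is at
  most the second moment.\<close>

lemma sum_iid_moments:
  assumes fin: "finite (set_pmf p)"
  defines "\<mu> \<equiv> measure_pmf.expectation p (\<lambda>x. x)"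
  shows "measure_pmf.expectation (sum_iid k p) (\<lambda>x. x - k * \<mu>) = 0"
    and "measure_pmf.expectation (sum_iid k p) (\<lambda>x. (x - k * \<mu>)\<^sup>2) \<le> k * measure_pmf.expectation p (\<lambda>x. x\<^sup>2)"
proof -
  note int = integrable_measure_pmf_finite[OF fin] integrable_measure_pmf_finite[OF finite_sum_iid[OF fin]]
  have p1: "measure_pmf.expectation p (\<lambda>x. x - \<mu>) = 0"
    by (simp add: int \<mu>_def)
  have p2: "measure_pmf.expectation p (\<lambda>x. (x - \<mu>)\<^sup>2) \<le> measure_pmf.expectation p (\<lambda>x. x\<^sup>2)"
  proof -
    have "measure_pmf.expectation p (\<lambda>x. (x - \<mu>)\<^sup>2) = measure_pmf.expectation p (\<lambda>x. x\<^sup>2 - 2 * \<mu> * x + \<mu>\<^sup>2)"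
      by (simp add: power2_diff algebra_simps)
    also have "\<dots> = measure_pmf.expectation p (\<lambda>x. x\<^sup>2) - \<mu>\<^sup>2"
      by (simp add: int power2_eq_square flip: \<mu>_def)
    finally show ?thesis by simp
  qed
  have bind: "measure_pmf.expectation (sum_iid (Suc k) p) h =
    measure_pmf.expectation p (\<lambda>a. measure_pmf.expectation (sum_iid k p) (\<lambda>s. h (a + s)))" for k and h :: "real \<Rightarrow> real"
    by (simp add: expectation_bind_finite fin finite_sum_iid)
  show m1: "measure_pmf.expectation (sum_iid k p) (\<lambda>x. x - k * \<mu>) = 0" for k
  proof (induction k)
    case (Suc k)
    have "a + s - real (Suc k) * \<mu> = (a - \<mu>) + (s - k * \<mu>)" for a s by (simp add: algebra_simps)
    then have "measure_pmf.expectation (sum_iid (Suc k) p) (\<lambda>x. x - real (Suc k) * \<mu>) =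
        measure_pmf.expectation p (\<lambda>a. measure_pmf.expectation (sum_iid k p) (\<lambda>s. (a - \<mu>) + (s - k * \<mu>)))"
      by (simp only: bind)
    also have "\<dots> = measure_pmf.expectation p (\<lambda>a. (a - \<mu>) + measure_pmf.expectation (sum_iid k p) (\<lambda>s. s - k * \<mu>))"
      by (subst Bochner_Integration.integral_add) (simp_all add: int)
    finally show ?case by (simp add: Suc p1)
  qed simp
  show "measure_pmf.expectation (sum_iid k p) (\<lambda>x. (x - k * \<mu>)\<^sup>2) \<le> k * measure_pmf.expectation p (\<lambda>x. x\<^sup>2)"
  proof (induction k)
    case (Suc k)
    have "(a + s - real (Suc k) * \<mu>)\<^sup>2 = (a - \<mu>)\<^sup>2 + 2 * (a - \<mu>) * (s - k * \<mu>) + (s - k * \<mu>)\<^sup>2" for a s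
      by (simp add: power2_eq_square algebra_simps)
    then have "measure_pmf.expectation (sum_iid (Suc k) p) (\<lambda>x. (x - real (Suc k) * \<mu>)\<^sup>2) =
        measure_pmf.expectation p (\<lambda>a. measure_pmf.expectation (sum_iid k p)
          (\<lambda>s. (a - \<mu>)\<^sup>2 + 2 * (a - \<mu>) * (s - k * \<mu>) + (s - k * \<mu>)\<^sup>2))"
      by (simp only: bind)
    also have "\<dots> = measure_pmf.expectation p (\<lambda>a. (a - \<mu>)\<^sup>2 + 2 * (a - \<mu>) * measure_pmf.expectation (sum_iid k p) (\<lambda>s. s - k * \<mu>)
        + measure_pmf.expectation (sum_iid k p) (\<lambda>s. (s - k * \<mu>)\<^sup>2))"
    proof -
      have "measure_pmf.expectation (sum_iid k p) (\<lambda>s. c + b * X s + Y s) =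
        c + b * measure_pmf.expectation (sum_iid k p) X + measure_pmf.expectation (sum_iid k p) Y" for b c :: real and X Y
        by (simp add: int)
      then show ?thesis by simp
    qed
    also have "\<dots> = measure_pmf.expectation p (\<lambda>a. (a - \<mu>)\<^sup>2) + measure_pmf.expectation (sum_iid k p) (\<lambda>s. (s - k * \<mu>)\<^sup>2)"
      unfolding m1 by (subst Bochner_Integration.integral_add) (simp_all add: int)
    finally show ?case using Suc p2 by (simp add: algebra_simps)
  qed simp
qed

text \<open>The slack \<open>a\<close> makes the bound meaningful for every \<open>\<mu>\<close>, so that a threshold test can be decided with it.\<close>

lemma sum_iid_concentration:
  assumes fin: "finite (set_pmf p)"
  defines "\<mu> \<equiv> measure_pmf.expectation p (\<lambda>x. x)"
  assumes \<mu>: "\<mu> \<ge> 0" and W: "W \<ge> 0" "measure_pmf.expectation p (\<lambda>x. x\<^sup>2) \<le> W * \<mu>"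
    and pos: "\<eta> > 0" "a > 0"
  shows "measure_pmf.prob (sum_iid R p) {s. \<not> \<bar>s - real R * \<mu>\<bar> < \<eta> * (real R * \<mu> + a)} \<le> W / (\<eta>\<^sup>2 * a)"
proof -
  let ?q = "sum_iid R p" and ?t = "\<eta> * (real R * \<mu> + a)"
  have t: "?t > 0" using pos \<mu> by (intro mult_pos_pos add_nonneg_pos) auto
  have "{s. \<not> \<bar>s - real R * \<mu>\<bar> < ?t} = {s. ?t\<^sup>2 \<le> (s - real R * \<mu>)\<^sup>2}"
    using t by (auto simp: not_less simp flip: abs_le_square_iff)
  then have "measure_pmf.prob ?q {s. \<not> \<bar>s - real R * \<mu>\<bar> < ?t} = measure_pmf.prob ?q {s \<in> space (measure_pmf ?q). ?t\<^sup>2 \<le> (s - real R * \<mu>)\<^sup>2}" by simp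
  also have "\<dots> \<le> measure_pmf.expectation ?q (\<lambda>s. (s - real R * \<mu>)\<^sup>2) / ?t\<^sup>2"
    using t by (intro integral_Markov_inequality_measure[where A = "{}"] integrable_measure_pmf_finite finite_sum_iid fin) auto
  also have "\<dots> \<le> (real R * (W * \<mu>)) / ?t\<^sup>2"
  proof (rule divide_right_mono)
    have "measure_pmf.expectation ?q (\<lambda>s. (s - real R * \<mu>)\<^sup>2) \<le> real R * measure_pmf.expectation p (\<lambda>x. x\<^sup>2)"
      unfolding \<mu>_def by (rule sum_iid_moments(2)[OF fin])
    also have "\<dots> \<le> real R * (W * \<mu>)" using W by (intro mult_left_mono) auto
    finally show "measure_pmf.expectation ?q (\<lambda>s. (s - real R * \<mu>)\<^sup>2) \<le> real R * (W * \<mu>)" .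
  qed simp
  \<comment> \<open>The inequality \<open>x * a \<le> (x + a)\<^sup>2\<close> removes the unknown
    mean from Chebyshev's bound.\<close>
  also have "\<dots> \<le> W / (\<eta>\<^sup>2 * a)"
  proof -
    let ?x = "real R * \<mu>"
    have x: "?x \<ge> 0" using \<mu> by simp
    have "c * b \<le> (c + b)\<^sup>2" if "0 \<le> c" "0 \<le> b" for b c :: real
    proof -
      have "(c + b)\<^sup>2 = c * b + (c * c + c * b + b * b)" by (simp add: power2_eq_square algebra_simps)
      moreover have "0 \<le> c * c + c * b + b * b" using that by simp
      ultimately show ?thesis by linarith
    qed
    then have "?x * a \<le> (?x + a)\<^sup>2" using x pos by simp
    then have "W * \<eta>\<^sup>2 * (?x * a) \<le> W * \<eta>\<^sup>2 * (?x + a)\<^sup>2" using W by (intro mult_left_mono) auto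
    then have "(?x * W) * (\<eta>\<^sup>2 * a) \<le> W * ?t\<^sup>2" by (simp add: power_mult_distrib ac_simps)
    moreover have "\<eta>\<^sup>2 * a > 0" "?t\<^sup>2 > 0" using pos t by auto
    ultimately show ?thesis by (simp add: divide_le_eq le_divide_eq ac_simps)
  qed
  finally show ?thesis .
qed

section \<open>Random vertices and neighbours\<close>

text \<open>The probability that \<open>k\<close> random elements of a set of size \<open>n\<close> include \<open>u\<close> given ones.\<close>

fun cover :: "nat \<Rightarrow> nat \<Rightarrow> nat \<Rightarrow> real" where
  "cover n 0 u = (if u = 0 then 1 else 0)"
| "cover n (Suc k) u = u / n * cover n k (u - 1) + (1 - u / n) * cover n k u"

lemma cover_nonneg: "u \<le> n \<Longrightarrow> cover n k u \<ge> 0"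
proof (induction k arbitrary: u)
  case (Suc k)
  have "real u / n \<le> 1" using Suc.prems by (cases "n = 0") (auto simp: divide_le_eq_1)
  then show ?case using Suc.IH[of u] Suc.IH[of "u - 1"] Suc.prems by (auto intro!: add_nonneg_nonneg)
qed auto

text \<open>Two terms of the binomial expansion; divided by \<open>n ^ u\<close>, this is the
  induction step of \<open>cover_le\<close>.\<close>

lemma power_Suc_ge: "real k ^ u + u * real k ^ (u - 1) \<le> real (Suc k) ^ u"
proof (induction u)
  case (Suc u)
  have "real k ^ Suc u + real (Suc u) * real k ^ (Suc u - 1) = real k * real k ^ u + u * (real k * real k ^ (u - 1)) + real k ^ u"
    by (cases u) (simp_all add: algebra_simps)
  also have "\<dots> \<le> (1 + real k) * (real k ^ u + u * real k ^ (u - 1))" by (simp add: algebra_simps)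
  also have "\<dots> \<le> (1 + real k) * real (Suc k) ^ u" using Suc by (intro mult_left_mono) auto
  finally show ?case by (simp add: add.commute)
qed simp

lemma cover_le: "u \<le> n \<Longrightarrow> n > 0 \<Longrightarrow> cover n k u \<le> (k / n) ^ u"
proof (induction k arbitrary: u)
  case (Suc k)
  have "cover n (Suc k) u \<le> u / n * (k / n) ^ (u - 1) + 1 * (k / n) ^ u"
    unfolding cover.simps using Suc.IH[of u] Suc.IH[of "u - 1"] Suc.prems cover_nonneg[of u n k] cover_nonneg[of "u - 1" n k]
    by (intro add_mono mult_mono) auto
  also have "\<dots> = (real k ^ u + u * real k ^ (u - 1)) / real n ^ u"
    by (cases u) (simp_all add: power_divide add_divide_distrib algebra_simps)
  also have "\<dots> \<le> real (Suc k) ^ u / real n ^ u" by (intro divide_right_mono power_Suc_ge) auto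
  finally show ?case by (simp add: power_divide)
qed (simp add: power_0_left)

lemma cover_0 [simp]: "cover n k 0 = 1"
  by (induction k) auto

text \<open>A slightly weakened Bonferroni inequality for
  \<open>1 - (1 - 1 / n) ^ k\<close>.\<close>

lemma cover_1_ge:
  assumes "n > 0"
  shows "cover n k 1 \<ge> k / n - (k / n)\<^sup>2 / 2"
proof (induction k)
  case (Suc k)
  let ?x = "real k / n" and ?y = "1 / real n"
  have y: "?y \<le> 1" "?y > 0" using assms by auto
  have "b + (1 - b) * (a - a\<^sup>2 / 2) - ((a + b) - (a + b)\<^sup>2 / 2) = b * a\<^sup>2 / 2 + b\<^sup>2 / 2" for a b :: real
    by (simp add: power2_eq_square field_simps)
  moreover have "0 \<le> ?y * ?x\<^sup>2 / 2 + ?y\<^sup>2 / 2" using y by simp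
  ultimately have "(?x + ?y) - (?x + ?y)\<^sup>2 / 2 \<le> ?y + (1 - ?y) * (?x - ?x\<^sup>2 / 2)"
    by (metis diff_ge_0_iff_ge)
  also have "\<dots> \<le> ?y + (1 - ?y) * cover n k 1" using Suc y by (intro add_mono mult_left_mono) auto
  also have "\<dots> = cover n (Suc k) 1" by simp
  finally show ?case by (simp add: add_divide_distrib add.commute)
qed simp

text \<open>For \<open>k \<le> n\<close> one given element is covered with probability at least
  \<open>k / (2 * n)\<close>, so a further draw gains \<open>k / n^2\<close>. The bound grows by
  half of that; the other half pays for the factor \<open>1 - 2 / n\<close>.\<close>

lemma cover_2_ge:
  assumes "n > 1" "k \<le> n"
  shows "cover n k 2 \<ge> k * (real k - 1) / (4 * (real n)\<^sup>2)"
  using assms(2)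
proof (induction k)
  case (Suc k)
  have kn: "real k / n \<le> 1" using Suc.prems assms by simp
  have "(real k / n)\<^sup>2 \<le> real k / n" using kn power_decreasing[of 1 2 "real k / n"] by simp
  then have c1: "cover n k 1 \<ge> real k / (2 * n)" using cover_1_ge[of n k] assms by simp
  have n2: "real n \<ge> 2" using assms by simp
  have "real (Suc k) * (real (Suc k) - 1) / (4 * (real n)\<^sup>2) \<le>
     2 / n * (real k / (2 * n)) + (1 - 2 / n) * (k * (real k - 1) / (4 * (real n)\<^sup>2))"
  proof -
    let ?r = "2 / n * (real k / (2 * n)) + (1 - 2 / n) * (k * (real k - 1) / (4 * (real n)\<^sup>2))"
    have "?r - real (Suc k) * (real (Suc k) - 1) / (4 * (real n)\<^sup>2) = (real k * (real n - real k) + real k) / (2 * real n ^ 3)"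
      using n2 by (simp add: field_simps power2_eq_square power3_eq_cube)
    also have "\<dots> \<ge> 0" using Suc.prems by simp
    finally show ?thesis by simp
  qed
  also have "\<dots> \<le> 2 / n * cover n k 1 + (1 - 2 / n) * cover n k 2"
    using c1 Suc n2 by (intro add_mono mult_left_mono) auto
  also have "\<dots> = cover n (Suc k) 2" by simp
  finally show ?case .
qed simp

section \<open>Edge counts in random vertex sets\<close>

locale input =
  fixes G :: graph
  assumes input: "input_graph G"
begin

abbreviation n :: nat where "n \<equiv> num_verts G"
abbreviation m :: nat where "m \<equiv> num_edges G"
abbreviation unif :: "nat pmf" where "unif \<equiv> pmf_of_set (verts G)"

lemmas fin = input_graph_finite[OF input]
lemmas bounds = input_graph_bounds[OF input]

lemma V: "verts G \<noteq> {}" and edgeD: "e \<in> edges G \<Longrightarrow> e \<subseteq> verts G" "e \<in> edges G \<Longrightarrow> card e = 2"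
  and nbrs_nonempty: "x \<in> verts G \<Longrightarrow> nbrs G x \<noteq> {}"
  using input by (auto simp: input_graph_def simple_graph_def no_isolated_def)

lemma n_pos: "n > 0" and m_pos: "m > 0"
  using bounds by linarith+

lemma nbrs_sub: "nbrs G x \<subseteq> verts G"
  using edgeD(1) by (auto simp: nbrs_def)

lemma finite_nbrs: "finite (nbrs G x)"
  using nbrs_sub fin finite_subset by blast

lemma deg_pos: "x \<in> verts G \<Longrightarrow> deg G x > 0"
  using nbrs_nonempty finite_nbrs by (simp add: deg_def card_gt_0_iff)

lemma nbrs_irrefl: "y \<in> nbrs G x \<Longrightarrow> y \<noteq> x"
  using edgeD(2) by (fastforce simp: nbrs_def)

lemma set_unif [simp]: "set_pmf unif = verts G"
  using fin V by simp

lemma set_nbr [simp]: "x \<in> verts G \<Longrightarrow> set_pmf (pmf_of_set (nbrs G x)) = nbrs G x"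
  using nbrs_nonempty finite_nbrs by simp

lemma expectation_unif: "measure_pmf.expectation unif f = (\<Sum>x\<in>verts G. f x) / n" for f :: "nat \<Rightarrow> real"
  using fin V by (simp add: integral_pmf_of_set num_verts_def)

lemma expectation_nbr:
  "x \<in> verts G \<Longrightarrow> measure_pmf.expectation (pmf_of_set (nbrs G x)) f = (\<Sum>y\<in>nbrs G x. f y) / deg G x" for f :: "nat \<Rightarrow> real"
  using nbrs_nonempty finite_nbrs by (simp add: integral_pmf_of_set deg_def)

lemma nbr_edges:
  assumes "F \<subseteq> edges G"
  shows "card {e \<in> F. x \<in> e} = card {y \<in> nbrs G x. {x, y} \<in> F}"
proof -
  have "{e \<in> F. x \<in> e} = (\<lambda>y. {x, y}) ` {y \<in> nbrs G x. {x, y} \<in> F}"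
  proof (intro equalityI subsetI)
    fix e assume e: "e \<in> {e \<in> F. x \<in> e}"
    then obtain y where "e = {x, y}" using edgeD(2)[of e] assms by (auto simp: card_2_iff doubleton_eq_iff)
    then show "e \<in> (\<lambda>y. {x, y}) ` {y \<in> nbrs G x. {x, y} \<in> F}" using e assms by (auto simp: nbrs_def)
  qed auto
  then show ?thesis by (auto simp: card_image inj_on_def doubleton_eq_iff)
qed

text \<open>Stated for any set of edges, as it is applied both to all edges and to the light
  ones.\<close>

lemma handshake:
  assumes "F \<subseteq> edges G"
  shows "(\<Sum>x\<in>verts G. card {y \<in> nbrs G x. {x, y} \<in> F}) = 2 * card F"
proof -
  have finF: "finite F" using assms fin finite_subset by blast
  have "(\<Sum>x\<in>verts G. card {y \<in> nbrs G x. {x, y} \<in> F}) = (\<Sum>x\<in>verts G. \<Sum>e\<in>F. of_bool (x \<in> e))"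
    using finF by (intro sum.cong) (auto simp: nbr_edges[OF assms, symmetric] Int_def)
  also have "\<dots> = (\<Sum>e\<in>F. \<Sum>x\<in>verts G. of_bool (x \<in> e))" by (rule sum.swap)
  also have "\<dots> = (\<Sum>e\<in>F. 2)"
  proof (rule sum.cong)
    fix e assume "e \<in> F"
    then have "e \<subseteq> verts G" "card e = 2" using assms edgeD by auto
    then show "(\<Sum>x\<in>verts G. of_bool (x \<in> e)) = (2 :: nat)" using fin by (simp add: Int_absorb1)
  qed simp
  finally show ?thesis by simp
qed

lemma sum_deg: "(\<Sum>x\<in>verts G. deg G x) = 2 * m"
  using handshake[of "edges G"] by (simp add: deg_def num_edges_def nbrs_def)

lemma deg_less: "y \<in> verts G \<Longrightarrow> deg G y < n"
  unfolding deg_def num_verts_def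
  using fin(1) nbrs_sub[of y] nbrs_irrefl[of y y] by (intro psubset_card_mono) auto

text \<open>A set, because \<open>Additive\<close> takes one. Repeated vertices are lost, so the
  number of pairs actually drawn is random and has to be estimated too.\<close>

primrec draw :: "nat \<Rightarrow> nat set pmf" where
  "draw 0 = return_pmf {}"
| "draw (Suc k) = bind_pmf unif (\<lambda>x. bind_pmf (draw k) (\<lambda>S. return_pmf (insert x S)))"

lemma set_draw: "S \<in> set_pmf (draw k) \<Longrightarrow> S \<subseteq> verts G \<and> finite S \<and> card S \<le> k"
proof (induction k arbitrary: S)
  case (Suc k)
  then obtain x S' where "x \<in> verts G" "S' \<in> set_pmf (draw k)" "S = insert x S'" by auto
  then show ?case using Suc.IH[of S'] by (auto simp: card_insert_if)
qed simp

lemma finite_draw: "finite (set_pmf (draw k))"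
  using fin by (induction k) auto

lemma prob_draw_superset:
  "U \<subseteq> verts G \<Longrightarrow> measure_pmf.expectation (draw k) (\<lambda>S. of_bool (U \<subseteq> S)) = cover n k (card U)"
proof (induction k arbitrary: U)
  case 0
  then have "finite U" using fin finite_subset by blast
  then show ?case by simp
next
  case (Suc k)
  have finU: "finite U" using Suc fin finite_subset by blast
  have "measure_pmf.expectation (draw (Suc k)) (\<lambda>S. of_bool (U \<subseteq> S) :: real) =
     (\<Sum>x\<in>verts G. measure_pmf.expectation (draw k) (\<lambda>S. of_bool (U \<subseteq> insert x S))) / n"
    using fin finite_draw by (simp add: expectation_bind_finite expectation_unif)
  also have "(\<Sum>x\<in>verts G. measure_pmf.expectation (draw k) (\<lambda>S. of_bool (U \<subseteq> insert x S)) :: real) =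
     (\<Sum>x\<in>verts G. cover n k (if x \<in> U then card U - 1 else card U))"
  proof (rule sum.cong)
    fix x
    have "U \<subseteq> insert x S \<longleftrightarrow> U - {x} \<subseteq> S" for S by blast
    then have "measure_pmf.expectation (draw k) (\<lambda>S. of_bool (U \<subseteq> insert x S)) = measure_pmf.expectation (draw k) (\<lambda>S. of_bool (U - {x} \<subseteq> S) :: real)"
      by simp
    also have "\<dots> = cover n k (card (U - {x}))" using Suc.prems by (intro Suc.IH) auto
    finally show "measure_pmf.expectation (draw k) (\<lambda>S. of_bool (U \<subseteq> insert x S)) = cover n k (if x \<in> U then card U - 1 else card U)"
      using finU by auto
  qed simp
  also have "\<dots> = (\<Sum>x\<in>U. cover n k (card U - 1)) + (\<Sum>x\<in>verts G - U. cover n k (card U))"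
    using Suc.prems fin by (subst sum.subset_diff[OF Suc.prems]) auto
  also have "\<dots> = card U * cover n k (card U - 1) + (real n - card U) * cover n k (card U)"
    using Suc.prems finU card_mono[OF fin(1) Suc.prems] by (simp add: card_Diff_subset num_verts_def)
  finally show ?case using n_pos by (simp add: field_simps)
qed

lemma expectation_draw_sum:
  fixes f :: "'c \<Rightarrow> nat set \<Rightarrow> real"
  shows "measure_pmf.expectation (draw k) (\<lambda>S. \<Sum>i\<in>I. f i S) = (\<Sum>i\<in>I. measure_pmf.expectation (draw k) (f i))"
  by (intro Bochner_Integration.integral_sum integrable_measure_pmf_finite finite_draw)

lemma finite_pairs: "finite {e. e \<subseteq> verts G \<and> card e = 2}"
  by (rule finite_subset[of _ "Pow (verts G)"]) (use fin in auto)

lemma expectation_pairs: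
  assumes F: "F \<subseteq> {e. e \<subseteq> verts G \<and> card e = 2}"
  shows "measure_pmf.expectation (draw k) (\<lambda>S. real (card {e \<in> F. e \<subseteq> S})) = card F * cover n k 2"
proof -
  have finF: "finite F" using F finite_pairs by (rule finite_subset)
  have "measure_pmf.expectation (draw k) (\<lambda>S. real (card {e \<in> F. e \<subseteq> S})) =
     measure_pmf.expectation (draw k) (\<lambda>S. \<Sum>e\<in>F. of_bool (e \<subseteq> S))"
    using finF by (simp add: Int_def)
  also have "\<dots> = (\<Sum>e\<in>F. cover n k (card e))"
    using F unfolding expectation_draw_sum by (intro sum.cong prob_draw_superset) auto
  also have "\<dots> = card F * cover n k 2" using F by (simp add: subset_iff)
  finally show ?thesis .
qed

text \<open>The square is a sum over two edges. Equal edges cover 2 vertices, edges with one common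
  vertex 3, disjoint edges 4, and an edge has at most \<open>2 * D\<close> partners of the second
  kind. The resulting term \<open>2 * D * (k / n)\<close> is the reason for excluding heavy
  vertices.\<close>

lemma second_moment_pairs:
  assumes F: "F \<subseteq> {e. e \<subseteq> verts G \<and> card e = 2}" and D: "\<And>v. card {e \<in> F. v \<in> e} \<le> D"
  shows "measure_pmf.expectation (draw k) (\<lambda>S. (real (card {e \<in> F. e \<subseteq> S}))\<^sup>2) \<le>
    card F * (k / n)\<^sup>2 * (1 + 2 * D * (k / n) + card F * (k / n)\<^sup>2)"
proof -
  let ?q = "real k / n"
  have q: "?q \<ge> 0" by simp
  have finF: "finite F" using F finite_pairs by (rule finite_subset)
  have "measure_pmf.expectation (draw k) (\<lambda>S. (real (card {e \<in> F. e \<subseteq> S}))\<^sup>2) =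
     measure_pmf.expectation (draw k) (\<lambda>S. \<Sum>e\<in>F. \<Sum>e'\<in>F. of_bool (e \<union> e' \<subseteq> S))"
  proof (rule arg_cong[where f = "measure_pmf.expectation (draw k)"], rule ext)
    fix S
    have "real (card {e \<in> F. e \<subseteq> S}) = (\<Sum>e\<in>F. of_bool (e \<subseteq> S))" using finF by (simp add: Int_def)
    then show "(real (card {e \<in> F. e \<subseteq> S}))\<^sup>2 = (\<Sum>e\<in>F. \<Sum>e'\<in>F. of_bool (e \<union> e' \<subseteq> S))"
      by (simp add: power2_eq_square sum_product flip: of_bool_conj)
  qed
  also have "\<dots> = (\<Sum>e\<in>F. \<Sum>e'\<in>F. cover n k (card (e \<union> e')))"
    unfolding expectation_draw_sum using F by (intro sum.cong prob_draw_superset) auto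
  also have "\<dots> \<le> (\<Sum>e\<in>F. ?q ^ 2 + ?q ^ 3 * (2 * D) + card F * ?q ^ 4)"
  proof (rule sum_mono)
    fix e assume e: "e \<in> F"
    then have e2: "card e = 2" "e \<subseteq> verts G" and fe: "finite e" using F by (auto intro: finite_subset[OF _ fin(1)])
    have "cover n k (card (e \<union> e')) \<le> of_bool (e = e') * ?q ^ 2 + ?q ^ 3 * (\<Sum>v\<in>e. of_bool (v \<in> e')) + ?q ^ 4"
      if e': "e' \<in> F" for e'
    proof -
      have e'2: "card e' = 2" "e' \<subseteq> verts G" and fe': "finite e'" using F e' by (auto intro: finite_subset[OF _ fin(1)])
      have "cover n k (card (e \<union> e')) \<le> ?q ^ card (e \<union> e')"
        using e2 e'2 n_pos fin by (intro cover_le) (auto simp: num_verts_def intro!: card_mono)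
      moreover have cU: "card (e \<union> e') + card (e \<inter> e') = 4" using card_Un_Int[OF fe fe'] e2 e'2 by simp
      consider "e = e'" | "e \<noteq> e'" "card (e \<inter> e') \<ge> 1" | "card (e \<inter> e') = 0" by linarith
      then have "?q ^ card (e \<union> e') \<le> of_bool (e = e') * ?q ^ 2 + ?q ^ 3 * card (e \<inter> e') + ?q ^ 4"
      proof cases
        case 1
        then show ?thesis using e2 q by simp
      next
        case 2
        have "card (e \<inter> e') \<noteq> 2"
        proof
          assume eq: "card (e \<inter> e') = 2"
          have "e \<inter> e' = e" using eq e2 by (intro card_subset_eq[OF fe]) auto
          moreover have "e \<inter> e' = e'" using eq e'2 by (intro card_subset_eq[OF fe']) auto
          ultimately have "e = e'" by blast
          then show False using 2 by simp
        qed
        moreover have "card (e \<inter> e') \<le> 2" using e2 fe card_mono[of e "e \<inter> e'"] by simp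
        ultimately have "card (e \<inter> e') = 1" using 2 by linarith
        then show ?thesis using cU q by simp
      next
        case 3
        then show ?thesis using cU q by simp
      qed
      moreover have "real (card (e \<inter> e')) = (\<Sum>v\<in>e. of_bool (v \<in> e'))" using fe by (simp add: Int_def)
      ultimately show ?thesis by simp
    qed
    then have "(\<Sum>e'\<in>F. cover n k (card (e \<union> e'))) \<le>
        (\<Sum>e'\<in>F. of_bool (e = e') * ?q ^ 2 + ?q ^ 3 * (\<Sum>v\<in>e. of_bool (v \<in> e')) + ?q ^ 4)" by (rule sum_mono)
    also have "\<dots> = ?q ^ 2 + ?q ^ 3 * (\<Sum>e'\<in>F. \<Sum>v\<in>e. of_bool (v \<in> e')) + card F * ?q ^ 4"
      using finF e by (simp add: sum.distrib flip: sum_distrib_left sum_distrib_right)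
    also have "(\<Sum>e'\<in>F. \<Sum>v\<in>e. of_bool (v \<in> e')) = (\<Sum>v\<in>e. real (card {e' \<in> F. v \<in> e'}))"
      using finF by (subst sum.swap) (simp add: Int_def)
    also have "?q ^ 2 + ?q ^ 3 * \<dots> + card F * ?q ^ 4 \<le> ?q ^ 2 + ?q ^ 3 * (2 * D) + card F * ?q ^ 4"
    proof -
      have "(\<Sum>v\<in>e. real (card {e' \<in> F. v \<in> e'})) \<le> (\<Sum>v\<in>e. real D)" using D by (intro sum_mono) simp
      then show ?thesis using q e2 by (intro add_mono mult_left_mono) auto
    qed
    finally show "(\<Sum>e'\<in>F. cover n k (card (e \<union> e'))) \<le> ?q ^ 2 + ?q ^ 3 * (2 * D) + card F * ?q ^ 4" .
  qed
  also have "\<dots> = card F * ?q\<^sup>2 * (1 + 2 * D * ?q + card F * ?q\<^sup>2)"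
    by (simp add: algebra_simps power2_eq_square power3_eq_cube power4_eq_xxxx)
  finally show ?thesis by simp
qed

text \<open>The factor \<open>cover n k 2\<close> is that of \<open>expectation_pairs\<close> and
  cancels in the quotient of the two counts. The second moment is controlled by
  \<open>card S \<le> k\<close>.\<close>

lemma expectation_choose:
  "measure_pmf.expectation (draw k) (\<lambda>S. real (card S choose 2)) = real n * (real n - 1) / 2 * cover n k 2"
  "measure_pmf.expectation (draw k) (\<lambda>S. (real (card S choose 2))\<^sup>2) \<le>
     (real k)\<^sup>2 / 2 * measure_pmf.expectation (draw k) (\<lambda>S. real (card S choose 2))"
proof -
  let ?F = "{e. e \<subseteq> verts G \<and> card e = 2}"
  have eq: "card S choose 2 = card {e \<in> ?F. e \<subseteq> S}" if "S \<in> set_pmf (draw k)" for S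
  proof -
    have "{e \<in> ?F. e \<subseteq> S} = {e. e \<subseteq> S \<and> card e = 2}" using set_draw[OF that] by auto
    then show ?thesis using set_draw[OF that] by (simp add: n_subsets)
  qed
  have "measure_pmf.expectation (draw k) (\<lambda>S. real (card S choose 2)) = measure_pmf.expectation (draw k) (\<lambda>S. real (card {e \<in> ?F. e \<subseteq> S}))"
    using eq by (intro integral_cong_AE AE_pmfI) auto
  also have "\<dots> = card ?F * cover n k 2" by (rule expectation_pairs) simp
  also have "card ?F = n choose 2" using fin by (simp add: n_subsets num_verts_def)
  finally show "measure_pmf.expectation (draw k) (\<lambda>S. real (card S choose 2)) = real n * (real n - 1) / 2 * cover n k 2"
    using bounds by (simp add: binomial_gbinomial gbinomial_pochhammer' numeral_2_eq_2 pochhammer_Suc algebra_simps)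
  have "measure_pmf.expectation (draw k) (\<lambda>S. (real (card S choose 2))\<^sup>2) \<le>
     measure_pmf.expectation (draw k) (\<lambda>S. (real k)\<^sup>2 / 2 * real (card S choose 2))"
  proof (rule expectation_mono_finite[OF finite_draw])
    fix S assume "S \<in> set_pmf (draw k)"
    then have "card S \<le> k" using set_draw by blast
    then have "card S * (card S - 1) div 2 \<le> k * k div 2" by (intro div_le_mono mult_mono) auto
    then have "real (card S choose 2) \<le> real (k * k div 2)" unfolding choose_two of_nat_le_iff .
    also have "\<dots> \<le> (real k)\<^sup>2 / 2" by (simp add: power2_eq_square flip: of_nat_mult)
    finally show "(real (card S choose 2))\<^sup>2 \<le> (real k)\<^sup>2 / 2 * real (card S choose 2)"
      unfolding power2_eq_square by (intro mult_right_mono) auto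
  qed
  then show "measure_pmf.expectation (draw k) (\<lambda>S. (real (card S choose 2))\<^sup>2) \<le>
     (real k)\<^sup>2 / 2 * measure_pmf.expectation (draw k) (\<lambda>S. real (card S choose 2))" by simp
qed

end

section \<open>Light edges, adjacency tests and the search for a heavy vertex\<close>

context input
begin

definition light :: "nat \<Rightarrow> nat set set" where
  "light D = {e \<in> edges G. \<forall>v\<in>e. deg G v \<le> D}"

lemma light_sub: "light D \<subseteq> edges G"
  by (auto simp: light_def)

lemma light_pairs: "light D \<subseteq> {e. e \<subseteq> verts G \<and> card e = 2}"
  using light_sub edgeD by blast

lemma card_light_le: "card (light D) \<le> m"
  unfolding num_edges_def using fin by (intro card_mono light_sub) auto

lemma light_degree: "card {e \<in> light D. v \<in> e} \<le> D"
proof (cases "deg G v \<le> D")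
  case True
  have "card {e \<in> light D. v \<in> e} \<le> deg G v"
    unfolding nbr_edges[OF light_sub] deg_def using finite_nbrs by (intro card_mono) auto
  then show ?thesis using True by linarith
next
  case False
  then have "{e \<in> light D. v \<in> e} = {}" by (auto simp: light_def)
  then show ?thesis by (metis card.empty le0)
qed

lemma expectation_unif_nbr:
  fixes h :: "'a \<Rightarrow> real"
  shows "measure_pmf.expectation (bind_pmf unif (\<lambda>x. bind_pmf (pmf_of_set (nbrs G x)) (\<lambda>y. return_pmf (f x y)))) h =
    (\<Sum>x\<in>verts G. (\<Sum>y\<in>nbrs G x. h (f x y)) / deg G x) / n"
proof -
  have "measure_pmf.expectation (bind_pmf (pmf_of_set (nbrs G x)) (\<lambda>y. return_pmf (f x y))) h = (\<Sum>y\<in>nbrs G x. h (f x y)) / deg G x"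
    if "x \<in> verts G" for x
    using that finite_nbrs by (subst expectation_bind_finite) (auto simp: expectation_nbr)
  then show ?thesis
    using fin finite_nbrs by (subst expectation_bind_finite) (auto simp: expectation_unif)
qed

text \<open>An importance weight: the ordered pair \<open>(x, y)\<close> of neighbours arises with
  probability \<open>1 / (n * deg G x)\<close>, so the value \<open>deg G x\<close> makes all light
  edges count equally. The cutoff at \<open>D\<close> bounds the value and with it the
  variance.\<close>

definition light_deg :: "nat \<Rightarrow> real pmf" where
  "light_deg D = bind_pmf unif (\<lambda>x. bind_pmf (pmf_of_set (nbrs G x)) (\<lambda>y.
     return_pmf (if deg G x \<le> D \<and> deg G y \<le> D then real (deg G x) else 0)))"

lemma finite_light_deg: "finite (set_pmf (light_deg D))"
  using fin finite_nbrs by (auto simp: light_deg_def)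

lemma expectation_light_deg:
  "measure_pmf.expectation (light_deg D) (\<lambda>x. x) = 2 * card (light D) / n"
  "measure_pmf.expectation (light_deg D) (\<lambda>x. x\<^sup>2) \<le> D * measure_pmf.expectation (light_deg D) (\<lambda>x. x)"
proof -
  have "measure_pmf.expectation (light_deg D) (\<lambda>x. x) =
    (\<Sum>x\<in>verts G. (\<Sum>y\<in>nbrs G x. if deg G x \<le> D \<and> deg G y \<le> D then real (deg G x) else 0) / deg G x) / n"
    unfolding light_deg_def by (rule expectation_unif_nbr)
  also have "(\<Sum>x\<in>verts G. (\<Sum>y\<in>nbrs G x. if deg G x \<le> D \<and> deg G y \<le> D then real (deg G x) else 0) / deg G x) =
    (\<Sum>x\<in>verts G. real (card {y \<in> nbrs G x. {x, y} \<in> light D}))"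
  proof (rule sum.cong)
    fix x assume x: "x \<in> verts G"
    have "(\<Sum>y\<in>nbrs G x. if deg G x \<le> D \<and> deg G y \<le> D then real (deg G x) else 0) =
       (\<Sum>y\<in>nbrs G x. if {x, y} \<in> light D then real (deg G x) else 0)"
      by (intro sum.cong) (auto simp: light_def nbrs_def)
    also have "\<dots> = real (card {y \<in> nbrs G x. {x, y} \<in> light D}) * deg G x"
      using finite_nbrs by (simp add: sum.If_cases Int_def)
    finally show "(\<Sum>y\<in>nbrs G x. if deg G x \<le> D \<and> deg G y \<le> D then real (deg G x) else 0) / deg G x =
      real (card {y \<in> nbrs G x. {x, y} \<in> light D})" using deg_pos[OF x] by simp
  qed simp
  also have "\<dots> = 2 * card (light D)"
    using arg_cong[OF handshake[OF light_sub, of D], of real] by simp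
  finally show "measure_pmf.expectation (light_deg D) (\<lambda>x. x) = 2 * card (light D) / n" by simp
  have "measure_pmf.expectation (light_deg D) (\<lambda>x. x\<^sup>2) \<le> measure_pmf.expectation (light_deg D) (\<lambda>x. D * x)"
  proof (rule expectation_mono_finite[OF finite_light_deg])
    fix x assume "x \<in> set_pmf (light_deg D)"
    then have "0 \<le> x" "x \<le> D" by (auto simp: light_deg_def split: if_splits)
    then show "x\<^sup>2 \<le> D * x" unfolding power2_eq_square by (intro mult_right_mono) auto
  qed
  then show "measure_pmf.expectation (light_deg D) (\<lambda>x. x\<^sup>2) \<le> D * measure_pmf.expectation (light_deg D) (\<lambda>x. x)" by simp
qed

text \<open>\<open>Additive\<close> on two vertices serves as an adjacency test; for
  \<open>z = y\<close> it yields 0, as it should.\<close>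

definition hit :: "nat \<Rightarrow> real pmf" where
  "hit y = bind_pmf unif (\<lambda>z. return_pmf (real (card {e \<in> edges G. e \<subseteq> {z, y}})))"

lemma finite_hit: "finite (set_pmf (hit y))"
  using fin by (auto simp: hit_def)

lemma edges_in_pair: "card {e \<in> edges G. e \<subseteq> {z, y}} = of_bool (z \<in> nbrs G y)"
proof -
  have "e = {z, y}" if "e \<in> edges G" "e \<subseteq> {z, y}" for e
    using edgeD(2)[OF that(1)] that(2) by (intro card_subset_eq) (auto simp: card_insert_if split: if_splits dest: card_mono[rotated])
  then have "{e \<in> edges G. e \<subseteq> {z, y}} = (if z \<in> nbrs G y then {{z, y}} else {})"
    by (auto simp: nbrs_def insert_commute)
  then show ?thesis by simp
qed

lemma expectation_hit:
  "measure_pmf.expectation (hit y) (\<lambda>x. x) = deg G y / n"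
  "measure_pmf.expectation (hit y) (\<lambda>x. x\<^sup>2) = deg G y / n"
proof -
  have "(\<Sum>z\<in>verts G. of_bool (z \<in> nbrs G y)) = real (deg G y)"
    using fin nbrs_sub[of y] by (simp add: deg_def Int_absorb1)
  moreover have "(of_bool b :: real)\<^sup>2 = of_bool b" for b by simp
  ultimately show "measure_pmf.expectation (hit y) (\<lambda>x. x) = deg G y / n" "measure_pmf.expectation (hit y) (\<lambda>x. x\<^sup>2) = deg G y / n"
    unfolding hit_def edges_in_pair using fin
    by (simp_all add: expectation_bind_finite expectation_unif)
qed

definition rand_nbr :: "nat pmf" where
  "rand_nbr = bind_pmf unif (\<lambda>x. pmf_of_set (nbrs G x))"

text \<open>
  Orient every edge from its endpoint of lower degree to the one of higher degree. Out-degrees are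
  at most \<open>sqrt (2 * m)\<close>, so a random neighbour is the head of an edge into a heavy vertex often enough.
\<close>

lemma higher_nbrs: "(card {y \<in> nbrs G x. deg G x \<le> deg G y})\<^sup>2 \<le> 2 * m"
proof -
  let ?H = "{y \<in> nbrs G x. deg G x \<le> deg G y}"
  have "(card ?H)\<^sup>2 \<le> card ?H * deg G x"
    unfolding power2_eq_square deg_def using finite_nbrs by (intro mult_left_mono card_mono) auto
  also have "\<dots> = (\<Sum>y\<in>?H. deg G x)" by simp
  also have "\<dots> \<le> (\<Sum>y\<in>?H. deg G y)" by (intro sum_mono) auto
  also have "\<dots> \<le> (\<Sum>y\<in>verts G. deg G y)" using nbrs_sub fin by (intro sum_mono2) auto
  finally show ?thesis by (simp add: sum_deg)
qed

text \<open>The probability is at least \<open>1 / n\<close> times the sum of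
  \<open>1 / deg G x\<close> over the oriented edges in \<open>P\<close>. There are at least
  \<open>m / 2\<close> of these, and by the bound on out-degrees the mean of \<open>deg G x\<close>
  over them is at most \<open>4 * sqrt (2 * m)\<close>; convexity of \<open>1 / a\<close> does the
  rest.\<close>

lemma prob_rand_nbr_heavy:
  assumes "2 * card {e \<in> edges G. \<exists>v\<in>e. \<delta> \<le> deg G v} \<ge> m"
  shows "measure_pmf.prob rand_nbr {y. \<delta> \<le> deg G y} \<ge> sqrt (2 * m) / (16 * n)"
proof -
  define P where "P = (SIGMA x:verts G. {y \<in> nbrs G x. deg G x \<le> deg G y \<and> \<delta> \<le> deg G y})"
  have finP: "finite P" unfolding P_def using fin finite_nbrs by (intro finite_SigmaI) auto
  have "{e \<in> edges G. \<exists>v\<in>e. \<delta> \<le> deg G v} \<subseteq> (\<lambda>(x, y). {x, y}) ` P"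
  proof
    fix e assume "e \<in> {e \<in> edges G. \<exists>v\<in>e. \<delta> \<le> deg G v}"
    then have e: "e \<in> edges G" and h: "\<exists>v\<in>e. \<delta> \<le> deg G v" by auto
    obtain x y where xy: "e = {x, y}" "deg G x \<le> deg G y"
      using edgeD(2)[OF e] by (metis card_2_iff insert_commute linear)
    then have "\<delta> \<le> deg G y" using h by auto
    then have "(x, y) \<in> P" using xy e edgeD(1)[OF e] by (auto simp: P_def nbrs_def)
    then show "e \<in> (\<lambda>(x, y). {x, y}) ` P" using xy by force
  qed
  then have "card {e \<in> edges G. \<exists>v\<in>e. \<delta> \<le> deg G v} \<le> card P" using finP by (meson surj_card_le)
  then have cP: "real (card P) \<ge> m / 2" using assms by linarith
  define s where "s = (\<Sum>(x, y)\<in>P. real (deg G x))"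
  define u where "u = sqrt (2 * real m)"
  have u: "u > 0" "u * u = 2 * m" using m_pos by (auto simp: u_def)
  have "s \<le> 2 * m * u"
  proof -
    have "s = (\<Sum>x\<in>verts G. \<Sum>y\<in>{y \<in> nbrs G x. deg G x \<le> deg G y \<and> \<delta> \<le> deg G y}. real (deg G x))"
      unfolding s_def P_def using fin finite_nbrs by (subst sum.Sigma) auto
    also have "\<dots> \<le> (\<Sum>x\<in>verts G. u * deg G x)"
    proof (rule sum_mono)
      fix x
      let ?H = "{y \<in> nbrs G x. deg G x \<le> deg G y \<and> \<delta> \<le> deg G y}"
      have "(real (card ?H))\<^sup>2 \<le> (real (card {y \<in> nbrs G x. deg G x \<le> deg G y}))\<^sup>2"
        using finite_nbrs by (intro power_mono) (auto intro!: card_mono)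
      also have "\<dots> \<le> 2 * real m" using of_nat_mono[OF higher_nbrs[of x], where 'a = real] by simp
      finally have "real (card ?H) \<le> u" unfolding u_def by (rule real_le_rsqrt)
      then show "(\<Sum>y\<in>?H. real (deg G x)) \<le> u * deg G x" by (simp add: mult_right_mono)
    qed
    also have "\<dots> = u * real (\<Sum>x\<in>verts G. deg G x)" by (simp add: sum_distrib_left)
    finally show ?thesis by (simp add: sum_deg mult_ac)
  qed
  \<comment> \<open>The tangent of \<open>1 / a\<close> at \<open>1 / t\<close> takes the place of
    Jensen's inequality; below, \<open>1 / t\<close> is the bound \<open>4 * u\<close> on the mean
    degree.\<close>
  have inv: "1 / a \<ge> 2 * t - t\<^sup>2 * a" if "a > 0" for a t :: real
  proof -
    have "0 \<le> (1 - t * a)\<^sup>2 / a" using that by simp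
    also have "\<dots> = 1 / a - (2 * t - t\<^sup>2 * a)" using that by (simp add: power2_eq_square field_simps)
    finally show ?thesis by simp
  qed
  define t where "t = 1 / (4 * u)"
  have "u / 16 = 2 * t * (m / 2) - t\<^sup>2 * (2 * m * u)"
    using u by (simp add: t_def power2_eq_square field_simps)
  also have "\<dots> \<le> 2 * t * card P - t\<^sup>2 * s"
    using cP \<open>s \<le> 2 * m * u\<close> u by (intro diff_mono mult_left_mono) (auto simp: t_def)
  also have "\<dots> = (\<Sum>(x, y)\<in>P. 2 * t - t\<^sup>2 * deg G x)"
    by (simp add: case_prod_unfold sum_subtractf s_def sum_distrib_left)
  also have "\<dots> \<le> (\<Sum>(x, y)\<in>P. 1 / deg G x)"
    by (intro sum_mono) (auto simp: P_def intro!: inv deg_pos)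
  also have "\<dots> = (\<Sum>x\<in>verts G. \<Sum>y\<in>{y \<in> nbrs G x. deg G x \<le> deg G y \<and> \<delta> \<le> deg G y}. 1 / deg G x)"
    unfolding P_def using fin finite_nbrs by (subst sum.Sigma) auto
  also have "\<dots> \<le> (\<Sum>x\<in>verts G. \<Sum>y\<in>nbrs G x. of_bool (\<delta> \<le> deg G y) / deg G x)"
  proof (rule sum_mono)
    fix x
    have "(\<Sum>y\<in>{y \<in> nbrs G x. deg G x \<le> deg G y \<and> \<delta> \<le> deg G y}. 1 / real (deg G x)) =
      (\<Sum>y\<in>{y \<in> nbrs G x. deg G x \<le> deg G y \<and> \<delta> \<le> deg G y}. of_bool (\<delta> \<le> deg G y) / deg G x)" by (intro sum.cong) auto
    also have "\<dots> \<le> (\<Sum>y\<in>nbrs G x. of_bool (\<delta> \<le> deg G y) / deg G x)" using finite_nbrs by (intro sum_mono2) auto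
    finally show "(\<Sum>y\<in>{y \<in> nbrs G x. deg G x \<le> deg G y \<and> \<delta> \<le> deg G y}. 1 / real (deg G x)) \<le>
      (\<Sum>y\<in>nbrs G x. of_bool (\<delta> \<le> deg G y) / deg G x)" .
  qed
  also have "\<dots> = measure_pmf.expectation rand_nbr (\<lambda>y. of_bool (\<delta> \<le> deg G y)) * n"
    using expectation_unif_nbr[of "\<lambda>x y. y" "\<lambda>y. of_bool (\<delta> \<le> deg G y)"] n_pos
    by (simp only: rand_nbr_def bind_return_pmf' sum_divide_distrib[of _ "nbrs G _"]) simp
  also have "measure_pmf.expectation rand_nbr (\<lambda>y. of_bool (\<delta> \<le> deg G y)) = measure_pmf.prob rand_nbr {y. \<delta> \<le> deg G y}"
  proof -
    have "(\<lambda>y. of_bool (\<delta> \<le> deg G y)) = (indicator {y. \<delta> \<le> deg G y} :: nat \<Rightarrow> real)" by (auto simp: indicator_def)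
    then show ?thesis by simp
  qed
  finally show ?thesis using n_pos by (simp add: u_def field_simps)
qed

primrec best :: "nat \<Rightarrow> nat pmf" where
  "best 0 = rand_nbr"
| "best (Suc t) = bind_pmf rand_nbr (\<lambda>y. bind_pmf (best t) (\<lambda>y'. return_pmf (if deg G y' \<le> deg G y then y else y')))"

lemma prob_best_less:
  "measure_pmf.prob (best t) {y. deg G y < \<delta>} \<le> (1 - measure_pmf.prob rand_nbr {y. \<delta> \<le> deg G y}) ^ Suc t"
proof (induction t)
  case 0
  have "{y. deg G y < \<delta>} = UNIV - {y. \<delta> \<le> deg G y}" by auto
  then show ?case by (simp add: measure_pmf.prob_compl[simplified])
next
  case (Suc t)
  let ?p = "measure_pmf.prob rand_nbr {y. deg G y < \<delta>}"
  have "{y. deg G y < \<delta>} = UNIV - {y. \<delta> \<le> deg G y}" by auto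
  then have p: "?p = 1 - measure_pmf.prob rand_nbr {y. \<delta> \<le> deg G y}" by (simp add: measure_pmf.prob_compl[simplified])
  have "emeasure (measure_pmf (best (Suc t))) {y. deg G y < \<delta>} =
     (\<integral>\<^sup>+y. (\<integral>\<^sup>+y'. indicator {y. deg G y < \<delta>} (if deg G y' \<le> deg G y then y else y') \<partial>measure_pmf (best t)) \<partial>measure_pmf rand_nbr)"
    by (simp add: indicator_def)
  also have "\<dots> = (\<integral>\<^sup>+y. (\<integral>\<^sup>+y'. indicator {y. deg G y < \<delta>} y' * indicator {y. deg G y < \<delta>} y \<partial>measure_pmf (best t)) \<partial>measure_pmf rand_nbr)"
    by (intro nn_integral_cong) (auto simp: indicator_def)
  also have "\<dots> = emeasure (best t) {y. deg G y < \<delta>} * emeasure rand_nbr {y. deg G y < \<delta>}"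
    by (simp add: nn_integral_cmult nn_integral_multc)
  finally have "measure_pmf.prob (best (Suc t)) {y. deg G y < \<delta>} = measure_pmf.prob (best t) {y. deg G y < \<delta>} * ?p"
    by (simp add: measure_pmf.emeasure_eq_measure flip: ennreal_mult)
  also have "\<dots> \<le> (1 - measure_pmf.prob rand_nbr {y. \<delta> \<le> deg G y}) ^ Suc t * ?p"
    by (intro mult_right_mono Suc) simp
  finally show ?case unfolding p by (simp add: mult.commute)
qed

text \<open>Compare with the largest degree that is reached at one end of at least half of the edges.\<close>

lemma prob_best_heavy:
  "measure_pmf.prob (best t) {y. \<not> real m \<le> 2 * card (light (deg G y))} \<le> 16 * n / (real (Suc t) * sqrt (2 * m))"
proof -
  define heavy where "heavy = (\<lambda>\<delta>. card {e \<in> edges G. \<exists>v\<in>e. \<delta> \<le> deg G v})"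
  have split: "card (light D) + heavy (Suc D) = m" for D
  proof -
    have "light D \<union> {e \<in> edges G. \<exists>v\<in>e. Suc D \<le> deg G v} = edges G" "light D \<inter> {e \<in> edges G. \<exists>v\<in>e. Suc D \<le> deg G v} = {}"
      by (auto simp: light_def not_less_eq_eq)
    then show ?thesis unfolding heavy_def num_edges_def using fin(2) finite_subset[OF light_sub fin(2)]
      by (subst card_Un_disjoint[symmetric]) simp_all
  qed
  define P where "P = (\<lambda>\<delta>. m \<le> 2 * heavy \<delta>)"
  have "e \<noteq> {}" if "e \<in> edges G" for e using edgeD(2)[OF that] by auto
  then have "{e \<in> edges G. \<exists>v\<in>e. 0 \<le> deg G v} = edges G" by blast
  then have "P 0" by (simp add: P_def heavy_def num_edges_def)
  have bnd: "\<delta> \<le> n" if "P \<delta>" for \<delta>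
  proof (rule ccontr)
    assume "\<not> \<delta> \<le> n"
    then have "{e \<in> edges G. \<exists>v\<in>e. \<delta> \<le> deg G v} = {}" using deg_less edgeD(1) by fastforce
    then show False using that m_pos unfolding P_def heavy_def by (simp only: card.empty)
  qed
  define \<delta> where "\<delta> = (GREATEST \<delta>. P \<delta>)"
  have \<delta>: "P \<delta>" unfolding \<delta>_def using \<open>P 0\<close> bnd by (rule GreatestI_nat)
  have "\<not> P (Suc \<delta>)" using Greatest_le_nat[of P "Suc \<delta>" n] bnd unfolding \<delta>_def by auto
  have light: "m \<le> 2 * card (light D)" if "\<delta> \<le> D" for D
  proof -
    have "heavy (Suc D) \<le> heavy (Suc \<delta>)" unfolding heavy_def using fin that
      by (intro card_mono) (auto intro: le_trans[of "Suc \<delta>" "Suc D"])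
    then show ?thesis using \<open>\<not> P (Suc \<delta>)\<close> split[of D] by (simp add: P_def)
  qed
  define p where "p = measure_pmf.prob rand_nbr {y. \<delta> \<le> deg G y}"
  have p: "p \<ge> sqrt (2 * m) / (16 * n)" "p \<le> 1"
    using prob_rand_nbr_heavy[of \<delta>] \<delta> by (auto simp: p_def P_def heavy_def)
  have pos: "sqrt (2 * m) / (16 * n) > 0" using m_pos n_pos by simp
  have "measure_pmf.prob (best t) {y. \<not> real m \<le> 2 * card (light (deg G y))} \<le> measure_pmf.prob (best t) {y. deg G y < \<delta>}"
    using light by (intro measure_pmf.finite_measure_mono) (auto simp: not_le, metis not_le of_nat_le_iff of_nat_mult of_nat_numeral)
  also have "\<dots> \<le> (1 - p) ^ Suc t" unfolding p_def by (rule prob_best_less)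
  \<comment> \<open>Bernoulli gives \<open>Suc t * p \<le> (1 + p) ^ Suc t\<close>, and
    \<open>(1 - p) * (1 + p)\<close> is at most 1. A bound of order \<open>1 / R\<close> is enough
    for the failure budget of a phase.\<close>
  also have "\<dots> \<le> 1 / (real (Suc t) * p)"
  proof -
    have "(1 - p) ^ Suc t * (real (Suc t) * p) \<le> (1 - p) ^ Suc t * (1 + p) ^ Suc t"
      using Bernoulli_inequality[of p "Suc t"] p pos by (intro mult_left_mono) auto
    also have "\<dots> = (1 - p\<^sup>2) ^ Suc t" by (simp add: power2_eq_square algebra_simps flip: power_mult_distrib)
    also have "\<dots> \<le> 1" using p pos by (intro power_le_one) (auto simp: power_le_one)
    finally show ?thesis using p pos by (simp add: le_divide_eq mult_pos_pos)
  qed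
  also have "\<dots> \<le> 1 / (real (Suc t) * (sqrt (2 * m) / (16 * n)))"
    using p pos by (intro divide_left_mono mult_left_mono mult_pos_pos) auto
  finally show ?thesis by simp
qed

end

section \<open>The estimator\<close>

text \<open>The default 0, here and in \<open>count_of\<close>, is for answers of the wrong kind,
  which \<open>response\<close> never gives to the queries concerned.\<close>

fun vertex_of :: "answer \<Rightarrow> nat" where
  "vertex_of (Vertex x) = x" | "vertex_of _ = 0"

fun count_of :: "answer \<Rightarrow> nat" where
  "count_of (Count c) = c" | "count_of _ = 0"

definition vert_prog :: "nat prog" where
  "vert_prog = Query RandVert (\<lambda>a. Ret (vertex_of a))"

definition nbr_prog :: "nat \<Rightarrow> nat prog" where
  "nbr_prog x = Query (RandNbr x) (\<lambda>a. Ret (vertex_of a))"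

definition degree_prog :: "nat \<Rightarrow> nat prog" where
  "degree_prog x = Query (Degree x) (\<lambda>a. Ret (count_of a))"

definition additive_prog :: "nat set \<Rightarrow> nat prog" where
  "additive_prog S = Query (Additive S) (\<lambda>a. Ret (count_of a))"

primrec total :: "nat \<Rightarrow> real prog \<Rightarrow> real prog" where
  "total 0 p = Ret 0"
| "total (Suc R) p = bind_prog p (\<lambda>a. bind_prog (total R p) (\<lambda>s. Ret (a + s)))"

primrec best_prog :: "nat \<Rightarrow> nat prog" where
  "best_prog 0 = bind_prog vert_prog nbr_prog"
| "best_prog (Suc t) = bind_prog vert_prog (\<lambda>x. bind_prog (nbr_prog x) (\<lambda>y. bind_prog (best_prog t) (\<lambda>y'.
     bind_prog (degree_prog y) (\<lambda>d. bind_prog (degree_prog y') (\<lambda>d'. Ret (if d' \<le> d then y else y'))))))"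

definition hit_prog :: "nat \<Rightarrow> real prog" where
  "hit_prog y = bind_prog vert_prog (\<lambda>z. bind_prog (additive_prog {z, y}) (\<lambda>c. Ret (real c)))"

definition light_deg_prog :: "nat \<Rightarrow> real prog" where
  "light_deg_prog D = bind_prog vert_prog (\<lambda>x. bind_prog (nbr_prog x) (\<lambda>y.
     bind_prog (degree_prog x) (\<lambda>d. bind_prog (degree_prog y) (\<lambda>d'.
       Ret (if d \<le> D \<and> d' \<le> D then real d else 0)))))"

primrec draw_prog :: "nat \<Rightarrow> nat set prog" where
  "draw_prog 0 = Ret {}"
| "draw_prog (Suc k) = bind_prog vert_prog (\<lambda>x. bind_prog (draw_prog k) (\<lambda>S. Ret (insert x S)))"

definition pairs_prog :: "nat \<Rightarrow> real prog" where
  "pairs_prog k = bind_prog (draw_prog k) (\<lambda>S. Ret (real (card S choose 2)))"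

primrec draw_light_prog :: "nat \<Rightarrow> nat \<Rightarrow> nat set prog" where
  "draw_light_prog D 0 = Ret {}"
| "draw_light_prog D (Suc k) = bind_prog vert_prog (\<lambda>x. bind_prog (degree_prog x) (\<lambda>d.
     bind_prog (draw_light_prog D k) (\<lambda>S. Ret (if d \<le> D then insert x S else S))))"

definition light_edges_prog :: "nat \<Rightarrow> nat \<Rightarrow> real prog" where
  "light_edges_prog D k = bind_prog (draw_light_prog D k) (\<lambda>S. bind_prog (additive_prog S) (\<lambda>c. Ret (real c)))"

text \<open>
  \<open>y\<close> is a vertex of large degree \<open>D\<close>. If \<open>D\<close> is large enough, then the frequency \<open>D / n\<close> of its
  neighbours is seen directly. Otherwise the edges between vertices of degree at most \<open>D\<close> are dense
  enough, and \<open>A / C\<close> and \<open>B / (R * k)\<close> estimate their number relative to \<open>n choose 2\<close> and to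
  \<open>n / 2\<close>, respectively; \<open>C\<close> accounts for repeated vertices.
\<close>

definition phase :: "nat \<Rightarrow> nat \<Rightarrow> real option prog" where
  "phase R k = bind_prog (best_prog (R * k)) (\<lambda>y. bind_prog (degree_prog y) (\<lambda>D.
     bind_prog (total (R * k) (hit_prog y)) (\<lambda>K.
       if 2 * real R \<le> K then Ret (Some (real D * real (R * k) / K))
       else bind_prog (total R (light_edges_prog D k)) (\<lambda>A.
         if A < real R / 256 then Ret None
         else bind_prog (total R (pairs_prog k)) (\<lambda>C.
           bind_prog (total (R * k) (light_deg_prog D)) (\<lambda>B.
             Ret (Some (1 + B * C / (real (R * k) * A)))))))))"

section \<open>Distributions, legality and costs of the programs\<close>

context input
begin

lemma sem_vert [simp]: "sem G vert_prog = unif"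
  and sem_nbr [simp]: "sem G (nbr_prog x) = pmf_of_set (nbrs G x)"
  and sem_degree [simp]: "sem G (degree_prog x) = return_pmf (deg G x)"
  and sem_additive [simp]: "sem G (additive_prog S) = return_pmf (card {e \<in> edges G. e \<subseteq> S})"
  by (simp_all add: vert_prog_def nbr_prog_def degree_prog_def additive_prog_def bind_map_pmf bind_return_pmf bind_return_pmf')

lemma sem_total [simp]: "sem G (total R p) = sum_iid R (sem G p)"
  by (induction R) simp_all

lemma sem_best [simp]: "sem G (best_prog t) = best t"
  by (induction t) (simp_all add: rand_nbr_def bind_assoc_pmf bind_return_pmf)

lemma sem_hit [simp]: "sem G (hit_prog y) = hit y"
  by (simp add: hit_prog_def hit_def bind_return_pmf)

lemma sem_light_deg [simp]: "sem G (light_deg_prog D) = light_deg D"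
  by (simp add: light_deg_prog_def light_deg_def bind_return_pmf)

lemma sem_draw [simp]: "sem G (draw_prog k) = draw k"
  by (induction k) simp_all

lemma sem_pairs [simp]: "sem G (pairs_prog k) = map_pmf (\<lambda>S. real (card S choose 2)) (draw k)"
  by (simp add: pairs_prog_def map_pmf_def)

lemma sem_draw_light: "sem G (draw_light_prog D k) = map_pmf (\<lambda>S. {x \<in> S. deg G x \<le> D}) (draw k)"
proof (induction k)
  case (Suc k)
  have "(if deg G x \<le> D then insert x {x \<in> S. deg G x \<le> D} else {x \<in> S. deg G x \<le> D}) = {y \<in> insert x S. deg G y \<le> D}" for x S
    by auto
  then show ?case using Suc by (simp add: bind_return_pmf map_bind_pmf bind_map_pmf)
qed simp

text \<open>An edge is light iff both its ends survive the filter on degrees, so the count can be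
  analysed on the unfiltered draw.\<close>

lemma sem_light_edges [simp]:
  "sem G (light_edges_prog D k) = map_pmf (\<lambda>S. real (card {e \<in> light D. e \<subseteq> S})) (draw k)"
proof -
  have "{e \<in> edges G. e \<subseteq> {x \<in> S. deg G x \<le> D}} = {e \<in> light D. e \<subseteq> S}" for S
    by (auto simp: light_def)
  then show ?thesis by (simp add: light_edges_prog_def sem_draw_light map_pmf_def bind_assoc_pmf bind_return_pmf)
qed

lemma safe_vert: "safe G vert_prog V 1 (\<lambda>V' x. V' = insert x V \<and> x \<in> verts G)"
  using fin V by (auto simp: vert_prog_def advanced_model_def)

lemma safe_nbr: "x \<in> V \<Longrightarrow> x \<in> verts G \<Longrightarrow> safe G (nbr_prog x) V 1 (\<lambda>V' y. V' = insert y V \<and> y \<in> verts G)"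
  using nbrs_nonempty finite_nbrs nbrs_sub by (fastforce simp: nbr_prog_def advanced_model_def)

lemma safe_degree: "x \<in> V \<Longrightarrow> safe G (degree_prog x) V 1 (\<lambda>V' d. V' = V \<and> d = deg G x)"
  by (simp add: degree_prog_def advanced_model_def)

lemma safe_additive: "S \<subseteq> V \<Longrightarrow> safe G (additive_prog S) V (card S) (\<lambda>V' d. V' = V)"
  by (simp add: additive_prog_def advanced_model_def)

lemma safe_total:
  assumes "\<And>V'. V \<subseteq> V' \<Longrightarrow> safe G p V' w (\<lambda>V'' _. V' \<subseteq> V'')"
  shows "safe G (total R p) V (R * w) (\<lambda>V' _. V \<subseteq> V')"
  using assms
proof (induction R arbitrary: V)
  case (Suc R)
  have "safe G (bind_prog (total R p) (\<lambda>s. Ret (a + s))) V' (R * w + 0) (\<lambda>V'' _. V \<subseteq> V'')" if "V \<subseteq> V'" for a V'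
    using that Suc.prems by (intro safe_bind[OF Suc.IH[of V']]) auto
  then have "safe G (total (Suc R) p) V (w + (R * w + 0)) (\<lambda>V' _. V \<subseteq> V')"
    unfolding total.simps using Suc.prems by (intro safe_bind[of G p V w "\<lambda>V' _. V \<subseteq> V'"]) auto
  then show ?case by simp
qed simp

lemma safe_best: "safe G (best_prog t) V (4 * t + 2) (\<lambda>V' y. V \<subseteq> V' \<and> y \<in> V' \<and> y \<in> verts G)"
proof (induction t arbitrary: V)
  case 0
  have "safe G (best_prog 0) V (1 + 1) (\<lambda>V' y. V \<subseteq> V' \<and> y \<in> V' \<and> y \<in> verts G)"
    unfolding best_prog.simps
    by (rule safe_bind[OF safe_vert], rule safe_mono[OF safe_nbr]) auto
  then show ?case by simp
next
  case (Suc t)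
  let ?\<Phi> = "\<lambda>V' y. V \<subseteq> V' \<and> y \<in> V' \<and> y \<in> verts G"
  have d: "safe G (bind_prog (degree_prog y) (\<lambda>d. bind_prog (degree_prog y') (\<lambda>d'. Ret (if d' \<le> d then y else y')))) V' (1 + (1 + 0)) ?\<Phi>"
    if "V \<subseteq> V'" "y \<in> V'" "y \<in> verts G" "y' \<in> V'" "y' \<in> verts G" for V' y y'
    using that by (intro safe_bind[OF safe_degree] safe_bind[OF safe_degree[of y']]) auto
  have "safe G (best_prog (Suc t)) V (1 + (1 + ((4 * t + 2) + (1 + (1 + 0))))) ?\<Phi>"
    unfolding best_prog.simps
  proof (rule safe_bind[OF safe_vert], rule safe_bind[OF safe_nbr], goal_cases)
    case (3 V1 x V2 y)
    show ?case using 3 by (intro safe_bind[OF Suc.IH[of V2]] d) auto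
  qed auto
  then show ?case by (rule safe_mono) auto
qed

lemma safe_hit: "y \<in> V \<Longrightarrow> safe G (hit_prog y) V 3 (\<lambda>V' _. V \<subseteq> V')"
proof -
  assume y: "y \<in> V"
  have "safe G (hit_prog y) V (1 + (2 + 0)) (\<lambda>V' _. V \<subseteq> V')"
    unfolding hit_prog_def
  proof (rule safe_bind[OF safe_vert], goal_cases)
    case (1 V' z)
    have "safe G (additive_prog {z, y}) V' 2 (\<lambda>V'' _. V'' = V')"
      using 1 y by (intro safe_mono[OF safe_additive]) (auto simp: card_insert_if)
    then show ?case using 1 by (intro safe_bind[of G _ V' 2 "\<lambda>V'' _. V'' = V'"]) auto
  qed
  then show ?thesis by (rule safe_mono) auto
qed

lemma safe_light_deg: "safe G (light_deg_prog D) V 4 (\<lambda>V' _. V \<subseteq> V')"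
proof -
  have d: "safe G (bind_prog (degree_prog x) (\<lambda>d. bind_prog (degree_prog y) (\<lambda>d'. Ret (if d \<le> D \<and> d' \<le> D then real d else 0)))) V' (1 + (1 + 0)) (\<lambda>V' _. V \<subseteq> V')"
    if "V \<subseteq> V'" "x \<in> V'" "y \<in> V'" for V' x y
    using that by (intro safe_bind[OF safe_degree] safe_bind[OF safe_degree[of y]]) auto
  have "safe G (light_deg_prog D) V (1 + (1 + (1 + (1 + 0)))) (\<lambda>V' _. V \<subseteq> V')"
    unfolding light_deg_prog_def
    by (rule safe_bind[OF safe_vert], rule safe_bind[OF safe_nbr]) (auto intro!: d[simplified])
  then show ?thesis by (simp add: numeral_eq_Suc)
qed

lemma safe_draw: "safe G (draw_prog k) V k (\<lambda>V' _. V \<subseteq> V')"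
proof (induction k arbitrary: V)
  case (Suc k)
  have "safe G (draw_prog (Suc k)) V (1 + (k + 0)) (\<lambda>V' _. V \<subseteq> V')"
    unfolding draw_prog.simps by (rule safe_bind[OF safe_vert], rule safe_bind[OF Suc]) auto
  then show ?case by simp
qed simp

lemma safe_pairs: "safe G (pairs_prog k) V k (\<lambda>V' _. V \<subseteq> V')"
  using safe_bind[OF safe_draw[of k V], of "\<lambda>S. Ret (real (card S choose 2))" 0 "\<lambda>V' _. V \<subseteq> V'"]
  by (simp add: pairs_prog_def)

lemma safe_draw_light: "safe G (draw_light_prog D k) V (2 * k) (\<lambda>V' S. V \<subseteq> V' \<and> S \<subseteq> V' \<and> finite S \<and> card S \<le> k)"
proof (induction k arbitrary: V)
  case (Suc k)
  have "safe G (draw_light_prog D (Suc k)) V (1 + (1 + (2 * k + 0))) (\<lambda>V' S. V \<subseteq> V' \<and> S \<subseteq> V' \<and> finite S \<and> card S \<le> Suc k)"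
    unfolding draw_light_prog.simps
    by (rule safe_bind[OF safe_vert], rule safe_bind[OF safe_degree], simp, rule safe_bind[OF Suc])
      (auto simp: card_insert_if)
  then show ?case by simp
qed simp

lemma safe_light_edges: "safe G (light_edges_prog D k) V (3 * k) (\<lambda>V' _. V \<subseteq> V')"
proof -
  have "safe G (light_edges_prog D k) V (2 * k + (k + 0)) (\<lambda>V' _. V \<subseteq> V')"
    unfolding light_edges_prog_def
  proof (rule safe_bind[OF safe_draw_light], goal_cases)
    case (1 V' S)
    then have "safe G (additive_prog S) V' k (\<lambda>V'' _. V'' = V')"
      by (intro safe_mono[OF safe_additive]) auto
    then show ?case using 1 by (intro safe_bind[of G _ V' k "\<lambda>V'' _. V'' = V'"]) auto
  qed
  then show ?thesis by simp
qed

lemma safe_phase: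
  assumes "R > 0" "k > 0"
  shows "safe G (phase R k) V (20 * (R * k)) (\<lambda>V' _. V \<subseteq> V')"
proof -
  let ?\<Phi> = "\<lambda>V' _. V \<subseteq> V'"
  have B: "safe G (bind_prog (total (R * k) (light_deg_prog D)) (\<lambda>B. Ret (g B))) V' (R * k * 4 + 0) ?\<Phi>"
    if "V \<subseteq> V'" for V' D and g :: "real \<Rightarrow> real option"
    using that by (intro safe_bind[OF safe_total[OF safe_light_deg]]) auto
  have C: "safe G (bind_prog (total R (pairs_prog k)) (\<lambda>C. bind_prog (total (R * k) (light_deg_prog D)) (\<lambda>B. Ret (g B C)))) V'
     (R * k + (R * k * 4 + 0)) ?\<Phi>"
    if "V \<subseteq> V'" for V' D and g :: "real \<Rightarrow> real \<Rightarrow> real option"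
    using that by (intro safe_bind[OF safe_total[OF safe_pairs]] B) auto
  have A: "safe G (bind_prog (total R (light_edges_prog D k)) (\<lambda>A. if A < real R / 256 then Ret None
         else bind_prog (total R (pairs_prog k)) (\<lambda>C. bind_prog (total (R * k) (light_deg_prog D)) (\<lambda>B. Ret (g A B C))))) V'
     (R * (3 * k) + (R * k + (R * k * 4 + 0))) ?\<Phi>"
    if "V \<subseteq> V'" for V' D and g :: "real \<Rightarrow> real \<Rightarrow> real \<Rightarrow> real option"
  proof (rule safe_bind[OF safe_total[OF safe_light_edges]], goal_cases)
    case (1 V'' A)
    then show ?case using C[of V'' D "g A"] that by auto
  qed
  have s: "safe G (phase R k) V ((4 * (R * k) + 2) + (1 + (R * k * 3 + (R * (3 * k) + (R * k + (R * k * 4 + 0)))))) ?\<Phi>"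
    unfolding phase_def
  proof (rule safe_bind[OF safe_best], goal_cases)
    case (1 V1 y)
    show ?case
    proof (rule safe_bind[OF safe_degree], goal_cases)
      case (2 V2 D)
      show ?case
      proof (rule safe_bind[OF safe_total[OF safe_hit]], goal_cases)
        case (2 V3 K)
        then show ?case using A[of V3 D "\<lambda>A B C. Some (1 + B * C / (real (R * k) * A))"] 1 \<open>V2 = V1 \<and> D = deg G y\<close> by auto
      qed (use 1 2 in auto)
    qed (use 1 in auto)
  qed
  have "R * k \<ge> 1" using assms by (simp add: Suc_leI)
  moreover have "R * (3 * k) = 3 * (R * k)" by simp
  \<comment> \<open>The sum is \<open>15 * (R * k) + 3\<close>, and \<open>R * k \<ge> 1\<close>
    absorbs the constant.\<close>
  ultimately have "(4 * (R * k) + 2) + (1 + (R * k * 3 + (R * (3 * k) + (R * k + (R * k * 4 + 0))))) \<le> 20 * (R * k)"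
    by linarith
  then show ?thesis by (rule safe_mono[OF s])
qed

end

text \<open>A value of at least \<open>2 * a\<close> cannot come from a mean below \<open>a\<close>;
  hence the slack \<open>a\<close> is at most the mean, and the error becomes relative.\<close>

lemma relative_estimate:
  fixes x v :: real
  assumes "\<bar>v - x\<bar> < \<eta> * (x + a)" "2 * a \<le> v" "0 < \<eta>" "\<eta> \<le> 1 / 16" "0 < a"
  shows "a \<le> x" "\<bar>v - x\<bar> \<le> 2 * \<eta> * x"
proof -
  show "a \<le> x"
  proof (rule ccontr)
    assume "\<not> a \<le> x"
    then have "\<eta> * (x + a) \<le> \<eta> * (2 * a)" using assms by (intro mult_left_mono) auto
    also have "\<dots> \<le> 1 / 16 * (2 * a)" using assms by (intro mult_right_mono) auto
    finally have "v - x < a / 8" using assms(1) by (simp add: abs_less_iff)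
    then show False using assms \<open>\<not> a \<le> x\<close> by linarith
  qed
  then have "\<eta> * (x + a) \<le> \<eta> * (2 * x)" using assms by (intro mult_left_mono) auto
  then show "\<bar>v - x\<bar> \<le> 2 * \<eta> * x" using assms by linarith
qed

text \<open>The other outcome of the same test: the mean is at most a constant factor above the
  threshold, which is information as well.\<close>

lemma below_threshold:
  fixes x v :: real
  assumes "\<bar>v - x\<bar> < \<eta> * (x + a)" "v < 2 * a" "0 < \<eta>" "\<eta> \<le> 1 / 16" "0 < a" "0 \<le> x"
  shows "x < 4 * a"
proof -
  have "\<eta> * (x + a) \<le> 1 / 16 * (x + a)" using assms by (intro mult_right_mono) auto
  then have "x - v < (x + a) / 16" using assms(1) by (simp add: abs_less_iff)
  then show ?thesis using assms(2,5) by argo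
qed

lemma inverse_estimate:
  fixes x v c :: real
  assumes v: "\<bar>v - x\<bar> \<le> h * x" and h: "0 \<le> h" "h \<le> 1 / 8" and x: "x > 0" and c: "c \<ge> 0"
  shows "(1 - 8 * h) * c \<le> c * x / v" "c * x / v \<le> (1 + 8 * h) * c"
proof -
  have vb: "(1 - h) * x \<le> v" "v \<le> (1 + h) * x" using v by (auto simp: left_diff_distrib distrib_right abs_le_iff)
  have v0: "v > 0"
  proof -
    have "0 < (1 - h) * x" using h x by (intro mult_pos_pos) auto
    then show ?thesis using vb by linarith
  qed
  have hh: "h * h \<le> 1 / 8 * h" using h by (intro mult_right_mono) auto
  have "(1 - 8 * h) * (1 + h) \<le> 1" using hh h by (simp add: algebra_simps)
  have lo: "(1 - 8 * h) * v \<le> x"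
  proof -
    have "(1 - 8 * h) * v \<le> (1 - 8 * h) * ((1 + h) * x)" using h vb by (intro mult_left_mono) auto
    also have "\<dots> = ((1 - 8 * h) * (1 + h)) * x" by simp
    also have "\<dots> \<le> 1 * x" using \<open>(1 - 8 * h) * (1 + h) \<le> 1\<close> x by (intro mult_right_mono) auto
    finally show ?thesis by simp
  qed
  have "(1 + 8 * h) * (1 - h) \<ge> 1" using hh h by (simp add: algebra_simps)
  have hi: "x \<le> (1 + 8 * h) * v"
  proof -
    have "1 * x \<le> ((1 + 8 * h) * (1 - h)) * x" using \<open>(1 + 8 * h) * (1 - h) \<ge> 1\<close> x by (intro mult_right_mono) auto
    also have "\<dots> = (1 + 8 * h) * ((1 - h) * x)" by simp
    also have "\<dots> \<le> (1 + 8 * h) * v" using h vb by (intro mult_left_mono) auto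
    finally show ?thesis by simp
  qed
  show "(1 - 8 * h) * c \<le> c * x / v" using mult_left_mono[OF lo c] v0 by (simp add: le_divide_eq mult_ac)
  show "c * x / v \<le> (1 + 8 * h) * c" using mult_left_mono[OF hi c] v0 by (simp add: divide_le_eq mult_ac)
qed

text \<open>The factor 8 is generous for three relative errors. It is the one in
  \<open>inverse_estimate\<close>, so \<open>h = \<epsilon> / 8\<close> serves both kinds of
  output.\<close>

lemma product_estimate:
  fixes a b c x y z :: real
  assumes "\<bar>a - x\<bar> \<le> h * x" "\<bar>b - y\<bar> \<le> h * y" "\<bar>c - z\<bar> \<le> h * z"
    and h: "0 \<le> h" "h \<le> 1 / 8" and pos: "x > 0" "y > 0" "z > 0"
  shows "(1 - 8 * h) * (y * z / x) \<le> b * c / a" "b * c / a \<le> (1 + 8 * h) * (y * z / x)"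
proof -
  have ab: "(1 - h) * x \<le> a" "a \<le> (1 + h) * x" "(1 - h) * y \<le> b" "b \<le> (1 + h) * y" "(1 - h) * z \<le> c" "c \<le> (1 + h) * z"
    using assms(1-3) by (auto simp: left_diff_distrib distrib_right abs_le_iff)
  have p: "(1 - h) * x > 0" "(1 - h) * y > 0" "(1 - h) * z > 0" using h pos by auto
  then have pa: "a > 0" "b > 0" "c > 0" using ab by linarith+
  have hh: "0 \<le> h * h" by simp
  have hh': "h * h \<le> 1 / 8 * h" using h by (intro mult_right_mono) auto
  have n1: "(1 - 8 * h) * (1 + h) \<le> (1 - h) * (1 - h)" using hh hh' h by (simp add: algebra_simps)
  have n2: "(1 + h) * (1 + h) \<le> (1 + 8 * h) * (1 - h)" using hh hh' h by (simp add: algebra_simps)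
  have "(1 - 8 * h) * (y * z) * a \<le> b * c * x"
  proof -
    have "(1 - 8 * h) * (y * z) * a \<le> (1 - 8 * h) * (y * z) * ((1 + h) * x)"
      using h ab pos by (intro mult_left_mono) auto
    also have "\<dots> = ((1 - 8 * h) * (1 + h)) * (x * y * z)" by (simp add: mult_ac)
    also have "\<dots> \<le> ((1 - h) * (1 - h)) * (x * y * z)" using n1 pos by (intro mult_right_mono) auto
    also have "\<dots> = ((1 - h) * y) * ((1 - h) * z) * x" by (simp add: mult_ac)
    also have "\<dots> \<le> b * c * x" using ab p pa pos by (intro mult_right_mono mult_mono) auto
    finally show ?thesis .
  qed
  then show "(1 - 8 * h) * (y * z / x) \<le> b * c / a" using pa pos by (simp add: divide_le_eq le_divide_eq mult_ac)
  have "b * c * x \<le> (1 + 8 * h) * (y * z) * a"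
  proof -
    have "b * c * x \<le> ((1 + h) * y) * ((1 + h) * z) * x" using ab pa pos h by (intro mult_right_mono mult_mono) auto
    also have "\<dots> = ((1 + h) * (1 + h)) * (x * y * z)" by (simp add: mult_ac)
    also have "\<dots> \<le> ((1 + 8 * h) * (1 - h)) * (x * y * z)" using n2 pos by (intro mult_right_mono) auto
    also have "\<dots> = (1 + 8 * h) * (y * z) * ((1 - h) * x)" by (simp add: mult_ac)
    also have "\<dots> \<le> (1 + 8 * h) * (y * z) * a" using ab h pos by (intro mult_left_mono) auto
    finally show ?thesis .
  qed
  then show "b * c / a \<le> (1 + 8 * h) * (y * z / x)" using pa pos by (simp add: divide_le_eq le_divide_eq mult_ac)
qed

section \<open>Correctness of a single phase\<close>

context input
begin

text \<open>\<open>must\<close> marks a phase in which abstaining counts as failure; a wrong value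
  is a failure in any case.\<close>

definition good :: "real \<Rightarrow> bool \<Rightarrow> real option \<Rightarrow> bool" where
  "good \<epsilon> must r \<longleftrightarrow> (case r of None \<Rightarrow> \<not> must | Some v \<Rightarrow> eps_approx \<epsilon> v n)"

lemma cover_bounds:
  assumes "2 \<le> k" "k \<le> n"
  shows "(real k / n)\<^sup>2 / 8 \<le> cover n k 2" "cover n k 2 \<le> (real k / n)\<^sup>2"
proof -
  have "real k * real k \<le> real k * (2 * (real k - 1))" using assms by (intro mult_left_mono) auto
  then have "(real k / n)\<^sup>2 / 8 \<le> k * (real k - 1) / (4 * (real n)\<^sup>2)"
    using n_pos by (simp add: power2_eq_square field_simps)
  also have "\<dots> \<le> cover n k 2" using assms by (intro cover_2_ge) auto
  finally show "(real k / n)\<^sup>2 / 8 \<le> cover n k 2" .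
  show "cover n k 2 \<le> (real k / n)\<^sup>2" using cover_le[of 2 n k] bounds by simp
qed

text \<open>With \<open>F\<close> light edges the terms summed in \<open>A\<close>, \<open>C\<close>
  and \<open>B\<close> have means \<open>F * g\<close>, \<open>n * (n - 1) / 2 * g\<close> and
  \<open>2 * F / n\<close>. In \<open>B * C / A\<close> both \<open>F\<close> and \<open>g\<close>
  cancel and \<open>R * k * (n - 1)\<close> is left. Each of the three sums fails with probability
  at most \<open>\<delta>\<close>.\<close>

lemma phase_light:
  assumes \<epsilon>: "0 < \<epsilon>" "\<epsilon> < 1" and k: "2 \<le> k" "k \<le> n" "m * (real k / n)\<^sup>2 \<le> 2"
    and R: "R * \<epsilon>\<^sup>2 * \<delta> \<ge> 11534336" and \<delta>: "0 < \<delta>"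
    and must: "must \<Longrightarrow> 8 * m * (real k / n)\<^sup>2 \<ge> 1" "must \<Longrightarrow> real m \<le> 2 * card (light D)"
    and D: "D * (real k / n) < 4"
  shows "measure_pmf.prob (sem G (bind_prog (total R (light_edges_prog D k)) (\<lambda>A.
         if A < real R / 256 then Ret None
         else bind_prog (total R (pairs_prog k)) (\<lambda>C.
           bind_prog (total (R * k) (light_deg_prog D)) (\<lambda>B.
             Ret (Some (1 + B * C / (real (R * k) * A)))))))) {r. \<not> good \<epsilon> must r} \<le> 3 * \<delta>"
proof -
  \<comment> \<open>Passing a test doubles the error to \<open>\<epsilon> / 8\<close>, and forming
    the quotient costs the factor 8.\<close>
  define \<eta> where "\<eta> = \<epsilon> / 16"
  define F where "F = real (card (light D))"
  define q where "q = real k / n"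
  define g where "g = cover n k 2"
  have \<eta>: "0 < \<eta>" "\<eta> \<le> 1 / 16" using \<epsilon> by (auto simp: \<eta>_def)
  \<comment> \<open>\<open>11534336 = 256 * 45056\<close> and \<open>45056 = 88 * 512\<close>: the
    demand of \<open>A\<close>, with \<open>W = 88\<close> and slack \<open>R / 512\<close>. The
    other two sums demand less.\<close>
  have R\<eta>: "R * \<eta>\<^sup>2 * \<delta> \<ge> 45056" using R by (simp add: \<eta>_def power_divide)
  have R0: "real R > 0" using R by (cases "R = 0") auto
  have q: "q > 0" using k n_pos by (simp add: q_def)
  have g: "q\<^sup>2 / 8 \<le> g" "g \<le> q\<^sup>2" using cover_bounds[OF k(1,2)] by (simp_all add: q_def g_def)
  have g0: "g > 0" using g(1) q by (smt (verit) zero_less_power zero_less_divide_iff)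
  have F: "0 \<le> F" "F \<le> m" using card_light_le by (auto simp: F_def)
  have bad: "W / (\<eta>\<^sup>2 * a) \<le> \<delta>" if "W * R \<le> 45056 * a" "a > 0" for W a :: real
  proof -
    have "W * R \<le> (R * \<eta>\<^sup>2 * \<delta>) * a" using R\<eta> that by (meson less_imp_le mult_right_mono order_trans)
    then have "W * R \<le> (\<delta> * (\<eta>\<^sup>2 * a)) * R" by (simp add: mult_ac)
    then have "W \<le> \<delta> * (\<eta>\<^sup>2 * a)" using R0 by (simp only: mult_le_cancel_right_pos)
    then show ?thesis using \<eta> that by (simp add: divide_le_eq)
  qed
  define pA where "pA = map_pmf (\<lambda>S. real (card {e \<in> light D. e \<subseteq> S})) (draw k)"
  define pC where "pC = map_pmf (\<lambda>S. real (card S choose 2)) (draw k)"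
  have finA: "finite (set_pmf pA)" and finC: "finite (set_pmf pC)"
    using finite_draw by (auto simp: pA_def pC_def)
  have EA: "measure_pmf.expectation pA (\<lambda>x. x) = F * g"
    using expectation_pairs[OF light_pairs] by (simp add: pA_def F_def g_def)
  have EA2: "measure_pmf.expectation pA (\<lambda>x. x\<^sup>2) \<le> 88 * (F * g)"
  proof -
    have "measure_pmf.expectation pA (\<lambda>x. x\<^sup>2) \<le> F * q\<^sup>2 * (1 + 2 * D * q + F * q\<^sup>2)"
      using second_moment_pairs[OF light_pairs light_degree] by (simp add: pA_def F_def q_def)
    \<comment> \<open>\<open>11 = 1 + 2 * 4 + 2\<close>, from the bounds on \<open>D * q\<close> and
      \<open>m * q\<^sup>2\<close>. Then \<open>q\<^sup>2 \<le> 8 * g\<close> makes it 88.\<close>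
    also have "\<dots> \<le> F * q\<^sup>2 * 11"
    proof -
      have "F * q\<^sup>2 \<le> m * q\<^sup>2" using F by (intro mult_right_mono) auto
      then show ?thesis using D k(3) F by (intro mult_left_mono) (auto simp: q_def)
    qed
    also have "\<dots> \<le> F * (8 * g) * 11" using g F by (intro mult_right_mono mult_left_mono) auto
    finally show ?thesis by simp
  qed
  have nA: "measure_pmf.prob (sum_iid R pA) {s. \<not> \<bar>s - R * (F * g)\<bar> < \<eta> * (R * (F * g) + R / 512)} \<le> \<delta>"
  proof -
    have "measure_pmf.prob (sum_iid R pA) {s. \<not> \<bar>s - R * (F * g)\<bar> < \<eta> * (R * (F * g) + R / 512)} \<le> 88 / (\<eta>\<^sup>2 * (R / 512))"
      unfolding EA[symmetric] by (rule sum_iid_concentration[OF finA]) (use EA EA2 F g0 \<eta> R0 in auto)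
    also have "\<dots> \<le> \<delta>" using R0 by (intro bad) auto
    finally show ?thesis .
  qed
  have EC: "measure_pmf.expectation pC (\<lambda>x. x) = real n * (real n - 1) / 2 * g"
    using expectation_choose(1) by (simp add: pC_def g_def)
  define \<mu>C where "\<mu>C = real n * (real n - 1) / 2 * g"
  have n2: "real n \<ge> 2" using bounds by simp
  have \<mu>C: "\<mu>C \<ge> (real k)\<^sup>2 / 32"
  proof -
    have "real n * real n \<le> real n * (2 * (real n - 1))" using n2 by (intro mult_left_mono) auto
    then have "(real n)\<^sup>2 / 4 * (q\<^sup>2 / 8) \<le> real n * (real n - 1) / 2 * g"
      using g(1) n2 by (intro mult_mono) (auto simp: power2_eq_square)
    then show ?thesis using n_pos by (simp add: q_def \<mu>C_def power_divide)
  qed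
  have k0: "real k > 0" using k by simp
  have \<mu>C0: "\<mu>C > 0" using \<mu>C k0 by (smt (verit) zero_less_power zero_less_divide_iff)
  \<comment> \<open>With the mean itself as slack the error is relative at once.\<close>
  have nC: "measure_pmf.prob (sum_iid R pC) {s. \<not> \<bar>s - R * \<mu>C\<bar> < \<eta> * (R * \<mu>C + R * \<mu>C)} \<le> \<delta>"
  proof -
    have "measure_pmf.prob (sum_iid R pC) {s. \<not> \<bar>s - R * \<mu>C\<bar> < \<eta> * (R * \<mu>C + R * \<mu>C)} \<le> ((real k)\<^sup>2 / 2) / (\<eta>\<^sup>2 * (R * \<mu>C))"
      unfolding \<mu>C_def EC[symmetric]
      using expectation_choose(2)[of k] EC \<mu>C0 \<eta> R0
      by (intro sum_iid_concentration[OF finC]) (auto simp: pC_def \<mu>C_def)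
    also have "\<dots> \<le> \<delta>"
    proof (rule bad)
      have "(real k)\<^sup>2 / 2 * R \<le> (16 * \<mu>C) * R" using \<mu>C by (intro mult_right_mono) auto
      also have "\<dots> = 16 * (R * \<mu>C)" by simp
      also have "\<dots> \<le> 45056 * (R * \<mu>C)" using \<mu>C0 R0 by (intro mult_right_mono) auto
      finally show "(real k)\<^sup>2 / 2 * R \<le> 45056 * (R * \<mu>C)" .
    qed (use \<mu>C0 R0 in simp)
    finally show ?thesis .
  qed
  define \<beta> where "\<beta> = 2 * F / n"
  have EB: "measure_pmf.expectation (light_deg D) (\<lambda>x. x) = \<beta>"
    using expectation_light_deg(1) by (simp add: \<beta>_def F_def)
  \<comment> \<open>The second moment is bounded through \<open>D\<close>. A passed test on
    \<open>A\<close> gives \<open>F * g \<ge> 1 / 512\<close>, and since \<open>D * q < 4\<close>,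
    this bounds \<open>D\<close> by a constant times \<open>k * \<beta>\<close>.\<close>
  have nB: "measure_pmf.prob (sum_iid (R * k) (light_deg D)) {s. \<not> \<bar>s - real (R * k) * \<beta>\<bar> < \<eta> * (real (R * k) * \<beta> + real (R * k) * \<beta>)} \<le> \<delta>"
    if Fg: "F * g \<ge> 1 / 512"
  proof -
    have F0: "F > 0" using Fg F by (cases "F = 0") auto
    then have \<beta>0: "\<beta> > 0" using n_pos by (simp add: \<beta>_def)
    have "measure_pmf.prob (sum_iid (R * k) (light_deg D)) {s. \<not> \<bar>s - real (R * k) * \<beta>\<bar> < \<eta> * (real (R * k) * \<beta> + real (R * k) * \<beta>)}
       \<le> D / (\<eta>\<^sup>2 * (real (R * k) * \<beta>))"
      unfolding EB[symmetric]
      using expectation_light_deg(2)[of D] EB \<beta>0 \<eta> R0 k0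
      by (intro sum_iid_concentration[OF finite_light_deg]) auto
    also have "\<dots> \<le> \<delta>"
    proof (rule bad)
      have "F * q\<^sup>2 \<ge> 1 / 512" using Fg g F by (meson mult_left_mono order_trans)
      then have "4 \<le> 2048 * (F * q\<^sup>2)" by simp
      then have "D * q \<le> 2048 * (F * q\<^sup>2)" using D by (simp add: q_def)
      then have "D * q \<le> (2048 * (F * q)) * q" by (simp add: power2_eq_square)
      then have "real D \<le> 2048 * (F * q)" using q by (simp only: mult_le_cancel_right_pos)
      also have "\<dots> \<le> 45056 * (k * \<beta>)" using F k0 n_pos by (simp add: q_def \<beta>_def field_simps)
      finally have "real D * R \<le> 45056 * (k * \<beta>) * R" using R0 by (intro mult_right_mono) auto
      then show "real D * R \<le> 45056 * (real (R * k) * \<beta>)" by (simp add: mult_ac)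
    qed (use \<beta>0 R0 k0 in simp)
    finally show ?thesis .
  qed
  let ?rest = "\<lambda>A. if A < real R / 256 then Ret None
         else bind_prog (total R (pairs_prog k)) (\<lambda>C.
           bind_prog (total (R * k) (light_deg_prog D)) (\<lambda>B.
             Ret (Some (1 + B * C / (real (R * k) * A)))))"
  have rest: "measure_pmf.prob (sem G (?rest A)) {r. \<not> good \<epsilon> must r} \<le> \<delta> + \<delta>"
    if A: "\<bar>A - R * (F * g)\<bar> < \<eta> * (R * (F * g) + R / 512)" for A
  proof (cases "A < real R / 256")
    case True
    \<comment> \<open>Under \<open>must\<close>, \<open>F \<ge> m / 2\<close> and
      \<open>g \<ge> q\<^sup>2 / 8\<close> give
      \<open>F * g \<ge> m * q\<^sup>2 / 16 \<ge> 1 / 128\<close>, whereas the failed test gives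
      \<open>F * g < 4 / 512\<close>. The threshold \<open>R / 256\<close> is chosen for these to
      clash.\<close>
    have "\<not> must"
    proof
      assume l: must
      have "F * g < 4 / 512"
        using below_threshold[OF A] True \<eta> R0 F g0 by simp
      moreover have "F * g \<ge> (m / 2) * (q\<^sup>2 / 8)"
        using must(2)[OF l] g F by (intro mult_mono) (auto simp: F_def)
      ultimately show False using must(1)[OF l] by (simp add: q_def)
    qed
    then have "{r. \<not> good \<epsilon> must r} \<inter> {None} = {}" by (auto simp: good_def)
    then have "measure_pmf.prob (sem G (?rest A)) {r. \<not> good \<epsilon> must r} = 0"
      using True by (simp add: good_def \<open>\<not> must\<close>)
    then show ?thesis using \<delta> by simp
  next
    case False
    have "R / 512 \<le> R * (F * g)" and relA: "\<bar>A - R * (F * g)\<bar> \<le> 2 * \<eta> * (R * (F * g))"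
      using relative_estimate[OF A] False \<eta> R0 by auto
    then have Fg: "1 / 512 \<le> F * g" using R0 by (simp add: divide_le_eq)
    have F0: "F > 0" using Fg F by (cases "F = 0") auto
    have \<beta>0: "\<beta> > 0" using F0 n_pos by (simp add: \<beta>_def)
    have "measure_pmf.prob (bind_pmf (sum_iid R pC) (\<lambda>C. bind_pmf (sum_iid (R * k) (light_deg D)) (\<lambda>B.
        return_pmf (Some (1 + B * C / (real (R * k) * A)))))) {r. \<not> good \<epsilon> must r} \<le> \<delta> + (\<delta> + 0)"
    proof (rule prob_bind_le[OF nC], use \<delta> in simp, rule prob_bind_le[OF nB[OF Fg]], simp, goal_cases)
      case (1 C B)
      have h: "2 * \<eta> = \<epsilon> / 8" by (simp add: \<eta>_def)
      have "\<bar>B - real (R * k) * \<beta>\<bar> \<le> 2 * \<eta> * (real (R * k) * \<beta>)" "\<bar>C - R * \<mu>C\<bar> \<le> 2 * \<eta> * (R * \<mu>C)"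
        using 1 by (auto simp: algebra_simps)
      then have "(1 - 8 * (2 * \<eta>)) * ((real (R * k) * \<beta>) * (R * \<mu>C) / (R * (F * g))) \<le> B * C / A"
        "B * C / A \<le> (1 + 8 * (2 * \<eta>)) * ((real (R * k) * \<beta>) * (R * \<mu>C) / (R * (F * g)))"
        using relA \<eta> R0 k0 \<beta>0 \<mu>C0 F0 g0
        by (intro product_estimate; simp)+
      moreover have "(real (R * k) * \<beta>) * (R * \<mu>C) / (R * (F * g)) = real (R * k) * (real n - 1)"
        using R0 F0 g0 n_pos by (simp add: \<beta>_def \<mu>C_def)
      ultimately have b: "(1 - \<epsilon>) * (real (R * k) * (real n - 1)) \<le> B * C / A" "B * C / A \<le> (1 + \<epsilon>) * (real (R * k) * (real n - 1))"
        by (simp_all add: h)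
      have Rk: "real (R * k) > 0" using R0 k0 by simp
      have eq: "B * C / (real (R * k) * A) = B * C / A / real (R * k)" by simp
      have "(1 - \<epsilon>) * (real n - 1) \<le> B * C / (real (R * k) * A)" "B * C / (real (R * k) * A) \<le> (1 + \<epsilon>) * (real n - 1)"
        unfolding eq using b Rk by (simp_all only: le_divide_eq divide_le_eq if_True mult_ac)
      then have "eps_approx \<epsilon> (1 + B * C / (real (R * k) * A)) n"
        using \<epsilon> by (simp add: eps_approx_def algebra_simps)
      then show ?case by (simp add: good_def)
    qed
    then show ?thesis using False by (simp add: pC_def)
  qed
  have "measure_pmf.prob (bind_pmf (sum_iid R pA) (\<lambda>A. sem G (?rest A))) {r. \<not> good \<epsilon> must r} \<le> \<delta> + (\<delta> + \<delta>)"
    by (rule prob_bind_le[OF nA _ rest]) (use \<delta> in auto)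
  then show ?thesis by (simp add: pA_def)
qed

text \<open>The five failures are those of the search, the hit count and the three sums of
  \<open>phase_light\<close>. The search has to succeed only under \<open>must\<close>: for any
  \<open>y\<close>, a passed hit test gives a good estimate, and a failed one certifies
  \<open>D * (k / n) < 4\<close>.\<close>

lemma phase_correct:
  assumes \<epsilon>: "0 < \<epsilon>" "\<epsilon> < 1" and k: "2 \<le> k" "k \<le> n" "m * (real k / n)\<^sup>2 \<le> 2"
    and R: "R * \<epsilon>\<^sup>2 * \<delta> \<ge> 11534336" and \<delta>: "0 < \<delta>"
    and must: "must \<Longrightarrow> 8 * m * (real k / n)\<^sup>2 \<ge> 1"
  shows "measure_pmf.prob (sem G (phase R k)) {r. \<not> good \<epsilon> must r} \<le> 5 * \<delta>"
proof -
  define \<eta> where "\<eta> = \<epsilon> / 16"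
  have \<eta>: "0 < \<eta>" "\<eta> \<le> 1 / 16" using \<epsilon> by (auto simp: \<eta>_def)
  have R\<eta>: "R * \<eta>\<^sup>2 * \<delta> \<ge> 45056" using R by (simp add: \<eta>_def power_divide)
  have R0: "real R > 0" using R by (cases "R = 0") auto
  have k0: "real k > 0" using k by simp
  have best: "measure_pmf.prob (best (R * k)) {y. \<not> (must \<longrightarrow> real m \<le> 2 * card (light (deg G y)))} \<le> \<delta>"
  proof (cases must)
    case True
    define u where "u = sqrt (2 * real m)"
    have u: "u > 0" "u\<^sup>2 = 2 * m" using m_pos by (auto simp: u_def)
    \<comment> \<open>So \<open>k\<close> is at least a constant times \<open>n / sqrt m\<close>,
      the order of the number of trials after which a heavy neighbour is expected;
      \<open>R * k\<close> trials fail with probability \<open>O(1 / R)\<close>.\<close>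
    have "(real n)\<^sup>2 \<le> 8 * m * (real k)\<^sup>2"
      using must[OF True] n_pos by (simp add: power_divide le_divide_eq)
    also have "\<dots> = (2 * u * k)\<^sup>2" by (simp add: power_mult_distrib u)
    finally have nu: "real n \<le> 2 * u * k" by (rule power2_le_imp_le) (use u k0 in simp)
    have "measure_pmf.prob (best (R * k)) {y. \<not> real m \<le> 2 * card (light (deg G y))} \<le> 16 * n / (real (Suc (R * k)) * u)"
      using prob_best_heavy[of "R * k"] by (simp add: u_def)
    also have "\<dots> \<le> 16 * (2 * u * k) / (real (R * k) * u)"
      using nu u R0 k0 by (intro frac_le mult_mono mult_pos_pos) auto
    also have "\<dots> = 32 / R" using u k0 by simp
    also have "\<dots> \<le> \<delta>"
    proof -
      have "\<epsilon>\<^sup>2 \<le> 1" using \<epsilon> by (simp add: power_le_one)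
      then have "(R * \<delta>) * \<epsilon>\<^sup>2 \<le> (R * \<delta>) * 1" using R0 \<delta> by (intro mult_left_mono) auto
      then have "32 \<le> R * \<delta>" using R by (simp add: mult_ac)
      then show ?thesis using R0 by (simp add: divide_le_eq mult.commute)
    qed
    finally show ?thesis using True by simp
  qed (use \<delta> in simp)
  have main: "measure_pmf.prob (sem G (bind_prog (total (R * k) (hit_prog y)) (\<lambda>K.
       if 2 * real R \<le> K then Ret (Some (real (deg G y) * real (R * k) / K))
       else bind_prog (total R (light_edges_prog (deg G y) k)) (\<lambda>A.
         if A < real R / 256 then Ret None
         else bind_prog (total R (pairs_prog k)) (\<lambda>C.
           bind_prog (total (R * k) (light_deg_prog (deg G y))) (\<lambda>B.
             Ret (Some (1 + B * C / (real (R * k) * A))))))))) {r. \<not> good \<epsilon> must r} \<le> \<delta> + 3 * \<delta>"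
    if heavy: "must \<longrightarrow> real m \<le> 2 * card (light (deg G y))" for y
  proof -
    let ?D = "deg G y"
    define x where "x = real (R * k) * (?D / n)"
    have x: "x \<ge> 0" by (simp add: x_def)
    have K: "measure_pmf.prob (sum_iid (R * k) (hit y)) {s. \<not> \<bar>s - x\<bar> < \<eta> * (x + R)} \<le> \<delta>"
    proof -
      have "measure_pmf.prob (sum_iid (R * k) (hit y)) {s. \<not> \<bar>s - x\<bar> < \<eta> * (x + R)} \<le> 1 / (\<eta>\<^sup>2 * R)"
        unfolding x_def expectation_hit(1)[symmetric]
        by (rule sum_iid_concentration[OF finite_hit]) (use \<eta> R0 in \<open>auto simp: expectation_hit\<close>)
      also have "\<dots> \<le> \<delta>" using R\<eta> R0 \<eta> by (simp add: divide_le_eq mult_ac)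
      finally show ?thesis .
    qed
    show ?thesis
      unfolding sem_bind sem_total sem_hit
    proof (rule prob_bind_le[OF K], use \<delta> in simp, goal_cases)
      case (1 K)
      show ?case
      proof (cases "2 * real R \<le> K")
        case True
        have xR: "real R \<le> x" and "\<bar>K - x\<bar> \<le> 2 * \<eta> * x"
          using relative_estimate[OF 1(2) True] \<eta> R0 by auto
        then have "(1 - 8 * (2 * \<eta>)) * n \<le> n * x / K" "n * x / K \<le> (1 + 8 * (2 * \<eta>)) * n"
          using \<eta> R0 by (intro inverse_estimate[of K x "2 * \<eta>"]; simp)+
        moreover have "n * x = real ?D * real (R * k)" using n_pos by (simp add: x_def)
        ultimately have "eps_approx \<epsilon> (real ?D * real (R * k) / K) n"
          by (simp add: eps_approx_def \<eta>_def)
        then show ?thesis using True \<delta> by (simp add: good_def)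
      next
        case False
        then have "x < 4 * R" using below_threshold[OF 1(2)] \<eta> R0 x by simp
        then have "R * (?D * (real k / n)) < real R * 4" by (simp add: x_def mult_ac)
        then have "?D * (real k / n) < 4" using R0 by (simp only: mult_less_cancel_left_pos)
        then show ?thesis
          using False phase_light[OF \<epsilon> k R \<delta> must, of must ?D] heavy by simp
      qed
    qed
  qed
  have "measure_pmf.prob (sem G (phase R k)) {r. \<not> good \<epsilon> must r} \<le> \<delta> + (\<delta> + 3 * \<delta>)"
    unfolding phase_def sem_bind sem_best sem_degree bind_return_pmf
    by (rule prob_bind_le[OF best]) (use \<delta> main[unfolded sem_bind] in auto)
  then show ?thesis by simp
qed

end

section \<open>Doubling of the sample size and the failure budget\<close>

definition reps :: "real \<Rightarrow> nat \<Rightarrow> nat" where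
  "reps \<epsilon> i = nat \<lceil>5767168000 * (real (i + 1) * real (i + 2)) / \<epsilon>\<^sup>2\<rceil>"

text \<open>The sizes start at 2, since a single vertex spans no pair and the lower bound in
  \<open>cover_bounds\<close> fails for it.\<close>

definition estimator :: "real \<Rightarrow> nat \<Rightarrow> real option prog" where
  "estimator \<epsilon> i = phase (reps \<epsilon> i) (2 ^ (i + 1))"

lemma reps_bounds:
  assumes "0 < \<epsilon>" "\<epsilon> < 1"
  shows "5767168000 * (real (i + 1) * real (i + 2)) / \<epsilon>\<^sup>2 \<le> reps \<epsilon> i"
    and "reps \<epsilon> i \<le> 2 * 5767168001 * (real (i + 1))\<^sup>2 / \<epsilon>\<^sup>2"
    and "reps \<epsilon> i > 0"
proof -
  let ?x = "5767168000 * (real (i + 1) * real (i + 2)) / \<epsilon>\<^sup>2"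
  have e: "0 < \<epsilon>\<^sup>2" "\<epsilon>\<^sup>2 \<le> 1" using assms by (auto simp: power_le_one)
  have x: "?x > 0" using e by simp
  show "?x \<le> reps \<epsilon> i" by (simp add: reps_def real_nat_ceiling_ge)
  then show "reps \<epsilon> i > 0" using x by linarith
  have "real (reps \<epsilon> i) \<le> ?x + 1" using x unfolding reps_def by linarith
  also have "1 \<le> real (i + 1) * real (i + 2) / \<epsilon>\<^sup>2"
  proof -
    have "1 * 1 \<le> real (i + 1) * real (i + 2)" by (intro mult_mono) auto
    then show ?thesis using e by (simp add: le_divide_eq)
  qed
  finally have "real (reps \<epsilon> i) \<le> 5767168001 * (real (i + 1) * real (i + 2)) / \<epsilon>\<^sup>2"
    by (simp add: add_divide_distrib)
  also have "\<dots> \<le> 5767168001 * (real (i + 1) * (2 * real (i + 1))) / \<epsilon>\<^sup>2"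
    using e by (intro divide_right_mono mult_left_mono) auto
  finally show "reps \<epsilon> i \<le> 2 * 5767168001 * (real (i + 1))\<^sup>2 / \<epsilon>\<^sup>2"
    by (simp add: power2_eq_square mult_ac)
qed

lemma reps_mono:
  assumes "0 < \<epsilon>" "i \<le> j"
  shows "reps \<epsilon> i \<le> reps \<epsilon> j"
  unfolding reps_def using assms
  by (intro nat_mono ceiling_mono divide_right_mono mult_left_mono mult_mono) auto

context input
begin

text \<open>Phases before \<open>L\<close> may abstain but not err; phase \<open>L\<close> has to
  answer. The failure probabilities telescope to less than 1/100.\<close>

lemma estimator_correct:
  assumes \<epsilon>: "0 < \<epsilon>" "\<epsilon> < 1"
    and small: "\<And>i. i \<le> L \<Longrightarrow> 2 ^ (i + 1) \<le> n \<and> m * (2 ^ (i + 1) / n)\<^sup>2 \<le> 2"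
    and large: "8 * m * (2 ^ (L + 1) / real n)\<^sup>2 \<ge> 1"
    and "i + l = L"
  shows "measure_pmf.prob (sem G (bind_prog (estimator \<epsilon> i) (continue (estimator \<epsilon>) l i))) {r. \<not> good \<epsilon> True r}
    \<le> (1 / (i + 1) - 1 / (i + l + 2)) / 100"
  using assms(5)
proof (induction l arbitrary: i)
  have phase: "measure_pmf.prob (sem G (estimator \<epsilon> i)) {r. \<not> good \<epsilon> must r} \<le> (1 / (real i + 1) - 1 / (real i + 2)) / 100"
    if i: "i \<le> L" and must: "must \<Longrightarrow> i = L" for i must
  proof -
    \<comment> \<open>Five times this budget is \<open>(1 / (i + 1) - 1 / (i + 2)) / 100\<close>,
      which telescopes. The constant of \<open>reps\<close> is \<open>500 * 11534336\<close>, as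
      \<open>phase_correct\<close> demands for this \<open>\<delta>\<close>.\<close>
    let ?d = "1 / (500 * (real (i + 1) * real (i + 2)))"
    have R: "reps \<epsilon> i * \<epsilon>\<^sup>2 * ?d \<ge> 11534336"
    proof -
      have "5767168000 * (real (i + 1) * real (i + 2)) \<le> reps \<epsilon> i * \<epsilon>\<^sup>2"
        using reps_bounds(1)[OF \<epsilon>, of i] \<epsilon> by (simp add: divide_le_eq)
      then have "5767168000 * (real (i + 1) * real (i + 2)) * ?d \<le> reps \<epsilon> i * \<epsilon>\<^sup>2 * ?d"
        by (rule mult_right_mono) simp
      then show ?thesis by simp
    qed
    have "measure_pmf.prob (sem G (estimator \<epsilon> i)) {r. \<not> good \<epsilon> must r} \<le> 5 * ?d"
      unfolding estimator_def
      by (rule phase_correct[OF \<epsilon> _ _ _ R]) (use small[OF i] large must in auto)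
    also have "\<dots> = (1 / (real i + 1) - 1 / (real i + 2)) / 100"
      by (simp add: divide_simps) (simp add: algebra_simps)
    finally show ?thesis .
  qed
  {
    case 0
    then show ?case using phase[of i True] by (simp add: bind_return_pmf')
  next
    case (Suc l)
    have "measure_pmf.prob (sem G (bind_prog (estimator \<epsilon> i) (continue (estimator \<epsilon>) (Suc l) i))) {r. \<not> good \<epsilon> True r}
      \<le> (1 / (real i + 1) - 1 / (real i + 2)) / 100 + (1 / (Suc i + 1) - 1 / (Suc i + l + 2)) / 100"
      unfolding sem_bind
    proof (rule prob_bind_le[OF phase[of i False]], goal_cases)
      case 3
      show ?case by (simp add: divide_simps)
    next
      case (4 r)
      show ?case
      proof (cases r)
        case None
        have "Suc i + l = L" using Suc.prems by simp
        from Suc.IH[OF this]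
        have "measure_pmf.prob (sem G (bind_prog (estimator \<epsilon> (Suc i)) (continue (estimator \<epsilon>) l (Suc i)))) {r. \<not> good \<epsilon> True r}
          \<le> (1 / (Suc i + 1) - 1 / (Suc i + l + 2)) / 100" by (simp add: add_ac del: sem_bind)
        then show ?thesis by (simp add: None del: sem_bind)
      next
        case (Some v)
        then have "measure_pmf.prob (sem G (continue (estimator \<epsilon>) (Suc l) i r)) {r. \<not> good \<epsilon> True r} = 0"
          using 4 by (simp add: good_def)
        then show ?thesis by (simp add: divide_simps)
      qed
    qed (use Suc.prems in auto)
    then show ?case by (simp add: add_divide_distrib diff_divide_distrib add_ac)
  }
qed

lemma estimator_safe:
  assumes \<epsilon>: "0 < \<epsilon>" "\<epsilon> < 1" and "i + l \<le> L"
  shows "safe G (bind_prog (estimator \<epsilon> i) (continue (estimator \<epsilon>) l i)) V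
    (Suc l * (21 * (reps \<epsilon> L * 2 ^ (L + 1)))) (\<lambda>_ _. True)"
  using assms(3)
proof (induction l arbitrary: i V)
  let ?C = "reps \<epsilon> L * 2 ^ (L + 1)"
  have C: "?C > 0" using reps_bounds(3)[OF \<epsilon>, of L] by simp
  have ph: "safe G (estimator \<epsilon> i) V (20 * ?C) (\<lambda>V' _. True)" if "i \<le> L" for i V
  proof -
    have "safe G (estimator \<epsilon> i) V (20 * (reps \<epsilon> i * 2 ^ (i + 1))) (\<lambda>V' _. V \<subseteq> V')"
      unfolding estimator_def using reps_bounds(3)[OF \<epsilon>, of i] by (intro safe_phase) auto
    moreover have "reps \<epsilon> i * 2 ^ (i + 1) \<le> ?C"
      using that reps_mono[OF \<epsilon>(1) that] by (intro mult_mono power_increasing) auto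
    ultimately show ?thesis by (elim safe_mono) auto
  qed
  {
    case 0
    have "safe G (bind_prog (estimator \<epsilon> i) (continue (estimator \<epsilon>) 0 i)) V (20 * ?C + 0) (\<lambda>_ _. True)"
      using 0 by (intro safe_bind[OF ph]) auto
    then show ?case by (rule safe_mono) auto
  next
    case (Suc l)
    \<comment> \<open>A phase is charged \<open>21 * ?C\<close>: 20 for its own queries, and the
      remainder covers the \<open>RandVert\<close> that separates it from the next.\<close>
    have "safe G (bind_prog (estimator \<epsilon> i) (continue (estimator \<epsilon>) (Suc l) i)) V (20 * ?C + (1 + Suc l * (21 * ?C))) (\<lambda>_ _. True)"
    proof (rule safe_bind[OF ph], goal_cases)
      case (2 V' r)
      have "safe G (bind_prog (estimator \<epsilon> (Suc i)) (continue (estimator \<epsilon>) l (Suc i))) V (Suc l * (21 * ?C)) (\<lambda>_ _. True)" for V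
        using Suc.prems by (intro Suc.IH) simp
      then show ?case by (cases r) (auto simp: advanced_model_def)
    qed (use Suc.prems in simp)
    then show ?case using C by (elim safe_mono) auto
  }
qed

lemma estimator_run:
  assumes \<epsilon>: "0 < \<epsilon>" "\<epsilon> < 1"
  shows "run_prob G (strat (estimator \<epsilon>)) (\<lambda>r t. eps_approx \<epsilon> r n \<and>
    real t \<le> 3875536896672 * ln n ^ 3 * (1 / \<epsilon>\<^sup>2 * sqrt (n / avg_deg G))) \<ge> 99 / 100"
proof -
  define s where "s = sqrt (n / avg_deg G)"
  have s2: "s\<^sup>2 = (real n)\<^sup>2 / (2 * m)" by (simp add: s_def avg_deg_def power2_eq_square)
  have n2: "real n \<ge> 2" and mn: "2 * real m \<le> (real n)\<^sup>2"
  proof -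
    have "2 * (n choose 2) \<le> n * n" by (simp add: choose_two) (meson diff_le_self mult_le_mono2 order_trans times_div_less_eq_dividend)
    then have "2 * m \<le> n * n" using bounds by linarith
    then have "real (2 * m) \<le> real (n * n)" by (simp only: of_nat_le_iff)
    then show "2 * real m \<le> (real n)\<^sup>2" by (simp add: power2_eq_square)
  qed (use bounds in simp)
  have m1: "real m \<ge> 1" using m_pos by simp
  have s_ge: "s \<ge> 1"
  proof (rule power2_le_imp_le)
    show "1\<^sup>2 \<le> s\<^sup>2" unfolding s2 using mn m1 by (simp add: le_divide_eq)
  qed (simp add: s_def avg_deg_def)
  have s_le: "s \<le> n"
  proof (rule power2_le_imp_le)
    have "(real n)\<^sup>2 * 1 \<le> (real n)\<^sup>2 * (2 * m)" using m1 by (intro mult_left_mono) auto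
    then show "s\<^sup>2 \<le> (real n)\<^sup>2" unfolding s2 using m1 by (simp add: divide_le_eq)
  qed simp
  \<comment> \<open>\<open>L\<close> is the first phase whose size \<open>k = 2 ^ (L + 1)\<close>
    satisfies \<open>s \<le> 2 * k\<close>, which after squaring is the condition for
    \<open>must\<close>. Minimality keeps \<open>k\<close> below \<open>s\<close>, except in phase
    0, where 2 may exceed \<open>s\<close>; hence the case distinctions on \<open>L\<close>.\<close>
  define L where "L = (LEAST l. s \<le> 2 ^ (l + 2))"
  have "\<exists>l. s \<le> 2 ^ (l + 2)"
  proof -
    obtain a where "s < 2 ^ a" using real_arch_pow[of 2 s] by auto
    also have "(2::real) ^ a \<le> 2 ^ (a + 2)" by (intro power_increasing) auto
    finally show ?thesis by (intro exI[of _ a]) simp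
  qed
  then have L1: "s \<le> 2 ^ (L + 2)" unfolding L_def by (rule LeastI_ex)
  have L2: "2 ^ (L + 1) < s" if "L \<noteq> 0"
  proof -
    have "\<not> s \<le> 2 ^ (L - 1 + 2)" using that unfolding L_def by (intro not_less_Least) simp
    moreover have "L - 1 + 2 = L + 1" using that by simp
    ultimately show ?thesis by simp
  qed
  have k2s: "2 ^ (L + 1) \<le> 2 * s" using L2 s_ge by (cases "L = 0") auto
  have kn: "2 ^ (L + 1) \<le> real n" using L2 s_le n2 by (cases "L = 0") auto
  have mk: "m * (2 ^ (L + 1) / n)\<^sup>2 \<le> 2"
  proof (cases "L = 0")
    case True
    then show ?thesis using mn n2 by (simp add: power_divide divide_le_eq)
  next
    case False
    then have "(2 ^ (L + 1))\<^sup>2 \<le> s\<^sup>2" using L2 by (intro power_mono) auto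
    then have "m * (2 ^ (L + 1) / n)\<^sup>2 \<le> m * (s\<^sup>2 / (real n)\<^sup>2)"
      unfolding power_divide by (intro mult_left_mono divide_right_mono) auto
    also have "\<dots> = 1 / 2" using m1 n2 by (simp add: s2)
    finally show ?thesis by simp
  qed
  have small: "2 ^ (i + 1) \<le> n \<and> m * (2 ^ (i + 1) / n)\<^sup>2 \<le> 2" if "i \<le> L" for i
  proof
    have le: "(2::real) ^ (i + 1) \<le> 2 ^ (L + 1)" using that by (intro power_increasing) auto
    then have "real (2 ^ (i + 1)) \<le> real n" using order_trans[OF le kn] by simp
    then show "2 ^ (i + 1) \<le> n" by (simp only: of_nat_le_iff)
    have "m * (2 ^ (i + 1) / n)\<^sup>2 \<le> m * (2 ^ (L + 1) / n)\<^sup>2"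
      using le by (intro mult_left_mono power_mono divide_right_mono) auto
    then show "m * (2 ^ (i + 1) / n)\<^sup>2 \<le> 2" using mk by linarith
  qed
  have large: "8 * m * (2 ^ (L + 1) / real n)\<^sup>2 \<ge> 1"
  proof -
    have "s\<^sup>2 \<le> (2 * 2 ^ (L + 1))\<^sup>2" using L1 s_ge by (intro power_mono) auto
    then have "(real n)\<^sup>2 \<le> 8 * m * (2 ^ (L + 1))\<^sup>2" unfolding s2 using m1 by (simp add: divide_le_eq power_mult_distrib mult_ac)
    then show ?thesis using n2 by (simp add: power_divide le_divide_eq)
  qed
  let ?w = "Suc L * (21 * (reps \<epsilon> L * 2 ^ (L + 1)))"
  let ?p = "sem G (bind_prog (estimator \<epsilon> 0) (continue (estimator \<epsilon>) L 0))"
  have "measure_pmf.prob ?p {r. \<not> good \<epsilon> True r} \<le> (1 / (real 0 + 1) - 1 / (0 + L + 2)) / 100"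
    using estimator_correct[OF \<epsilon> small large, of 0 L] by (simp add: add.commute del: sem_bind)
  also have "\<dots> \<le> 1 / 100" by simp
  finally have "measure_pmf.prob ?p {r. \<not> good \<epsilon> True r} \<le> 1 / 100" .
  moreover have "{r. \<exists>v. r = Some v \<and> eps_approx \<epsilon> v n} = UNIV - {r. \<not> good \<epsilon> True r}"
    by (auto simp: good_def split: option.splits)
  ultimately have "99 / 100 \<le> measure_pmf.prob ?p {r. \<exists>v. r = Some v \<and> eps_approx \<epsilon> v n}"
    by (simp add: measure_pmf.prob_compl[simplified])
  also have "\<dots> \<le> run_prob G (strat (estimator \<epsilon>)) (\<lambda>r t. eps_approx \<epsilon> r n \<and> t \<le> ?w)"
    by (rule run_prob_strat[OF estimator_safe[OF \<epsilon>]]) simp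
  also have "\<dots> \<le> run_prob G (strat (estimator \<epsilon>)) (\<lambda>r t. eps_approx \<epsilon> r n \<and>
    real t \<le> 3875536896672 * ln n ^ 3 * (1 / \<epsilon>\<^sup>2 * s))"
  proof -
    \<comment> \<open>Of the three logarithms, one comes from the number of phases and two from the
      quadratic growth of \<open>reps\<close>.\<close>
    have L: "real (L + 1) \<le> 2 * ln n"
    proof -
      have "real (L + 1) * ln 2 = ln (2 ^ (L + 1))" by (simp only: ln_realpow)
      also have "\<dots> \<le> ln n" using kn by (intro ln_mono) auto
      finally have "real (L + 1) * ln 2 \<le> ln n" .
      moreover have "real (L + 1) * (1 / 2) \<le> real (L + 1) * ln 2"
        using ln_le_minus_one[of "1 / 2"] by (intro mult_left_mono) (auto simp: ln_div)
      ultimately have "real (L + 1) * (1 / 2) \<le> ln n" by (rule order_trans[rotated])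
      then show ?thesis by simp
    qed
    have "real ?w = real (L + 1) * (21 * (real (reps \<epsilon> L) * 2 ^ (L + 1)))" by (simp add: algebra_simps)
    moreover have "real (reps \<epsilon> L) * 2 ^ (L + 1) \<le> (2 * 5767168001 * (real (L + 1))\<^sup>2 / \<epsilon>\<^sup>2) * (2 * s)"
      using s_ge by (intro mult_mono reps_bounds(2)[OF \<epsilon>] k2s) auto
    then have "real (L + 1) * (21 * (real (reps \<epsilon> L) * 2 ^ (L + 1))) \<le>
      real (L + 1) * (21 * ((2 * 5767168001 * (real (L + 1))\<^sup>2 / \<epsilon>\<^sup>2) * (2 * s)))"
      by (intro mult_left_mono) auto
    ultimately have "real ?w \<le> real (L + 1) * (21 * ((2 * 5767168001 * (real (L + 1))\<^sup>2 / \<epsilon>\<^sup>2) * (2 * s)))"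
      by simp
    also have "\<dots> = 484442112084 * real (L + 1) ^ 3 * (1 / \<epsilon>\<^sup>2 * s)"
      by (simp add: power2_eq_square power3_eq_cube)
    also have "\<dots> \<le> 484442112084 * (2 * ln n) ^ 3 * (1 / \<epsilon>\<^sup>2 * s)"
      using L s_ge by (intro mult_right_mono mult_left_mono power_mono) auto
    also have "\<dots> = 3875536896672 * ln n ^ 3 * (1 / \<epsilon>\<^sup>2 * s)" by (simp add: power_mult_distrib)
    finally have w: "real ?w \<le> 3875536896672 * ln n ^ 3 * (1 / \<epsilon>\<^sup>2 * s)" .
    show ?thesis unfolding run_prob_def
    proof (rule measure_spmf.finite_measure_mono)
      show "{(h, r). eps_approx \<epsilon> r n \<and> total_cost h \<le> ?w} \<subseteq>
        {(h, r). eps_approx \<epsilon> r n \<and> real (total_cost h) \<le> 3875536896672 * ln n ^ 3 * (1 / \<epsilon>\<^sup>2 * s)}"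
        using w by (auto simp del: of_nat_mult intro: order_trans[OF of_nat_mono])
    qed simp
  qed
  finally show ?thesis by (simp add: s_def)
qed

end

theorem theorem1p5:
  shows
    "(\<exists>(A :: real \<Rightarrow> strategy) (C :: real) (k :: nat). \<forall>\<epsilon>. 0 < \<epsilon> \<and> \<epsilon> < 1 \<longrightarrow>
        algorithm advanced_model (A \<epsilon>) \<and>
        (\<forall>G. input_graph G \<longrightarrow>
           run_prob G (A \<epsilon>) (\<lambda>r t. eps_approx \<epsilon> r (num_verts G) \<and>
              real t \<le> C * (ln (real (num_verts G))) ^ k *
                          (1 / \<epsilon>\<^sup>2 * sqrt (real (num_verts G) / avg_deg G)))
           \<ge> 99 / 100))
     \<and>
     (\<forall>M \<in> {advanced_model, full_adjacency_model}. \<forall>c::real. c \<ge> 1 \<longrightarrow>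
       (\<exists>\<delta>>0. \<forall>A. algorithm M A \<longrightarrow>
          (\<forall>G. input_graph G \<longrightarrow>
             run_prob G A (\<lambda>r t. factor_approx c r (num_verts G)) \<ge> 99 / 100) \<longrightarrow>
          (\<forall>n m. (\<exists>G. input_graph G \<and> num_verts G = n \<and> num_edges G = m) \<longrightarrow>
             (\<exists>G. input_graph G \<and> num_verts G = n \<and> num_edges G = m \<and>
                run_prob G A (\<lambda>r t. real t \<ge> \<delta> * sqrt (real n / avg_deg G)) \<ge> 9 / 10))))"
proof (intro conjI)
  show "\<exists>(A :: real \<Rightarrow> strategy) (C :: real) (k :: nat). \<forall>\<epsilon>. 0 < \<epsilon> \<and> \<epsilon> < 1 \<longrightarrow>
        algorithm advanced_model (A \<epsilon>) \<and>
        (\<forall>G. input_graph G \<longrightarrow>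
           run_prob G (A \<epsilon>) (\<lambda>r t. eps_approx \<epsilon> r (num_verts G) \<and>
              real t \<le> C * (ln (real (num_verts G))) ^ k *
                          (1 / \<epsilon>\<^sup>2 * sqrt (real (num_verts G) / avg_deg G)))
           \<ge> 99 / 100)"
    by (rule exI[of _ "\<lambda>\<epsilon>. strat (estimator \<epsilon>)"], rule exI[of _ 3875536896672], rule exI[of _ 3])
      (intro allI impI conjI algorithm_strat input.estimator_run input.intro; elim conjE)
  show "\<forall>M \<in> {advanced_model, full_adjacency_model}. \<forall>c::real. c \<ge> 1 \<longrightarrow>
       (\<exists>\<delta>>0. \<forall>A. algorithm M A \<longrightarrow>
          (\<forall>G. input_graph G \<longrightarrow>
             run_prob G A (\<lambda>r t. factor_approx c r (num_verts G)) \<ge> 99 / 100) \<longrightarrow>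
          (\<forall>n m. (\<exists>G. input_graph G \<and> num_verts G = n \<and> num_edges G = m) \<longrightarrow>
             (\<exists>G. input_graph G \<and> num_verts G = n \<and> num_edges G = m \<and>
                run_prob G A (\<lambda>r t. real t \<ge> \<delta> * sqrt (real n / avg_deg G)) \<ge> 9 / 10)))"
  \<comment> \<open>The constant does not depend on \<open>c\<close>, which only determines the
    number of copies; that number does not enter the collision bound.\<close>
  proof (intro ballI allI impI, rule exI[of _ "1 / 20"], intro conjI allI impI, simp)
    fix M c A n m
    assume "1 \<le> c" "algorithm M A"
      and "\<forall>G. input_graph G \<longrightarrow> run_prob G A (\<lambda>r t. factor_approx c r (num_verts G)) \<ge> 99 / 100"
      and "\<exists>G. input_graph G \<and> num_verts G = n \<and> num_edges G = m"
    then show "\<exists>G. input_graph G \<and> num_verts G = n \<and> num_edges G = m \<and>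
                run_prob G A (\<lambda>r t. real t \<ge> 1 / 20 * sqrt (real n / avg_deg G)) \<ge> 9 / 10"
      using lower_bound[of c M A] by blast
  qed
qed

end
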